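(* Let $\Sigma$ be a compact connected immersed surface of revolution in $\mathbb{R}^3$ with one smooth boundary component, equipped with the Riemannian metric induced by the Euclidean metric. Let $R$ be the radius of the circle $\partial\Sigma$ and let $D$ be a flat disc in $\mathbb{R}^2$ of radius $R$. Let $0<\lambda_1(\Sigma)<\lambda_2(\Sigma)\le\lambda_3(\Sigma)\le\cdots$ be the Dirichlet eigenvalues of $-\Delta_\Sigma$ and let $0<\lambda_1(D)<\lambda_2(D)\le\lambda_3(D)\le\cdots$ be the Dirichlet eigenvalues of $-\Delta$ on $D$, both listed with multiplicity. If $\Sigma$ is not equal to $D$ (that is, $\Sigma$ is not the flat disc of radius $R$ bounded by $\partial\Sigma$), then for every $j=1,2,3,\ldots$, $$\lambda_j(\Sigma)<\lambda_j(D).$$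
   Context: $\Delta_\Sigma$ is the Laplace-Beltrami operator of the induced metric on $\Sigma$, and $\Delta$ is the Euclidean Laplacian on $\mathbb{R}^2$. The surface of revolution $\Sigma$ is described by its meridian as follows. Identify isometrically a plane containing the axis of symmetry with $\mathbb{R}^2$ so that the axis is $\{x=0\}$, and put $\mathbb{R}^2_+=\{(x,y)\in\mathbb{R}^2:x\ge 0\}$. The meridian $\Sigma\cap\mathbb{R}^2_+$ has a regular arc-length parametrization $\alpha=(F_\alpha,G_\alpha):[0,L]\to\mathbb{R}^2_+$ (not necessarily injective, since $\Sigma$ is only immersed) with $\alpha(0)=(R,0)$, $F_\alpha>0$ on $[0,L)$ and $F_\alpha(L)=0$; $\Sigma$ is obtained by rotating $\alpha$ about the axis and is a smooth surface (in particular $\alpha$ meets the axis orthogonally, $\alpha'(L)=(-1,0)$). Thus the induced metric is $dt^2+F_\alpha(t)^2\,d\theta^2$. The case of the flat disc corresponds to $\alpha(t)=(R-t,0)$, $t\in[0,R]$. *)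

theory Defs
  imports "HOL-Analysis.Analysis" "HOL-Library.Function_Algebras"
begin

section \<open>Smooth functions\<close>

definition partial_deriv :: "'a::euclidean_space \<Rightarrow> ('a \<Rightarrow> 'b::real_normed_vector) \<Rightarrow> 'a \<Rightarrow> 'b"
  where "partial_deriv b f z = vector_derivative (\<lambda>t. f (z + t *\<^sub>R b)) (at 0)"

text \<open>Class \<open>C\<^sup>k\<close>; meant for open sets \<open>U\<close>.\<close>

primrec Ck_on :: "nat \<Rightarrow> 'a::euclidean_space set \<Rightarrow> ('a \<Rightarrow> 'b::real_normed_vector) \<Rightarrow> bool"
  where
    "Ck_on 0 U f \<longleftrightarrow> continuous_on U f"
  | "Ck_on (Suc k) U f \<longleftrightarrow> continuous_on U f \<and>
       (\<forall>b\<in>Basis. (\<forall>z\<in>U. (\<lambda>t. f (z + t *\<^sub>R b)) differentiable (at (0::real)))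
                 \<and> Ck_on k U (partial_deriv b f))"

text \<open>For a set that need not be open, smooth means that there is a smooth extension to an open
  neighbourhood.\<close>

definition smooth_on :: "'a::euclidean_space set \<Rightarrow> ('a \<Rightarrow> 'b::real_normed_vector) \<Rightarrow> bool"
  where "smooth_on S f \<longleftrightarrow>
    (\<exists>U g. open U \<and> S \<subseteq> U \<and> (\<forall>k. Ck_on k U g) \<and> (\<forall>z\<in>S. g z = f z))"


section \<open>Laplace operators\<close>

definition laplacian :: "('a::euclidean_space \<Rightarrow> real) \<Rightarrow> 'a \<Rightarrow> real"
  where "laplacian u z = (\<Sum>b\<in>Basis. partial_deriv b (partial_deriv b u) z)"

definition induced_metric :: "(real^2 \<Rightarrow> real^3) \<Rightarrow> real^2 \<Rightarrow> real^2^2"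
  where "induced_metric X z =
    (\<chi> i j. partial_deriv (axis i 1) X z \<bullet> partial_deriv (axis j 1) X z)"

text \<open>Laplace--Beltrami operator of the metric induced by the immersion \<open>X\<close>, written in the
  coordinates of the parameter domain.\<close>

definition laplace_beltrami :: "(real^2 \<Rightarrow> real^3) \<Rightarrow> (real^2 \<Rightarrow> real) \<Rightarrow> real^2 \<Rightarrow> real"
  where "laplace_beltrami X u z =
    (1 / sqrt (det (induced_metric X z))) *
    (\<Sum>i\<in>UNIV. partial_deriv (axis i 1)
       (\<lambda>w. sqrt (det (induced_metric X w)) *
            (\<Sum>j\<in>UNIV. matrix_inv (induced_metric X w) $ i $ j * partial_deriv (axis j 1) u w)) z)"


section \<open>Dirichlet eigenvalues\<close>

global_interpretation fun_space: vector_space "\<lambda>(c::real) (f::'a \<Rightarrow> real) x. c * f x"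
  by unfold_locales (auto simp: fun_eq_iff algebra_simps)

text \<open>Classical eigenfunctions, of class \<open>C\<^sup>2\<close> inside and continuous up to the boundary, where they
  vanish. They are extended by zero outside the domain, so that functions that agree on the domain
  are equal. The zero function is included.\<close>

definition dirichlet_eigenspace ::
  "(('a::euclidean_space \<Rightarrow> real) \<Rightarrow> 'a \<Rightarrow> real) \<Rightarrow> 'a set \<Rightarrow> real \<Rightarrow> ('a \<Rightarrow> real) set"
  where "dirichlet_eigenspace A \<Omega> \<mu> =
    {u. Ck_on 2 \<Omega> u \<and> continuous_on (closure \<Omega>) u \<and> (\<forall>z. z \<notin> \<Omega> \<longrightarrow> u z = 0) \<and>
        (\<forall>z\<in>\<Omega>. - A u z = \<mu> * u z)}"

text \<open>The sequence \<open>lam 1, lam 2, \<dots>\<close> lists the Dirichlet eigenvalues of \<open>-A\<close> on \<open>\<Omega>\<close> in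
  nondecreasing order, each repeated according to the dimension of its eigenspace; a real number
  with trivial eigenspace does not occur. The value \<open>lam 0\<close> is irrelevant.\<close>

definition dirichlet_eigenvalues ::
  "(('a::euclidean_space \<Rightarrow> real) \<Rightarrow> 'a \<Rightarrow> real) \<Rightarrow> 'a set \<Rightarrow> (nat \<Rightarrow> real) \<Rightarrow> bool"
  where "dirichlet_eigenvalues A \<Omega> lam \<longleftrightarrow>
    mono_on {1..} lam \<and>
    (\<forall>\<mu>. finite {j. 1 \<le> j \<and> lam j = \<mu>} \<and>
         (\<exists>B. finite B \<and> \<not> fun_space.dependent B \<and>
              fun_space.span B = dirichlet_eigenspace A \<Omega> \<mu> \<and>
              card B = card {j. 1 \<le> j \<and> lam j = \<mu>}))"


section \<open>Surfaces of revolution\<close>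

text \<open>The meridian \<open>(F, G)\<close> on \<open>[0, L]\<close>, rotated about the third axis. The parameter domain is the
  closed disc of radius \<open>L\<close> in the plane, with polar coordinates \<open>(L - t, \<theta>)\<close>: the centre is the pole
  \<open>t = L\<close> (there division by zero gives the intended value when \<open>F L = 0\<close>) and the bounding circle
  is \<open>t = 0\<close>.\<close>

definition revolve :: "real \<Rightarrow> (real \<Rightarrow> real) \<Rightarrow> (real \<Rightarrow> real) \<Rightarrow> real^2 \<Rightarrow> real^3"
  where "revolve L F G z =
    vector [F (L - norm z) * (z $ 1 / norm z), F (L - norm z) * (z $ 2 / norm z), G (L - norm z)]"

text \<open>The last condition says that the rotated surface is smooth, at the pole and up to the boundary
  as well. With the conditions on the meridian it makes \<open>revolve L F G\<close> an immersion, forces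
  \<open>F' L = -1\<close> and \<open>G' L = 0\<close>, and makes \<open>F\<close> and \<open>G\<close> smooth on \<open>[0, L]\<close>.\<close>

definition surface_of_revolution ::
  "real \<Rightarrow> real \<Rightarrow> (real \<Rightarrow> real) \<Rightarrow> (real \<Rightarrow> real) \<Rightarrow> bool"
  where "surface_of_revolution R L F G \<longleftrightarrow>
    0 < L \<and> F 0 = R \<and> G 0 = 0 \<and> (\<forall>t\<in>{0..<L}. 0 < F t) \<and> F L = 0 \<and>
    (\<exists>F' G'. \<forall>t\<in>{0..L}.
        (F has_real_derivative F' t) (at t within {0..L}) \<and>
        (G has_real_derivative G' t) (at t within {0..L}) \<and>
        (F' t)\<^sup>2 + (G' t)\<^sup>2 = 1) \<and>
    smooth_on (cball 0 L) (revolve L F G)"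

definition flat_disc :: "real \<Rightarrow> (real^3) set"
  where "flat_disc R = {p. (p $ 1)\<^sup>2 + (p $ 2)\<^sup>2 \<le> R\<^sup>2 \<and> p $ 3 = 0}"

end

theory Submission
  imports Defs
begin

text \<open>Writing \<open>r = L - t\<close> for the distance to the pole, the surface carries the metric
  \<open>dr\<^sup>2 + f(r)\<^sup>2 d\<theta>\<^sup>2\<close> with \<open>f(r) = F(L - r)\<close>. The map \<open>(r, \<theta>) \<mapsto> (\<rho>(r), \<theta>)\<close> with
  \<open>\<rho>' / \<rho> = 1 / f\<close> and \<open>\<rho>(L) = R\<close> is conformal onto the disc of radius \<open>R\<close>, so the eigenvalue problem
  on the surface becomes \<open>- \<Delta> u = \<mu> \<Phi> u\<close> on the disc with the radial weight \<open>\<Phi> = (f / \<rho>)\<^sup>2\<close>. Since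
  \<open>f' \<le> 1\<close>, the function \<open>ln (f / \<rho>)\<close> is nonincreasing in \<open>r\<close> and vanishes on the boundary; hence
  \<open>\<Phi> \<ge> 1\<close>, and \<open>\<Phi> > 1\<close> near the pole unless the surface is the flat disc.

  Separation of variables avoids the spectral theorem: the mode with angular frequency \<open>k\<close> has the
  eigenvalue \<open>\<mu>\<close> iff the Pruefer angle at \<open>R\<close> of the solution that is regular at the centre is a
  multiple of \<open>\<pi>\<close>. The angle depends continuously on \<open>\<mu>\<close> and, by a Sturm comparison, strictly
  increases with \<open>\<mu> \<Phi>\<close>. So for each eigenvalue of mode \<open>k\<close> of the disc the intermediate value theorem
  yields a strictly smaller one of mode \<open>k\<close> of the surface with the same angle, and different ones
  yield different ones. It remains that the modes exhaust the eigenspaces of the disc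
  (completeness of Fourier series), and that they are linearly independent on the surface.\<close>

section \<open>The radial equation\<close>

text \<open>The separated equation is singular at the centre, and the intermediate value theorem
  needs solutions that are continuous jointly in radius and parameter, down to parameter 0. So the
  regular solution is built directly, as an everywhere convergent series in \<mu> over a weight that
  is merely continuous; its zeros at \<open>R\<close> stand for the eigenvalues of a mode.

  The weight of a surface may equal 1 on an outer part of the disc. Strictness of the comparison
  therefore has to be gained near the pole and carried outwards.

  The count is asymmetric. The lists come with finite bases, so it is enough to bound a disc
  eigenspace from above by its modes and a surface eigenspace from below. The upper bound concerns
  arbitrary eigenfunctions, hence completeness; the lower bound needs explicit eigenfunctions only.

  Those must be C^2 at the pole in Cartesian coordinates, where the operator is given by matrices.
  This is why modes are harmonic polynomials times radial functions, and why radial quantities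
  appear with their power of \<open>r\<close> divided out.\<close>

definition radial_average :: "nat \<Rightarrow> (real \<Rightarrow> real) \<Rightarrow> real \<Rightarrow> real" where
  "radial_average m \<phi> r =
    (if r = 0 then \<phi> 0 / (m + 1) else integral {0..r} (\<lambda>t. t ^ m * \<phi> t) / r ^ (m + 1))"

lemma power_mult_radial_average:
  "0 \<le> r \<Longrightarrow> r ^ (m + 1) * radial_average m \<phi> r = integral {0..r} (\<lambda>t. t ^ m * \<phi> t)"
  by (auto simp: radial_average_def)

lemma has_integral_power_Icc:
  fixes r :: real
  assumes "0 \<le> r"
  shows "((\<lambda>t. t ^ m) has_integral r ^ (m + 1) / (m + 1)) {0..r}"
proof -
  have "((\<lambda>t. t ^ m) has_integral (r ^ (m + 1) / (m + 1) - 0 ^ (m + 1) / (m + 1))) {0..r}"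
  proof (rule fundamental_theorem_of_calculus[OF assms])
    fix x :: real
    show "((\<lambda>t. t ^ (m + 1) / real (m + 1)) has_vector_derivative x ^ m) (at x within {0..r})"
      unfolding has_real_derivative_iff_has_vector_derivative[symmetric]
      by (rule derivative_eq_intros refl | simp add: add_pos_nonneg)+ 
  qed
  then show ?thesis by simp
qed

lemma abs_radial_average_le:
  assumes "0 \<le> r" "continuous_on {0..r} \<phi>" "\<And>t. t \<in> {0..r} \<Longrightarrow> \<bar>\<phi> t\<bar> \<le> C"
  shows "\<bar>radial_average m \<phi> r\<bar> \<le> C"
proof -
  have C: "0 \<le> C" using assms(3)[of 0] assms(1) by auto
  have *: "x / (real m + 1) \<le> x" if "0 \<le> x" for x :: real
    using that by (simp add: divide_le_eq mult_le_cancel_left1 algebra_simps)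
  show ?thesis
  proof (cases "r = 0")
    case True
    have "\<bar>\<phi> 0\<bar> / (real m + 1) \<le> \<bar>\<phi> 0\<bar>" by (rule *) simp
    then show ?thesis using assms(3)[of 0] True by (simp add: radial_average_def add.commute)
  next
    case False
    with assms have r: "0 < r" by simp
    have "norm (integral {0..r} (\<lambda>t. t ^ m * \<phi> t)) \<le> integral {0..r} (\<lambda>t. C * t ^ m)"
    proof (rule integral_norm_bound_integral)
      show "(\<lambda>t. t ^ m * \<phi> t) integrable_on {0..r}"
        by (intro integrable_continuous_interval continuous_intros assms)
      show "(\<lambda>t. C * t ^ m) integrable_on {0..r}"
        by (intro integrable_continuous_interval continuous_intros)
      fix t assume "t \<in> {0..r}"
      then show "norm (t ^ m * \<phi> t) \<le> C * t ^ m"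
        using assms(3)[of t] by (simp add: abs_mult mult.commute mult_right_mono)
    qed
    also have "\<dots> = C * (r ^ (m + 1) / (m + 1))"
      using has_integral_mult_right[OF has_integral_power_Icc[OF assms(1), of m], of C]
      by (intro integral_unique) simp
    also have "\<dots> \<le> C * r ^ (m + 1)"
      using *[of "r ^ (m + 1)"] r C by (intro mult_left_mono) (auto simp: add.commute)
    finally show ?thesis
      using r False by (simp add: radial_average_def abs_mult pos_divide_le_eq)
  qed
qed

lemma radial_average_nonneg:
  assumes "0 \<le> r" "continuous_on {0..r} \<phi>" "\<And>t. t \<in> {0..r} \<Longrightarrow> 0 \<le> \<phi> t"
  shows "0 \<le> radial_average m \<phi> r"
proof -
  have "0 \<le> integral {0..r} (\<lambda>t. t ^ m * \<phi> t)"
  proof (rule integral_nonneg)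
    show "(\<lambda>t. t ^ m * \<phi> t) integrable_on {0..r}"
      by (intro integrable_continuous_interval continuous_intros assms)
  qed (use assms(3) in auto)
  then show ?thesis
    using assms(1) assms(3)[of 0] by (simp add: radial_average_def)
qed

lemma radial_average_minus_const:
  assumes "0 \<le> r" "continuous_on {0..r} \<phi>"
  shows "radial_average m (\<lambda>t. \<phi> t - c) r = radial_average m \<phi> r - c / (m + 1)"
proof (cases "r = 0")
  case True
  then show ?thesis by (simp add: radial_average_def diff_divide_distrib)
next
  case False
  have "((\<lambda>t. t ^ m * \<phi> t - c * t ^ m) has_integral
      integral {0..r} (\<lambda>t. t ^ m * \<phi> t) - c * (r ^ (m + 1) / (m + 1))) {0..r}"
    using assms
    by (intro has_integral_diff has_integral_mult_right has_integral_power_Icc integrable_integral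
        integrable_continuous_interval continuous_intros)
  then have *: "integral {0..r} (\<lambda>t. t ^ m * (\<phi> t - c)) =
      integral {0..r} (\<lambda>t. t ^ m * \<phi> t) - c * (r ^ (m + 1) / (m + 1))"
    by (intro integral_unique) (simp add: algebra_simps)
  show ?thesis
    unfolding radial_average_def * using False by (simp add: diff_divide_distrib)
qed

lemma has_real_derivative_power_mult_radial_average:
  assumes "continuous_on {0..R} \<phi>" "r \<in> {0..R}"
  shows "((\<lambda>r. integral {0..r} (\<lambda>t. t ^ m * \<phi> t)) has_real_derivative r ^ m * \<phi> r)
    (at r within {0..R})"
  by (rule integral_has_real_derivative) (intro continuous_intros assms)+

text \<open>Away from the centre this is a quotient of continuous functions. At the centre the
  average of the difference between \<open>\<phi>\<close> and \<open>\<phi> 0\<close> is bounded by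
  the oscillation of \<open>\<phi>\<close> near 0, and the constant part averages to the prescribed
  value.\<close>

lemma continuous_on_radial_average:
  assumes "continuous_on {0..R} \<phi>"
  shows "continuous_on {0..R} (radial_average m \<phi>)"
proof (rule continuous_on_eq_continuous_within[THEN iffD2], rule ballI)
  fix r assume r: "r \<in> {0..R}"
  show "continuous (at r within {0..R}) (radial_average m \<phi>)"
  proof (cases "r = 0")
    case False
    have "continuous_on {0<..R} (\<lambda>r. integral {0..r} (\<lambda>t. t ^ m * \<phi> t) / r ^ (m + 1))"
    proof (intro continuous_intros)
      have "continuous_on {0..R} (\<lambda>r. integral {0..r} (\<lambda>t. t ^ m * \<phi> t))"
        using has_real_derivative_power_mult_radial_average[OF assms]
        by (intro DERIV_continuous_on) blast
      then show "continuous_on {0<..R} (\<lambda>r. integral {0..r} (\<lambda>t. t ^ m * \<phi> t))"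
        by (rule continuous_on_subset) auto
    qed auto
    then have "continuous_on {0<..R} (radial_average m \<phi>)"
      by (rule continuous_on_eq) (auto simp: radial_average_def)
    then have "continuous (at r within {0<..R}) (radial_average m \<phi>)"
      using r False by (simp add: continuous_on_eq_continuous_within)
    moreover have "at r within {0..R} = at r within {0<..R}"
      by (rule at_within_nhd[of r "{0<..}"]) (use r False in auto)
    ultimately show ?thesis by simp
  next
    case True
    show ?thesis unfolding True continuous_within_eps_delta
    proof (intro allI impI)
      fix e :: real assume e: "0 < e"
      obtain d where d: "d > 0" "\<And>t. t \<in> {0..R} \<Longrightarrow> dist t 0 < d \<Longrightarrow> dist (\<phi> t) (\<phi> 0) < e / 2"
        using assms r True e unfolding continuous_on_iff by (metis half_gt_zero)
      have "dist (radial_average m \<phi> t) (radial_average m \<phi> 0) < e"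
        if t: "t \<in> {0..R}" "dist t 0 < d" for t
      proof -
        have "\<bar>radial_average m (\<lambda>s. \<phi> s - \<phi> 0) t\<bar> \<le> e / 2"
        proof (rule abs_radial_average_le)
          fix s assume "s \<in> {0..t}"
          then show "\<bar>\<phi> s - \<phi> 0\<bar> \<le> e / 2"
            using d(2)[of s] t by (auto simp: dist_real_def)
        qed (use t assms in \<open>auto intro!: continuous_intros intro: continuous_on_subset\<close>)
        then show ?thesis
          using t e radial_average_minus_const[of t \<phi> m "\<phi> 0"] continuous_on_subset[OF assms, of "{0..t}"]
          by (auto simp: dist_real_def radial_average_def[of _ _ 0])
      qed
      then show "\<exists>d>0. \<forall>t\<in>{0..R}. dist t 0 < d \<longrightarrow>
          dist (radial_average m \<phi> t) (radial_average m \<phi> 0) < e"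
        using d(1) by blast
    qed
  qed
qed


text \<open>One theory serves both sides: weight 1 is the disc, the conformal weight is the surface.
  The sign condition makes the coefficients of the series below nonnegative, which excludes
  eigenvalues \<open>\<mu> \<le> 0\<close>.\<close>

locale radial_weight =
  fixes R :: real and \<Phi> :: "real \<Rightarrow> real"
  assumes R_pos: "0 < R"
    and weight_cont: "continuous_on {0..R} \<Phi>"
    and weight_nonneg: "\<And>r. r \<in> {0..R} \<Longrightarrow> 0 \<le> \<Phi> r"
begin

text \<open>The substitution \<open>w = r\<^sup>k h\<close> turns \<open>r (r w')' = (k\<^sup>2 - \<mu> r\<^sup>2 \<Phi>) w\<close> into
  \<open>(r\<^sup>2\<^sup>k\<^sup>+\<^sup>1 h')' = - \<mu> r\<^sup>2\<^sup>k\<^sup>+\<^sup>1 \<Phi> h\<close>. The solution with \<open>h 0 = 1\<close> is a power series in \<open>\<mu>\<close>; \<open>rad_flux\<close> is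
  \<open>- h' / (\<mu> r)\<close>, which remains continuous at the centre and at \<open>\<mu> = 0\<close>.\<close>

primrec rad_iter :: "nat \<Rightarrow> nat \<Rightarrow> real \<Rightarrow> real" where
  "rad_iter k 0 = (\<lambda>r. 1)"
| "rad_iter k (Suc n) =
    (\<lambda>r. integral {0..r} (\<lambda>t. t * radial_average (2 * k + 1) (\<lambda>s. \<Phi> s * rad_iter k n s) t))"

definition flux_iter :: "nat \<Rightarrow> nat \<Rightarrow> real \<Rightarrow> real" where
  "flux_iter k n = radial_average (2 * k + 1) (\<lambda>s. \<Phi> s * rad_iter k n s)"

definition rad_sol :: "nat \<Rightarrow> real \<Rightarrow> real \<Rightarrow> real" where
  "rad_sol k \<mu> r = (\<Sum>n. (- \<mu>) ^ n * rad_iter k n r)"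

definition rad_flux :: "nat \<Rightarrow> real \<Rightarrow> real \<Rightarrow> real" where
  "rad_flux k \<mu> r = (\<Sum>n. (- \<mu>) ^ n * flux_iter k n r)"

lemma rad_iter_Suc: "rad_iter k (Suc n) = (\<lambda>r. integral {0..r} (\<lambda>t. t * flux_iter k n t))"
  by (simp add: flux_iter_def)

declare rad_iter.simps(2) [simp del]

lemma continuous_on_rad_iter: "continuous_on {0..R} (rad_iter k n)"
  and continuous_on_flux_iter: "continuous_on {0..R} (flux_iter k n)"
proof -
  have *: "continuous_on {0..R} (flux_iter k n)" if "continuous_on {0..R} (rad_iter k n)" for n
    unfolding flux_iter_def
    by (intro continuous_on_radial_average continuous_intros weight_cont that)
  show "continuous_on {0..R} (rad_iter k n)"
  proof (induction n)
    case (Suc n)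
    have "continuous_on {0..R} (\<lambda>t. t * flux_iter k n t)"
      by (intro continuous_intros *[OF Suc])
    from integral_has_real_derivative[OF this]
    show ?case unfolding rad_iter_Suc by (intro DERIV_continuous_on) blast
  qed simp
  then show "continuous_on {0..R} (flux_iter k n)" by (rule *)
qed

lemma rad_iter_nonneg: "r \<in> {0..R} \<Longrightarrow> 0 \<le> rad_iter k n r"
proof (induction n arbitrary: r)
  case (Suc n)
  show ?case unfolding rad_iter_Suc
  proof (rule integral_nonneg)
    show "(\<lambda>t. t * flux_iter k n t) integrable_on {0..r}"
      using Suc.prems continuous_on_subset[OF continuous_on_flux_iter, of "{0..r}"]
      by (intro integrable_continuous_interval continuous_intros) auto
    fix t assume "t \<in> {0..r}"
    then show "0 \<le> t * flux_iter k n t" unfolding flux_iter_def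
      using Suc.prems weight_nonneg continuous_on_subset[OF weight_cont, of "{0..t}"]
        continuous_on_subset[OF continuous_on_rad_iter, of "{0..t}" k n]
      by (intro mult_nonneg_nonneg radial_average_nonneg Suc.IH continuous_intros) auto
  qed
qed simp

definition weight_bound :: real where
  "weight_bound = (SOME B. 0 \<le> B \<and> (\<forall>r\<in>{0..R}. \<bar>\<Phi> r\<bar> \<le> B))"

lemma weight_bound_nonneg: "0 \<le> weight_bound"
  and abs_weight_le: "r \<in> {0..R} \<Longrightarrow> \<bar>\<Phi> r\<bar> \<le> weight_bound"
proof -
  have "bounded (\<Phi> ` {0..R})"
    using compact_continuous_image[OF weight_cont] by (simp add: compact_imp_bounded)
  then obtain B where "\<forall>r\<in>{0..R}. \<bar>\<Phi> r\<bar> \<le> B"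
    unfolding bounded_iff by auto
  moreover from this have "0 \<le> B"
    using R_pos by (metis abs_ge_zero atLeastAtMost_iff less_eq_real_def order_refl order_trans)
  ultimately have "\<exists>B. 0 \<le> B \<and> (\<forall>r\<in>{0..R}. \<bar>\<Phi> r\<bar> \<le> B)" by blast
  from someI_ex[OF this] show "0 \<le> weight_bound"
    "r \<in> {0..R} \<Longrightarrow> \<bar>\<Phi> r\<bar> \<le> weight_bound"
    unfolding weight_bound_def by auto
qed

lemma abs_flux_iter_le:
  assumes "r \<in> {0..R}" "\<And>t. t \<in> {0..R} \<Longrightarrow> \<bar>rad_iter k n t\<bar> \<le> (weight_bound * t\<^sup>2) ^ n / fact n"
  shows "\<bar>flux_iter k n r\<bar> \<le> weight_bound * ((weight_bound * r\<^sup>2) ^ n / fact n)"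
  unfolding flux_iter_def
proof (rule abs_radial_average_le)
  show "continuous_on {0..r} (\<lambda>s. \<Phi> s * rad_iter k n s)"
    using assms(1) continuous_on_subset[OF weight_cont, of "{0..r}"]
        continuous_on_subset[OF continuous_on_rad_iter, of "{0..r}" k n]
    by (intro continuous_intros) auto
  fix t assume t: "t \<in> {0..r}"
  with assms(1) have tR: "t \<in> {0..R}" by auto
  have "\<bar>rad_iter k n t\<bar> \<le> (weight_bound * t\<^sup>2) ^ n / fact n"
    by (rule assms(2)[OF tR])
  also have "\<dots> \<le> (weight_bound * r\<^sup>2) ^ n / fact n"
    using t weight_bound_nonneg
    by (intro divide_right_mono power_mono mult_left_mono) auto
  finally show "\<bar>\<Phi> t * rad_iter k n t\<bar> \<le> weight_bound * ((weight_bound * r\<^sup>2) ^ n / fact n)"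
    unfolding abs_mult using abs_weight_le[OF tR] weight_bound_nonneg
    by (intro mult_mono) auto
qed (use assms in auto)

text \<open>Each iteration costs one factor \<open>weight_bound\<close> and integrates
  \<open>t ^ (2 * n + 1)\<close>; the resulting denominator supplies the next factor of the
  factorial, so the series is dominated by an exponential one.\<close>

lemma abs_rad_iter_le:
  "r \<in> {0..R} \<Longrightarrow> \<bar>rad_iter k n r\<bar> \<le> (weight_bound * r\<^sup>2) ^ n / fact n"
proof (induction n arbitrary: r)
  case (Suc n)
  let ?B = weight_bound
  have r: "0 \<le> r" using Suc.prems by auto
  have "norm (integral {0..r} (\<lambda>t. t * flux_iter k n t)) \<le>
      integral {0..r} (\<lambda>t. (?B ^ (n + 1) / fact n) * t ^ (2 * n + 1))"
  proof (rule integral_norm_bound_integral)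
    show "(\<lambda>t. t * flux_iter k n t) integrable_on {0..r}"
      using Suc.prems continuous_on_subset[OF continuous_on_flux_iter, of "{0..r}"]
      by (intro integrable_continuous_interval continuous_intros) auto
    show "(\<lambda>t. (?B ^ (n + 1) / fact n) * t ^ (2 * n + 1)) integrable_on {0..r}"
      by (intro integrable_continuous_interval continuous_intros)
    fix t assume "t \<in> {0..r}"
    then have t: "t \<in> {0..R}" using Suc.prems by auto
    have "norm (t * flux_iter k n t) \<le> t * (?B * ((?B * t\<^sup>2) ^ n / fact n))"
      unfolding real_norm_def abs_mult
      using t abs_flux_iter_le[OF t Suc.IH] by (intro mult_mono) auto
    also have "\<dots> = (?B ^ (n + 1) / fact n) * t ^ (2 * n + 1)"
      by (simp add: power_mult_distrib power_mult)
    finally show "norm (t * flux_iter k n t) \<le> (?B ^ (n + 1) / fact n) * t ^ (2 * n + 1)" .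
  qed
  also have "\<dots> = (?B ^ (n + 1) / fact n) * (r ^ (2 * n + 1 + 1) / (2 * n + 1 + 1))"
    using has_integral_mult_right[OF has_integral_power_Icc[OF r, of "2 * n + 1"],
        of "?B ^ (n + 1) / fact n"]
    by (intro integral_unique) simp
  \<comment> \<open>Half of the denominator \<open>2 * n + 2\<close> is given up;
    \<open>n + 1\<close> already completes \<open>fact (Suc n)\<close>.\<close>
  also have "\<dots> \<le> (?B ^ (n + 1) / fact n) * (r ^ (2 * n + 1 + 1) / (n + 1))"
    using r weight_bound_nonneg by (intro mult_left_mono divide_left_mono) auto
  also have "\<dots> = (?B * r\<^sup>2) ^ Suc n / fact (Suc n)"
    by (simp add: power_mult_distrib power_mult power2_eq_square mult_ac add.commute)
  finally show ?case by (simp add: rad_iter_Suc)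
qed simp

section \<open>Convergence of the series and joint continuity\<close>

lemma rad_term_bound:
  assumes "r \<in> {0..R}" "\<bar>\<mu>\<bar> \<le> M"
  shows "norm ((- \<mu>) ^ n * rad_iter k n r) \<le> (M * weight_bound * R\<^sup>2) ^ n / fact n"
    and "norm ((- \<mu>) ^ n * flux_iter k n r) \<le>
      weight_bound * ((M * weight_bound * R\<^sup>2) ^ n / fact n)"
proof -
  let ?B = weight_bound
  have R2: "(?B * r\<^sup>2) ^ n / fact n \<le> (?B * R\<^sup>2) ^ n / fact n"
    using assms(1) weight_bound_nonneg
    by (intro divide_right_mono power_mono mult_left_mono) auto
  have M: "\<bar>\<mu>\<bar> ^ n \<le> M ^ n" using assms by (intro power_mono) auto
  have M0: "0 \<le> M" using assms by auto
  have "\<bar>\<mu>\<bar> ^ n * \<bar>rad_iter k n r\<bar> \<le> M ^ n * ((?B * R\<^sup>2) ^ n / fact n)"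
    using order_trans[OF abs_rad_iter_le[OF assms(1)] R2] M M0 by (intro mult_mono) auto
  then show "norm ((- \<mu>) ^ n * rad_iter k n r) \<le> (M * ?B * R\<^sup>2) ^ n / fact n"
    by (simp add: abs_mult power_abs power_mult_distrib mult_ac)
  have "\<bar>flux_iter k n r\<bar> \<le> ?B * ((?B * R\<^sup>2) ^ n / fact n)"
    using abs_flux_iter_le[OF assms(1) abs_rad_iter_le, of k n] mult_left_mono[OF R2 weight_bound_nonneg]
    by linarith
  then have "\<bar>\<mu>\<bar> ^ n * \<bar>flux_iter k n r\<bar> \<le> M ^ n * (?B * ((?B * R\<^sup>2) ^ n / fact n))"
    using M M0 by (intro mult_mono) auto
  then show "norm ((- \<mu>) ^ n * flux_iter k n r) \<le> ?B * ((M * ?B * R\<^sup>2) ^ n / fact n)"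
    by (simp add: abs_mult power_abs power_mult_distrib mult_ac)
qed

lemma summable_exp_div: "summable (\<lambda>n. (x::real) ^ n / fact n)"
  using summable_exp[of x] by (simp add: field_simps inverse_eq_divide)

lemma summable_rad_iter:
  assumes "r \<in> {0..R}"
  shows "summable (\<lambda>n. (- \<mu>) ^ n * rad_iter k n r)"
proof (rule summable_comparison_test)
  show "\<exists>N. \<forall>n\<ge>N. norm ((- \<mu>) ^ n * rad_iter k n r) \<le> (\<bar>\<mu>\<bar> * weight_bound * R\<^sup>2) ^ n / fact n"
    using rad_term_bound(1)[OF assms order_refl] by blast
qed (rule summable_exp_div)

lemma summable_flux_iter:
  assumes "r \<in> {0..R}"
  shows "summable (\<lambda>n. (- \<mu>) ^ n * flux_iter k n r)"
proof (rule summable_comparison_test)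
  show "\<exists>N. \<forall>n\<ge>N. norm ((- \<mu>) ^ n * flux_iter k n r) \<le>
      weight_bound * ((\<bar>\<mu>\<bar> * weight_bound * R\<^sup>2) ^ n / fact n)"
    using rad_term_bound(2)[OF assms order_refl] by blast
qed (intro summable_mult summable_exp_div)

text \<open>The majorant depends on the bound \<open>M\<close> for \<mu>, so the Weierstrass test
  gives continuity over bounded parameter ranges; these are relatively open and glue. Joint
  continuity is what lifting the phase to an angle requires.\<close>

lemma continuous_on_rad_pair:
  "continuous_on ({0..R} \<times> UNIV) (\<lambda>(r, \<mu>). rad_sol k \<mu> r)"
  "continuous_on ({0..R} \<times> UNIV) (\<lambda>(r, \<mu>). rad_flux k \<mu> r)"
proof -
  let ?A = "\<lambda>M. {0..R} \<times> {- M<..<M}"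
  have glue: "continuous_on ({0..R} \<times> UNIV) f"
    if "\<And>M. continuous_on (?A M) f" for f :: "real \<times> real \<Rightarrow> real"
    unfolding continuous_on_eq_continuous_within
  proof
    fix x :: "real \<times> real" assume x: "x \<in> {0..R} \<times> UNIV"
    let ?M = "\<bar>snd x\<bar> + 1"
    have "x \<in> ?A ?M" using x by (auto simp: mem_Times_iff)
    then have "continuous (at x within ?A ?M) f"
      using that[of ?M] unfolding continuous_on_eq_continuous_within by blast
    moreover have "at x within {0..R} \<times> UNIV = at x within ?A ?M"
      by (rule at_within_nhd[of x "UNIV \<times> {- ?M<..<?M}"])
        (use x in \<open>auto simp: mem_Times_iff intro: open_Times\<close>)
    ultimately show "continuous (at x within {0..R} \<times> UNIV) f" by simp
  qed
  show "continuous_on ({0..R} \<times> UNIV) (\<lambda>(r, \<mu>). rad_sol k \<mu> r)"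
  proof (rule glue)
    fix M
    have "uniform_limit (?A M) (\<lambda>n x. \<Sum>i<n. (- snd x) ^ i * rad_iter k i (fst x))
        (\<lambda>x. \<Sum>i. (- snd x) ^ i * rad_iter k i (fst x)) sequentially"
      by (rule Weierstrass_m_test[OF rad_term_bound(1)[where M = M] summable_exp_div]) auto
    then have "continuous_on (?A M) (\<lambda>x. \<Sum>i. (- snd x) ^ i * rad_iter k i (fst x))"
      by (rule uniform_limit_theorem[rotated])
        (auto intro!: always_eventually continuous_intros
          continuous_on_compose2[OF continuous_on_rad_iter])
    then show "continuous_on (?A M) (\<lambda>(r, \<mu>). rad_sol k \<mu> r)"
      by (simp add: rad_sol_def case_prod_beta)
  qed
  show "continuous_on ({0..R} \<times> UNIV) (\<lambda>(r, \<mu>). rad_flux k \<mu> r)"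
  proof (rule glue)
    fix M
    have "uniform_limit (?A M) (\<lambda>n x. \<Sum>i<n. (- snd x) ^ i * flux_iter k i (fst x))
        (\<lambda>x. \<Sum>i. (- snd x) ^ i * flux_iter k i (fst x)) sequentially"
      by (rule Weierstrass_m_test[OF rad_term_bound(2)[where M = M] summable_mult[OF summable_exp_div]]) auto
    then have "continuous_on (?A M) (\<lambda>x. \<Sum>i. (- snd x) ^ i * flux_iter k i (fst x))"
      by (rule uniform_limit_theorem[rotated])
        (auto intro!: always_eventually continuous_intros
          continuous_on_compose2[OF continuous_on_flux_iter])
    then show "continuous_on (?A M) (\<lambda>(r, \<mu>). rad_flux k \<mu> r)"
      by (simp add: rad_flux_def case_prod_beta)
  qed
qed

lemma continuous_on_rad_sol: "continuous_on {0..R} (rad_sol k \<mu>)"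
  and continuous_on_rad_flux: "continuous_on {0..R} (rad_flux k \<mu>)"
proof -
  have p: "continuous_on {0..R} (\<lambda>r. (r, \<mu>))" "(\<lambda>r. (r, \<mu>)) ` {0..R} \<subseteq> {0..R} \<times> UNIV"
    by (auto intro!: continuous_intros)
  show "continuous_on {0..R} (rad_sol k \<mu>)" "continuous_on {0..R} (rad_flux k \<mu>)"
    using continuous_on_compose2[OF continuous_on_rad_pair(1) p]
      continuous_on_compose2[OF continuous_on_rad_pair(2) p] by simp_all
qed

section \<open>Values, signs and derivatives of the series\<close>

lemma rad_sol_0: "rad_sol k \<mu> 0 = 1"
proof -
  have "(- \<mu>) ^ n * rad_iter k n 0 = (if n = 0 then 1 else 0)" for n
    by (cases n) (auto simp: rad_iter_Suc)
  then show ?thesis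
    unfolding rad_sol_def using sums_single[of 0 "\<lambda>_. 1::real"]
    by (simp add: sums_iff)
qed

text \<open>Only the zeroth term survives at the centre. In this form it says that the numerator of
  the derivative in \<open>DERIV_rad_flux\<close> vanishes there, which later gives regularity at
  the pole.\<close>

lemma rad_flux_0: "real (2 * k + 2) * rad_flux k \<mu> 0 = \<Phi> 0"
proof -
  have "(- \<mu>) ^ n * flux_iter k n 0 = (if n = 0 then \<Phi> 0 / real (2 * k + 2) else 0)" for n
    by (cases n) (auto simp: flux_iter_def radial_average_def rad_iter_Suc)
  then have "rad_flux k \<mu> 0 = \<Phi> 0 / real (2 * k + 2)"
    unfolding rad_flux_def using sums_single[of 0 "\<lambda>_. \<Phi> 0 / real (2 * k + 2)"]
    by (simp add: sums_iff)
  then show ?thesis by (simp only: nonzero_mult_div_cancel_left of_nat_eq_0_iff) simp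
qed

lemma rad_sol_zero_param: "rad_sol k 0 r = 1"
proof -
  have "(- 0) ^ n * rad_iter k n r = (if n = 0 then 1 else 0)" for n
    by (cases n) auto
  then show ?thesis
    unfolding rad_sol_def using sums_single[of 0 "\<lambda>_. 1::real"]
    by (simp add: sums_iff)
qed

text \<open>For such \<mu> all terms are nonnegative and the zeroth one is 1. Hence the eigenvalues
  of every mode are positive.\<close>

lemma rad_sol_ge_1:
  assumes "\<mu> \<le> 0" "r \<in> {0..R}"
  shows "1 \<le> rad_sol k \<mu> r"
proof -
  have "(\<Sum>n<1. (- \<mu>) ^ n * rad_iter k n r) \<le> rad_sol k \<mu> r"
    unfolding rad_sol_def using assms rad_iter_nonneg
    by (intro sum_le_suminf summable_rad_iter) auto
  then show ?thesis by simp
qed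

lemma DERIV_rad_sol:
  assumes "r \<in> {0<..<R}"
  shows "(rad_sol k \<mu> has_real_derivative - \<mu> * r * rad_flux k \<mu> r) (at r)"
proof -
  \<comment> \<open>The index shifts under differentiation: the term \<open>n + 1\<close> of
    \<open>rad_sol\<close> yields the term \<open>n\<close> of the flux, and the constant term
    yields 0.\<close>
  let ?f' = "\<lambda>n r. (- \<mu>) ^ n * (case n of 0 \<Rightarrow> 0 | Suc m \<Rightarrow> r * flux_iter k m r)"
  have 1: "((\<lambda>r. (- \<mu>) ^ n * rad_iter k n r) has_real_derivative ?f' n x) (at x within {0..R})"
    if "x \<in> {0..R}" for n x
  proof (cases n)
    case (Suc m)
    have "continuous_on {0..R} (\<lambda>t. t * flux_iter k m t)"
      by (intro continuous_intros continuous_on_flux_iter)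
    from DERIV_cmult[OF integral_has_real_derivative[OF this that], of "(- \<mu>) ^ Suc m"] show ?thesis
      unfolding Suc rad_iter_Suc by simp
  qed auto
  define C where "C = \<bar>\<mu>\<bar> * weight_bound * R\<^sup>2"
  define Mb where "Mb n = (case n of 0 \<Rightarrow> 0 | Suc m \<Rightarrow> \<bar>\<mu>\<bar> * R * (weight_bound * (C ^ m / fact m)))" for n
  have bd: "norm (?f' n x) \<le> Mb n" if x: "x \<in> {0..R}" for n x
  proof (cases n)
    case (Suc m)
    have "\<bar>\<mu>\<bar> * x * norm ((- \<mu>) ^ m * flux_iter k m x) \<le>
        \<bar>\<mu>\<bar> * R * (weight_bound * (C ^ m / fact m))"
      using rad_term_bound(2)[OF x order_refl, of \<mu> m k] x R_pos
      by (intro mult_mono) (auto simp: C_def)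
    then show ?thesis using x by (simp add: Suc Mb_def abs_mult mult_ac)
  qed (simp add: Mb_def)
  have "summable (\<lambda>n. Mb (Suc n))"
    unfolding Mb_def nat.case by (intro summable_mult summable_exp_div)
  then have sM: "summable Mb" by (simp only: summable_Suc_iff)
  have "uniformly_convergent_on {0..R} (\<lambda>n x. \<Sum>i<n. ?f' i x)"
    by (rule Weierstrass_m_test'[OF bd sM])
  from has_field_derivative_series'(2)[OF _ 1 this, of 0] R_pos assms
  have "((\<lambda>x. \<Sum>n. (- \<mu>) ^ n * rad_iter k n x) has_real_derivative (\<Sum>n. ?f' n r)) (at r)"
    using summable_rad_iter[of 0] by (simp add: interior_atLeastAtMost_real)
  moreover have "(\<Sum>n. ?f' n r) = - \<mu> * r * rad_flux k \<mu> r"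
  proof -
    have s: "summable (\<lambda>n. ?f' n r)"
      by (rule summable_comparison_test[OF _ sM]) (use bd[of r] assms in auto)
    have "(\<Sum>n. ?f' n r) = (\<Sum>n. ?f' (Suc n) r)"
      using suminf_split_head[OF s] by simp
    also have "\<dots> = (\<Sum>n. (- \<mu> * r) * ((- \<mu>) ^ n * flux_iter k n r))"
      by (rule suminf_cong) (simp only: nat.case power_Suc mult_ac)
    also have "\<dots> = - \<mu> * r * rad_flux k \<mu> r"
      unfolding rad_flux_def using assms by (intro suminf_mult summable_flux_iter) auto
    finally show ?thesis .
  qed
  ultimately show ?thesis unfolding rad_sol_def[abs_def] by simp
qed

text \<open>The factor \<open>r ^ (2 * k + 2)\<close> turns every term into a plain integral, which
  can be differentiated term by term; the derivative of \<open>rad_flux\<close> itself then follows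
  from the quotient rule.\<close>

lemma DERIV_power_rad_flux:
  assumes "r \<in> {0<..<R}"
  shows "((\<lambda>r. r ^ (2 * k + 2) * rad_flux k \<mu> r) has_real_derivative
    r ^ (2 * k + 1) * (\<Phi> r * rad_sol k \<mu> r)) (at r)"
proof -
  let ?G = "\<lambda>n r. integral {0..r} (\<lambda>t. t ^ (2 * k + 1) * (\<Phi> t * rad_iter k n t))"
  let ?f' = "\<lambda>n r. (- \<mu>) ^ n * (r ^ (2 * k + 1) * (\<Phi> r * rad_iter k n r))"
  have 1: "((\<lambda>r. (- \<mu>) ^ n * ?G n r) has_real_derivative ?f' n x) (at x within {0..R})"
    if "x \<in> {0..R}" for n x
    using that
    by (intro DERIV_cmult has_real_derivative_power_mult_radial_average continuous_intros
        weight_cont continuous_on_rad_iter)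
  have G: "(- \<mu>) ^ n * ?G n x = x ^ (2 * k + 2) * ((- \<mu>) ^ n * flux_iter k n x)"
    if "x \<in> {0..R}" for n x
    using that power_mult_radial_average[of x "2 * k + 1" "\<lambda>t. \<Phi> t * rad_iter k n t"]
    by (simp add: flux_iter_def mult_ac)
  define C where "C = \<bar>\<mu>\<bar> * weight_bound * R\<^sup>2"
  have bd: "norm (?f' n x) \<le> R ^ (2 * k + 1) * (weight_bound * (C ^ n / fact n))"
    if x: "x \<in> {0..R}" for n x
  proof -
    have "x ^ (2 * k + 1) * (\<bar>\<Phi> x\<bar> * norm ((- \<mu>) ^ n * rad_iter k n x)) \<le>
        R ^ (2 * k + 1) * (weight_bound * (C ^ n / fact n))"
      using rad_term_bound(1)[OF x order_refl, of \<mu> n k] abs_weight_le[OF x] x R_pos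
        weight_bound_nonneg
      by (intro mult_mono power_mono mult_nonneg_nonneg) (auto simp: C_def)
    then show ?thesis using x by (simp add: abs_mult mult_ac)
  qed
  have sM: "summable (\<lambda>n. R ^ (2 * k + 1) * (weight_bound * (C ^ n / fact n)))"
    by (intro summable_mult summable_exp_div)
  have "uniformly_convergent_on {0..R} (\<lambda>n x. \<Sum>i<n. ?f' i x)"
    by (rule Weierstrass_m_test'[OF bd sM])
  from has_field_derivative_series'(2)[OF _ 1 this, of 0] R_pos assms
  have "((\<lambda>x. \<Sum>n. (- \<mu>) ^ n * ?G n x) has_real_derivative (\<Sum>n. ?f' n r)) (at r)"
    using summable_mult[OF summable_flux_iter[of 0 \<mu> k], of "0 ^ (2 * k + 2)"]
    by (simp add: interior_atLeastAtMost_real)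
  moreover have "(\<Sum>n. ?f' n r) = r ^ (2 * k + 1) * (\<Phi> r * rad_sol k \<mu> r)"
  proof -
    have "(\<Sum>n. ?f' n r) = (\<Sum>n. (r ^ (2 * k + 1) * \<Phi> r) * ((- \<mu>) ^ n * rad_iter k n r))"
      by (rule suminf_cong) (simp only: mult_ac)
    also have "\<dots> = (r ^ (2 * k + 1) * \<Phi> r) * rad_sol k \<mu> r"
      unfolding rad_sol_def using assms by (intro suminf_mult summable_rad_iter) auto
    finally show ?thesis by simp
  qed
  moreover have "(\<Sum>n. (- \<mu>) ^ n * ?G n x) = x ^ (2 * k + 2) * rad_flux k \<mu> x"
    if "x \<in> {0<..<R}" for x
  proof -
    have x: "x \<in> {0..R}" using that by auto
    show ?thesis unfolding rad_flux_def G[OF x]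
      by (rule suminf_mult) (rule summable_flux_iter[OF x])
  qed
  ultimately show ?thesis
    using assms by (auto elim!: has_field_derivative_transform_within_open[of _ _ r "{0<..<R}"])
qed

lemma DERIV_rad_flux:
  assumes "r \<in> {0<..<R}"
  shows "(rad_flux k \<mu> has_real_derivative
    (\<Phi> r * rad_sol k \<mu> r - real (2 * k + 2) * rad_flux k \<mu> r) / r) (at r)"
proof -
  have "((\<lambda>r. (r ^ (2 * k + 2) * rad_flux k \<mu> r) / r ^ (2 * k + 2)) has_real_derivative
     (r ^ (2 * k + 1) * (\<Phi> r * rad_sol k \<mu> r) * r ^ (2 * k + 2)
       - (r ^ (2 * k + 2) * rad_flux k \<mu> r) * (real (2 * k + 2) * r ^ (2 * k + 1)))
       / (r ^ (2 * k + 2) * r ^ (2 * k + 2))) (at r)"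
    by (rule DERIV_divide[OF DERIV_power_rad_flux[OF assms]])
      (use assms in \<open>auto intro!: derivative_eq_intros simp del: power_Suc\<close>)
  moreover have "(r ^ (2 * k + 1) * (\<Phi> r * rad_sol k \<mu> r) * r ^ (2 * k + 2)
       - (r ^ (2 * k + 2) * rad_flux k \<mu> r) * (real (2 * k + 2) * r ^ (2 * k + 1)))
       / (r ^ (2 * k + 2) * r ^ (2 * k + 2)) = (\<Phi> r * rad_sol k \<mu> r - real (2 * k + 2) * rad_flux k \<mu> r) / r"
    using assms by (simp add: divide_simps) (simp add: algebra_simps)
  ultimately have "((\<lambda>r. (r ^ (2 * k + 2) * rad_flux k \<mu> r) / r ^ (2 * k + 2)) has_real_derivative
      (\<Phi> r * rad_sol k \<mu> r - real (2 * k + 2) * rad_flux k \<mu> r) / r) (at r)" by simp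
  then show ?thesis
    by (rule has_field_derivative_transform_within_open[of _ _ _ "{0<..<R}"]) (use assms in auto)
qed

end

section \<open>Pruefer angles\<close>

text \<open>Gronwall's argument for the energy \<open>E\<close>, whose derivative is at most
  \<open>2 * C * E\<close> in absolute value, run from \<open>c\<close> in both directions.
  Derivatives are required in the open interval only, since it may end at the boundary
  \<open>R\<close>, where just continuity is available.\<close>

lemma linear_system_zero:
  fixes x y \<alpha> \<beta> :: "real \<Rightarrow> real"
  assumes cont: "continuous_on {a..b} x" "continuous_on {a..b} y"
    and x: "\<And>t. t \<in> {a<..<b} \<Longrightarrow> (x has_real_derivative \<alpha> t * y t) (at t)"
    and y: "\<And>t. t \<in> {a<..<b} \<Longrightarrow> (y has_real_derivative \<beta> t * x t) (at t)"
    and C: "\<And>t. t \<in> {a<..<b} \<Longrightarrow> \<bar>\<alpha> t\<bar> \<le> C" "\<And>t. t \<in> {a<..<b} \<Longrightarrow> \<bar>\<beta> t\<bar> \<le> C"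
    and c: "c \<in> {a..b}" "x c = 0" "y c = 0"
    and t: "t \<in> {a..b}"
  shows "x t = 0 \<and> y t = 0"
proof -
  define E where "E s = (x s)\<^sup>2 + (y s)\<^sup>2" for s
  have contE: "continuous_on {a..b} E"
    unfolding E_def by (intro continuous_intros cont)
  have dE: "(E has_real_derivative 2 * (\<alpha> s + \<beta> s) * (x s * y s)) (at s)" if "s \<in> {a<..<b}" for s
    unfolding E_def[abs_def]
    by (rule derivative_eq_intros refl x[OF that] y[OF that] | simp add: algebra_simps)+
  have bd: "\<bar>2 * (\<alpha> s + \<beta> s) * (x s * y s)\<bar> \<le> 2 * C * E s" if "s \<in> {a<..<b}" for s
  proof -
    have "\<bar>\<alpha> s + \<beta> s\<bar> \<le> 2 * C" using C[OF that] by linarith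
    moreover have "\<bar>2 * (x s * y s)\<bar> \<le> E s"
      unfolding E_def using sum_squares_bound[of "x s" "y s"] sum_squares_bound[of "x s" "- y s"]
      by (simp add: abs_le_iff)
    ultimately have "\<bar>\<alpha> s + \<beta> s\<bar> * \<bar>2 * (x s * y s)\<bar> \<le> 2 * C * E s"
      by (intro mult_mono) auto
    then show ?thesis unfolding abs_mult by (simp only: abs_numeral mult_ac)
  qed
  have "E t \<le> 0"
  proof (cases "c \<le> t")
    case True
    have "E c * exp (- 2 * C * c) \<ge> E t * exp (- 2 * C * t)"
    proof (rule DERIV_nonpos_imp_decreasing_open[OF True])
      fix s assume "c < s" "s < t"
      then have s: "s \<in> {a<..<b}" using c t by auto
      have "((\<lambda>s. E s * exp (- 2 * C * s)) has_real_derivative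
          (2 * (\<alpha> s + \<beta> s) * (x s * y s) - 2 * C * E s) * exp (- 2 * C * s)) (at s)"
        by (rule derivative_eq_intros refl dE[OF s] | simp add: algebra_simps)+
      moreover have "(2 * (\<alpha> s + \<beta> s) * (x s * y s) - 2 * C * E s) * exp (- 2 * C * s) \<le> 0"
        using bd[OF s] by (intro mult_nonpos_nonneg) auto
      ultimately show "\<exists>z. ((\<lambda>s. E s * exp (- 2 * C * s)) has_real_derivative z) (at s) \<and> z \<le> 0"
        by blast
    next
      have "continuous_on {c..t} E" by (rule continuous_on_subset[OF contE]) (use c t in auto)
      then show "continuous_on {c..t} (\<lambda>s. E s * exp (- 2 * C * s))"
        by (intro continuous_intros)
    qed
    then have "E t * exp (- 2 * C * t) \<le> 0" using c by (simp add: E_def)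
    then show ?thesis by (simp add: mult_le_0_iff)
  next
    case False
    then have le: "t \<le> c" by simp
    have "E t * exp (2 * C * t) \<le> E c * exp (2 * C * c)"
    proof (rule DERIV_nonneg_imp_increasing_open[OF le])
      fix s assume "t < s" "s < c"
      then have s: "s \<in> {a<..<b}" using c t by auto
      have "((\<lambda>s. E s * exp (2 * C * s)) has_real_derivative
          (2 * (\<alpha> s + \<beta> s) * (x s * y s) + 2 * C * E s) * exp (2 * C * s)) (at s)"
        by (rule derivative_eq_intros refl dE[OF s] | simp add: algebra_simps)+
      moreover have "(2 * (\<alpha> s + \<beta> s) * (x s * y s) + 2 * C * E s) * exp (2 * C * s) \<ge> 0"
        using bd[OF s] by (intro mult_nonneg_nonneg) auto
      ultimately show "\<exists>z. ((\<lambda>s. E s * exp (2 * C * s)) has_real_derivative z) (at s) \<and> z \<ge> 0"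
        by blast
    next
      have "continuous_on {t..c} E" by (rule continuous_on_subset[OF contE]) (use c t in auto)
      then show "continuous_on {t..c} (\<lambda>s. E s * exp (2 * C * s))"
        by (intro continuous_intros)
    qed
    then have "E t * exp (2 * C * t) \<le> 0" using c by (simp add: E_def)
    then show ?thesis by (simp add: mult_le_0_iff)
  qed
  then show ?thesis unfolding E_def
    by (simp add: sum_power2_le_zero_iff)
qed

text \<open>The values lie in one coset of the integer multiples of \<open>2 * pi\<close>, which is
  countable, while a connected set of reals with two points is uncountable.\<close>

lemma continuous_cis_constant:
  fixes \<theta> :: "'a::topological_space \<Rightarrow> real"
  assumes "continuous_on S \<theta>" "connected S" "\<And>x. x \<in> S \<Longrightarrow> cis (\<theta> x) = d" "x \<in> S" "y \<in> S"
  shows "\<theta> x = \<theta> y"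
proof (rule ccontr)
  assume "\<theta> x \<noteq> \<theta> y"
  moreover have "connected (\<theta> ` S)" by (rule connected_continuous_image) fact+
  ultimately have "uncountable (\<theta> ` S)"
    using assms(4,5) by (intro connected_uncountable[of _ "\<theta> x" "\<theta> y"]) auto
  moreover have "\<theta> ` S \<subseteq> (\<lambda>n::int. \<theta> x + 2 * of_int n * pi) ` UNIV"
  proof
    fix z assume "z \<in> \<theta> ` S"
    then obtain s where "s \<in> S" "z = \<theta> s" by auto
    then have "cis z = cis (\<theta> x)" using assms(3,4) by auto
    then have "sin z = sin (\<theta> x) \<and> cos z = cos (\<theta> x)" by (simp add: complex_eq_iff)
    then obtain n :: int where "z = \<theta> x + 2 * of_int n * pi"
      using sin_cos_eq_iff[of z "\<theta> x"] by (auto simp: mult_ac)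
    then show "z \<in> (\<lambda>n::int. \<theta> x + 2 * of_int n * pi) ` UNIV"
      by auto
  qed
  ultimately show False by (metis countable_subset countable_image uncountable_def countableI_type)
qed

section \<open>Phase plane and continuous angles\<close>

context radial_weight
begin

text \<open>By uniqueness for the first-order system in \<open>rad_sol\<close> and
  \<open>r ^ (2 * k + 2) * rad_flux\<close>, a common zero propagates inwards to every
  \<open>a > 0\<close>, and in the limit it contradicts the value 1 at the centre. The coefficient
  bound depends on \<open>a\<close> because the system is singular at 0.\<close>

lemma rad_sol_flux_nonzero:
  assumes "r \<in> {0<..R}"
  shows "rad_sol k \<mu> r \<noteq> 0 \<or> rad_flux k \<mu> r \<noteq> 0"
proof (rule ccontr)
  assume neg: "\<not> ?thesis"
  have z: "rad_sol k \<mu> a = 0" if a: "a \<in> {0<..r}" for a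
  proof -
    let ?C = "max (\<bar>\<mu>\<bar> / a ^ (2 * k + 1)) (R ^ (2 * k + 1) * weight_bound)"
    define y where "y t = t ^ (2 * k + 2) * rad_flux k \<mu> t" for t
    have "rad_sol k \<mu> a = 0 \<and> y a = 0"
    proof (rule linear_system_zero[where c = r and a = a and b = r and t = a and C = ?C
          and \<alpha> = "\<lambda>t. - \<mu> / t ^ (2 * k + 1)" and \<beta> = "\<lambda>t. t ^ (2 * k + 1) * \<Phi> t"
          and x = "rad_sol k \<mu>" and y = y])
      show "continuous_on {a..r} (rad_sol k \<mu>)"
        by (rule continuous_on_subset[OF continuous_on_rad_sol]) (use a assms in auto)
      have "continuous_on {a..r} (rad_flux k \<mu>)"
        by (rule continuous_on_subset[OF continuous_on_rad_flux]) (use a assms in auto)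
      then show "continuous_on {a..r} y"
        unfolding y_def by (intro continuous_intros)
      fix t assume t: "t \<in> {a<..<r}"
      then have tR: "t \<in> {0<..<R}" using a assms by auto
      have "- \<mu> * t * rad_flux k \<mu> t = - \<mu> / t ^ (2 * k + 1) * (t ^ (2 * k + 2) * rad_flux k \<mu> t)"
        using tR by simp
      then show "(rad_sol k \<mu> has_real_derivative
          - \<mu> / t ^ (2 * k + 1) * y t) (at t)"
        using DERIV_rad_sol[OF tR, of k \<mu>] by (simp add: y_def)
      show "(y has_real_derivative t ^ (2 * k + 1) * \<Phi> t * rad_sol k \<mu> t) (at t)"
        using DERIV_power_rad_flux[OF tR, of k \<mu>] by (simp add: mult.assoc y_def[abs_def])
      have "a ^ (2 * k + 1) \<le> t ^ (2 * k + 1)" using t a by (intro power_mono) auto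
      then have mt: "\<bar>\<mu>\<bar> / t ^ (2 * k + 1) \<le> \<bar>\<mu>\<bar> / a ^ (2 * k + 1)"
        using t a by (intro divide_left_mono mult_pos_pos zero_less_power) auto
      show "\<bar>- \<mu> / t ^ (2 * k + 1)\<bar> \<le> ?C"
      proof -
        have "\<bar>- \<mu> / t ^ (2 * k + 1)\<bar> = \<bar>\<mu>\<bar> / t ^ (2 * k + 1)"
          using tR by (simp add: power_abs)
        then show ?thesis using mt by linarith
      qed
      have wt: "t ^ (2 * k + 1) * \<bar>\<Phi> t\<bar> \<le> R ^ (2 * k + 1) * weight_bound"
        using tR weight_bound_nonneg by (intro mult_mono power_mono abs_weight_le) auto
      show "\<bar>t ^ (2 * k + 1) * \<Phi> t\<bar> \<le> ?C"
      proof -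
        have "\<bar>t ^ (2 * k + 1) * \<Phi> t\<bar> = t ^ (2 * k + 1) * \<bar>\<Phi> t\<bar>"
          using tR by (simp add: abs_mult)
        then show ?thesis using wt by linarith
      qed
    qed (use neg a in \<open>auto simp: y_def\<close>)
    then show ?thesis by simp
  qed
  have "rad_sol k \<mu> 0 = 0"
  proof (rule continuous_constant_on_closure[where S = "{0<..r}" and f = "rad_sol k \<mu>"])
    show "continuous_on (closure {0<..r}) (rad_sol k \<mu>)"
      using assms by (auto intro: continuous_on_subset[OF continuous_on_rad_sol])
  qed (use z assms in auto)
  then show False by (simp add: rad_sol_0)
qed

text \<open>The Pruefer phase plane of \<open>w = r\<^sup>k h\<close>: up to the factor \<open>r\<^sup>k\<close> this is \<open>r w' + \<i> w\<close>.\<close>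

definition rad_phase :: "nat \<Rightarrow> real \<Rightarrow> real \<Rightarrow> complex" where
  "rad_phase k \<mu> r = Complex (k * rad_sol k \<mu> r - \<mu> * r\<^sup>2 * rad_flux k \<mu> r) (rad_sol k \<mu> r)"

lemma Im_rad_phase [simp]: "Im (rad_phase k \<mu> r) = rad_sol k \<mu> r"
  by (simp add: rad_phase_def)

lemma rad_phase_nonzero:
  assumes "r \<in> {0..R}"
  shows "rad_phase k \<mu> r \<noteq> 0"
proof
  assume 0: "rad_phase k \<mu> r = 0"
  then have h: "rad_sol k \<mu> r = 0" by (simp add: rad_phase_def complex_eq_iff)
  with 0 have "\<mu> * r\<^sup>2 * rad_flux k \<mu> r = 0" by (simp add: rad_phase_def complex_eq_iff)
  moreover have "\<mu> \<noteq> 0" using h rad_sol_zero_param[of k r] by auto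
  moreover have "r \<noteq> 0" using h rad_sol_0[of k \<mu>] by auto
  ultimately show False using rad_sol_flux_nonzero[of r k \<mu>] assms h by auto
qed

lemma continuous_on_rad_phase: "continuous_on ({0..R} \<times> UNIV) (\<lambda>(r, \<mu>). rad_phase k \<mu> r)"
proof -
  have "continuous_on ({0..R} \<times> UNIV) (\<lambda>x. complex_of_real
      (k * rad_sol k (snd x) (fst x) - snd x * (fst x)\<^sup>2 * rad_flux k (snd x) (fst x)) +
      \<i> * complex_of_real (rad_sol k (snd x) (fst x)))"
    using continuous_on_rad_pair[of k] unfolding case_prod_beta
    by (intro continuous_on_of_real continuous_on_add continuous_on_diff continuous_on_mult
        continuous_on_power continuous_on_fst continuous_on_snd continuous_on_const continuous_on_id)
  then show ?thesis by (simp add: rad_phase_def Complex_eq case_prod_beta)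
qed

text \<open>The strip is contractible, so the nonvanishing phase has a continuous logarithm, whose
  imaginary part gives the angle. On the edges \<open>r = 0\<close> and \<open>\<mu> = 0\<close> the
  phase is constant, hence so is the angle, with a value that does not depend on the weight. The
  first edge is the common start of the comparison, the second the common lower end for the
  intermediate value theorem.\<close>

lemma exists_angle:
  obtains \<theta> where "continuous_on ({0..R} \<times> UNIV) (\<lambda>(r, \<mu>). \<theta> r \<mu>)"
    "\<And>r \<mu>. r \<in> {0..R} \<Longrightarrow> rad_phase k \<mu> r = of_real (cmod (rad_phase k \<mu> r)) * cis (\<theta> r \<mu>)"
    "\<And>\<mu>. \<theta> 0 \<mu> = Arg (Complex k 1)"
    "\<And>r. r \<in> {0..R} \<Longrightarrow> \<theta> r 0 = Arg (Complex k 1)"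
proof -
  let ?P = "\<lambda>(r, \<mu>). rad_phase k \<mu> r"
  have "contractible ({0..R} \<times> (UNIV :: real set))"
    by (intro convex_imp_contractible convex_Times) auto
  then obtain g where g: "continuous_on ({0..R} \<times> UNIV) g"
    "\<And>x. x \<in> {0..R} \<times> UNIV \<Longrightarrow> ?P x = exp (g x)"
    using continuous_logarithm_on_contractible[OF continuous_on_rad_phase[of k]] rad_phase_nonzero
    by (smt (verit, best) case_prod_beta mem_Sigma_iff prod.collapse)
  \<comment> \<open>The shift fixes the value at \<open>(0, 0)\<close>, which removes the ambiguity
    of the logarithm.\<close>
  define \<theta> where "\<theta> r \<mu> = Im (g (r, \<mu>)) - Im (g (0, 0)) + Arg (Complex k 1)" for r \<mu>
  have start: "rad_phase k \<mu> 0 = Complex k 1" for \<mu>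
    by (simp add: rad_phase_def rad_sol_0)
  have cis_g: "cis (Im (g (r, \<mu>))) = sgn (rad_phase k \<mu> r)" if "r \<in> {0..R}" for r \<mu>
  proof -
    have "exp (g (r, \<mu>)) = of_real (exp (Re (g (r, \<mu>)))) * cis (Im (g (r, \<mu>)))"
      by (simp add: exp_eq_polar)
    with g(2)[of "(r, \<mu>)"] that have "rad_phase k \<mu> r = of_real (exp (Re (g (r, \<mu>)))) * cis (Im (g (r, \<mu>)))"
      by simp
    then show ?thesis by (simp add: sgn_mult sgn_of_real sgn_cis)
  qed
  have cis_th: "cis (\<theta> r \<mu>) = sgn (rad_phase k \<mu> r)" if "r \<in> {0..R}" for r \<mu>
  proof -
    have "cis (\<theta> r \<mu>) = cis (Im (g (r, \<mu>))) / cis (Im (g (0, 0))) * cis (Arg (Complex k 1))"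
      unfolding \<theta>_def by (simp add: cis_mult cis_divide)
    also have "cis (Im (g (0, 0))) = cis (Arg (Complex k 1))"
      using cis_g[of 0 0] R_pos start[of 0] by (simp add: cis_Arg complex_eq_iff)
    finally show ?thesis using cis_g[OF that] by simp
  qed
  have cont: "continuous_on ({0..R} \<times> UNIV) (\<lambda>(r, \<mu>). \<theta> r \<mu>)"
    unfolding \<theta>_def using g(1) by (simp add: case_prod_beta) (intro continuous_intros)
  have "\<theta> 0 0 = Arg (Complex k 1)" by (simp add: \<theta>_def)
  show ?thesis
  proof (rule that[of \<theta>])
    show "rad_phase k \<mu> r = of_real (cmod (rad_phase k \<mu> r)) * cis (\<theta> r \<mu>)" if "r \<in> {0..R}" for r \<mu>
      unfolding cis_th[OF that] by (simp add: sgn_eq)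
    show "\<theta> 0 \<mu> = Arg (Complex k 1)" for \<mu>
    proof -
      have "continuous_on UNIV (\<lambda>\<mu>. \<theta> 0 \<mu>)"
        using continuous_on_compose2[OF cont, of UNIV "Pair 0"] R_pos
        by (force intro!: continuous_intros)
      then have "\<theta> 0 \<mu> = \<theta> 0 0"
        by (rule continuous_cis_constant) (use cis_th[of 0] start R_pos in auto)
      then show ?thesis by (simp add: \<theta>_def)
    qed
    show "\<theta> r 0 = Arg (Complex k 1)" if "r \<in> {0..R}" for r
    proof -
      have "continuous_on {0..R} (\<lambda>r. \<theta> r 0)"
        using continuous_on_compose2[OF cont, of "{0..R}" "\<lambda>r. (r, 0)"]
        by (force intro!: continuous_intros)
      then have "\<theta> r 0 = \<theta> 0 0"
        by (rule continuous_cis_constant[where d = "sgn (Complex k 1)"])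
          (use cis_th[of _ 0] that R_pos in \<open>auto simp: rad_phase_def rad_sol_zero_param\<close>)
      then show ?thesis by (simp add: \<theta>_def)
    qed
  qed (rule cont)
qed

end


text \<open>Sturm comparison through the Wronskian, which for \<open>r > 0\<close> is a positive
  factor times the sine of the angle difference; the angles themselves are only known to be
  continuous. Strictness near the centre is enough because a positive difference cannot return to
  0.\<close>

lemma angle_comparison:
  assumes W: "radial_weight R \<Phi>\<^sub>1" "radial_weight R \<Phi>\<^sub>2"
    and le: "\<And>r. r \<in> {0..R} \<Longrightarrow> \<mu>\<^sub>1 * \<Phi>\<^sub>1 r \<le> \<mu>\<^sub>2 * \<Phi>\<^sub>2 r"
    and less: "0 < d" "\<And>r. r \<in> {0<..<d} \<Longrightarrow> \<mu>\<^sub>1 * \<Phi>\<^sub>1 r < \<mu>\<^sub>2 * \<Phi>\<^sub>2 r"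
    and cont: "continuous_on {0..R} \<theta>\<^sub>1" "continuous_on {0..R} \<theta>\<^sub>2"
    and polar: "\<And>r. r \<in> {0..R} \<Longrightarrow> radial_weight.rad_phase \<Phi>\<^sub>1 k \<mu>\<^sub>1 r =
        of_real (cmod (radial_weight.rad_phase \<Phi>\<^sub>1 k \<mu>\<^sub>1 r)) * cis (\<theta>\<^sub>1 r)"
      "\<And>r. r \<in> {0..R} \<Longrightarrow> radial_weight.rad_phase \<Phi>\<^sub>2 k \<mu>\<^sub>2 r =
        of_real (cmod (radial_weight.rad_phase \<Phi>\<^sub>2 k \<mu>\<^sub>2 r)) * cis (\<theta>\<^sub>2 r)"
    and start: "\<theta>\<^sub>1 0 = \<theta>\<^sub>2 0"
  shows "\<theta>\<^sub>1 R < \<theta>\<^sub>2 R"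
proof -
  interpret W1: radial_weight R \<Phi>\<^sub>1 by fact
  interpret W2: radial_weight R \<Phi>\<^sub>2 by fact
  note R = W1.R_pos
  let ?p1 = "W1.rad_phase k \<mu>\<^sub>1" and ?p2 = "W2.rad_phase k \<mu>\<^sub>2"
  let ?h1 = "W1.rad_sol k \<mu>\<^sub>1" and ?h2 = "W2.rad_sol k \<mu>\<^sub>2"
  let ?D1 = "W1.rad_flux k \<mu>\<^sub>1" and ?D2 = "W2.rad_flux k \<mu>\<^sub>2"
  define n1 where "n1 r = cmod (?p1 r)" for r
  define n2 where "n2 r = cmod (?p2 r)" for r
  have n_pos: "n1 r > 0" "n2 r > 0" if "r \<in> {0..R}" for r
    unfolding n1_def n2_def using W1.rad_phase_nonzero[OF that] W2.rad_phase_nonzero[OF that] by auto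
  have h_eq: "?h1 r = n1 r * sin (\<theta>\<^sub>1 r)" "?h2 r = n2 r * sin (\<theta>\<^sub>2 r)" if "r \<in> {0..R}" for r
    using arg_cong[OF polar(1)[OF that], of Im] arg_cong[OF polar(2)[OF that], of Im]
    by (simp_all add: n1_def n2_def)
  have re_eq: "k * ?h1 r - \<mu>\<^sub>1 * r\<^sup>2 * ?D1 r = n1 r * cos (\<theta>\<^sub>1 r)"
    "k * ?h2 r - \<mu>\<^sub>2 * r\<^sup>2 * ?D2 r = n2 r * cos (\<theta>\<^sub>2 r)" if "r \<in> {0..R}" for r
    using arg_cong[OF polar(1)[OF that], of Re] arg_cong[OF polar(2)[OF that], of Re]
    by (simp_all add: n1_def n2_def W1.rad_phase_def W2.rad_phase_def)
  define \<delta> where "\<delta> r = \<theta>\<^sub>2 r - \<theta>\<^sub>1 r" for r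
  have cont_\<delta>: "continuous_on {0..R} \<delta>" unfolding \<delta>_def by (intro continuous_intros cont)
  \<comment> \<open>With \<open>w1 = r ^ k * ?h1\<close> and \<open>w2 = r ^ k * ?h2\<close> this is
    \<open>r * (w1' * w2 - w1 * w2')\<close>; the terms with the factor \<open>k\<close>
    cancel.\<close>
  define S where "S r = \<mu>\<^sub>2 * (r ^ (2 * k + 2) * ?D2 r) * ?h1 r - \<mu>\<^sub>1 * (r ^ (2 * k + 2) * ?D1 r) * ?h2 r" for r
  have S_eq: "S r = r ^ (2 * k) * (n1 r * n2 r * sin (\<delta> r))" if r: "r \<in> {0..R}" for r
  proof -
    have "S r = r ^ (2 * k) * (\<mu>\<^sub>2 * r\<^sup>2 * ?D2 r * ?h1 r - \<mu>\<^sub>1 * r\<^sup>2 * ?D1 r * ?h2 r)"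
      by (simp add: S_def power_add power2_eq_square algebra_simps)
    also have "\<mu>\<^sub>2 * r\<^sup>2 * ?D2 r * ?h1 r - \<mu>\<^sub>1 * r\<^sup>2 * ?D1 r * ?h2 r =
        (k * ?h1 r - \<mu>\<^sub>1 * r\<^sup>2 * ?D1 r) * ?h2 r - (k * ?h2 r - \<mu>\<^sub>2 * r\<^sup>2 * ?D2 r) * ?h1 r"
      by (simp add: algebra_simps)
    also have "\<dots> = n1 r * n2 r * sin (\<delta> r)"
      unfolding re_eq[OF r] unfolding h_eq[OF r] \<delta>_def sin_diff by (simp add: algebra_simps)
    finally show ?thesis .
  qed
  have dS: "(S has_real_derivative r ^ (2 * k + 1) * (\<mu>\<^sub>2 * \<Phi>\<^sub>2 r - \<mu>\<^sub>1 * \<Phi>\<^sub>1 r) * (?h1 r * ?h2 r)) (at r)"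
    if r: "r \<in> {0<..<R}" for r
  proof -
    have "(S has_real_derivative
        (\<mu>\<^sub>2 * (r ^ (2 * k + 1) * (\<Phi>\<^sub>2 r * ?h2 r)) * ?h1 r
          + (- \<mu>\<^sub>1 * r * ?D1 r) * (\<mu>\<^sub>2 * (r ^ (2 * k + 2) * ?D2 r)))
        - (\<mu>\<^sub>1 * (r ^ (2 * k + 1) * (\<Phi>\<^sub>1 r * ?h1 r)) * ?h2 r
          + (- \<mu>\<^sub>2 * r * ?D2 r) * (\<mu>\<^sub>1 * (r ^ (2 * k + 2) * ?D1 r)))) (at r)"
      unfolding S_def[abs_def]
      by (intro DERIV_diff DERIV_mult DERIV_cmult W1.DERIV_rad_sol W2.DERIV_rad_sol
          W1.DERIV_power_rad_flux W2.DERIV_power_rad_flux r)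
    then show ?thesis by (simp add: algebra_simps)
  qed
  have contS: "continuous_on {0..R} S"
    unfolding S_def
    by (intro continuous_intros W1.continuous_on_rad_sol W2.continuous_on_rad_sol
        W1.continuous_on_rad_flux W2.continuous_on_rad_flux)
  text \<open>Near the centre both solutions are positive, so the angles separate.\<close>
  obtain e where e: "0 < e" "e < R" "\<delta> e > 0"
  proof -
    have near: "\<exists>e>0. \<forall>r\<in>{0..R}. r < e \<longrightarrow> f r > 0" if f: "continuous_on {0..R} f" "f 0 > 0"
      for f :: "real \<Rightarrow> real"
    proof -
      obtain e where "e > 0" "\<forall>r\<in>{0..R}. dist r 0 < e \<longrightarrow> dist (f r) (f 0) < f 0"
        using f R unfolding continuous_on_iff by (metis atLeastAtMost_iff order_refl less_eq_real_def)
      then show ?thesis by (intro exI[of _ e]) (force simp: dist_real_def)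
    qed
    obtain e1 where e1: "e1 > 0" "\<And>r. r \<in> {0..R} \<Longrightarrow> r < e1 \<Longrightarrow> ?h1 r > 0"
      using near[OF W1.continuous_on_rad_sol, of k \<mu>\<^sub>1] by (auto simp: W1.rad_sol_0)
    obtain e2 where e2: "e2 > 0" "\<And>r. r \<in> {0..R} \<Longrightarrow> r < e2 \<Longrightarrow> ?h2 r > 0"
      using near[OF W2.continuous_on_rad_sol, of k \<mu>\<^sub>2] by (auto simp: W2.rad_sol_0)
    have "continuous_on {0..R} (\<lambda>r. pi - \<bar>\<delta> r\<bar>)" by (intro continuous_intros cont_\<delta>)
    then obtain e3 where e3: "e3 > 0" "\<And>r. r \<in> {0..R} \<Longrightarrow> r < e3 \<Longrightarrow> pi - \<bar>\<delta> r\<bar> > 0"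
      using near[of "\<lambda>r. pi - \<bar>\<delta> r\<bar>"] start by (auto simp: \<delta>_def)
    define e where "e = min (min e1 e2) (min e3 (min d R)) / 2"
    have e: "0 < e" "e < e1" "e < e2" "e < e3" "e < d" "e < R"
      using e1 e2 e3 less R by (auto simp: e_def)
    have "S 0 < S e"
    proof (rule DERIV_pos_imp_increasing_open[OF e(1)])
      fix r assume r: "0 < r" "r < e"
      have "0 < r ^ (2 * k + 1) * (\<mu>\<^sub>2 * \<Phi>\<^sub>2 r - \<mu>\<^sub>1 * \<Phi>\<^sub>1 r) * (?h1 r * ?h2 r)"
        using r e less(2)[of r] e1(2)[of r] e2(2)[of r] by (intro mult_pos_pos zero_less_power) auto
      then show "\<exists>y. (S has_real_derivative y) (at r) \<and> 0 < y"
        using dS[of r] r e by auto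
    qed (use e in \<open>auto intro: continuous_on_subset[OF contS]\<close>)
    then have "0 < S e" by (simp add: S_def)
    then have "0 < sin (\<delta> e)"
      using n_pos[of e] e S_eq[of e]
        zero_less_mult_pos[of "e ^ (2 * k) * (n1 e * n2 e)" "sin (\<delta> e)"]
      by (simp add: mult.assoc)
    moreover have "\<bar>\<delta> e\<bar> < pi" using e3(2)[of e] e by simp
    ultimately have "\<delta> e > 0"
      using sin_ge_zero[of "- \<delta> e"] by (cases "\<delta> e \<le> 0") auto
    with e show ?thesis by (intro that[of e]) auto
  qed
  text \<open>As long as \<open>0 \<le> \<delta> \<le> \<pi> / 2\<close> the Wronskian satisfies \<open>S' \<ge> - C S\<close>, so it cannot fall back to 0,
    and neither can \<open>\<delta>\<close>.\<close>
  have "\<delta> R > 0"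
  proof (rule ccontr)
    assume "\<not> \<delta> R > 0"
    define Z where "Z = {r \<in> {e..R}. \<delta> r \<le> 0}"
    have "closed Z" unfolding Z_def
    proof (rule continuous_on_closed_Collect_le)
      show "continuous_on {e..R} \<delta>" by (rule continuous_on_subset[OF cont_\<delta>]) (use e in auto)
    qed auto
    moreover have Zne: "Z \<noteq> {}" using e \<open>\<not> \<delta> R > 0\<close> by (auto simp: Z_def)
    moreover have bdd: "bdd_below Z" by (auto simp: Z_def bdd_below_def)
    ultimately have "Inf Z \<in> Z" by (intro closed_contains_Inf)
    \<comment> \<open>The first radius from \<open>e\<close> on where \<delta> is no longer
      positive; continuity makes it an exact zero.\<close>
    define c where "c = Inf Z"
    have "c \<in> Z" using \<open>Inf Z \<in> Z\<close> by (simp add: c_def)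
    then have c': "e \<le> c" "c \<le> R" "\<delta> c \<le> 0" by (auto simp: Z_def)
    moreover have "e \<noteq> c" using c' e by auto
    ultimately have c: "e < c" "c \<le> R" "\<delta> c \<le> 0" by auto
    have before: "\<delta> r > 0" if "r \<in> {e..<c}" for r
    proof (rule ccontr)
      assume "\<not> \<delta> r > 0"
      then have "r \<in> Z" using that c by (auto simp: Z_def)
      then have "c \<le> r" unfolding c_def by (intro cInf_lower bdd)
      then show False using that by simp
    qed
    have c0: "\<delta> c = 0"
    proof (rule ccontr)
      assume "\<delta> c \<noteq> 0"
      then have "\<delta> c < 0" using c by simp
      have "continuous_on {e..c} \<delta>"
        by (rule continuous_on_subset[OF cont_\<delta>]) (use e c in auto)
      then obtain x where "e \<le> x" "x \<le> c" "\<delta> x = 0"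
        using IVT2'[of \<delta> c 0 e] c e \<open>\<delta> c < 0\<close> by auto
      then show False using before[of x] \<open>\<delta> c < 0\<close> by (cases "x = c") auto
    qed
    obtain b where b: "e \<le> b" "b < c" "\<And>r. r \<in> {b..c} \<Longrightarrow> \<delta> r < pi / 2"
    proof -
      obtain \<epsilon> where \<epsilon>: "\<epsilon> > 0" "\<forall>r\<in>{0..R}. dist r c < \<epsilon> \<longrightarrow> dist (\<delta> r) (\<delta> c) < pi / 2"
      proof -
        have "c \<in> {0..R}" using c e by auto
        then show ?thesis
          using that cont_\<delta>[unfolded continuous_on_iff, rule_format, of c "pi / 2"] pi_half_gt_zero
          by blast
      qed
      show ?thesis
      proof (rule that[of "max e (c - \<epsilon> / 2)"])
        fix r assume r: "r \<in> {max e (c - \<epsilon> / 2)..c}"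
        then have "dist r c < \<epsilon>" "r \<in> {0..R}" using \<epsilon>(1) e c by (auto simp: dist_real_def)
        then have "dist (\<delta> r) (\<delta> c) < pi / 2" using \<epsilon>(2) by blast
        then show "\<delta> r < pi / 2" unfolding c0 dist_real_def by linarith
      qed (use c \<epsilon> in auto)
    qed
    \<comment> \<open>Chosen to bound \<open>r\<close> times the difference of the two potentials on
      the whole interval.\<close>
    define C where "C = R * (\<bar>\<mu>\<^sub>2\<bar> * W2.weight_bound + \<bar>\<mu>\<^sub>1\<bar> * W1.weight_bound)"
    have "S b * exp (C * b) \<le> S c * exp (C * c)"
    proof (rule DERIV_nonneg_imp_increasing_open[where f = "\<lambda>r. S r * exp (C * r)"])
      show "b \<le> c" using b by simp
      have "continuous_on {b..c} S" by (rule continuous_on_subset[OF contS]) (use b c e in auto)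
      then show "continuous_on {b..c} (\<lambda>r. S r * exp (C * r))" by (intro continuous_intros)
      fix r assume r: "b < r" "r < c"
      have rR: "r \<in> {0<..<R}" "r \<in> {0..R}" using r b c e by auto
      have gen: "- x \<le> y \<Longrightarrow> x \<le> z \<Longrightarrow> 0 \<le> y + z" for x y z :: real by linarith
      let ?V = "\<mu>\<^sub>2 * \<Phi>\<^sub>2 r - \<mu>\<^sub>1 * \<Phi>\<^sub>1 r"
      let ?N = "r ^ (2 * k) * (n1 r * n2 r)"
      have \<delta>r: "0 < \<delta> r" "\<delta> r < pi / 2" using before[of r] b(3)[of r] r b by auto
      have sin0: "0 \<le> sin (\<delta> r)" "0 \<le> cos (\<delta> r)"
        using \<delta>r by (auto intro!: sin_ge_zero cos_ge_zero)
      have N0: "0 \<le> ?N" using n_pos[OF rR(2)] rR by (intro mult_nonneg_nonneg) auto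
      have V0: "0 \<le> ?V" using le[OF rR(2)] by simp
      have VC: "r * ?V \<le> C"
      proof -
        have "?V \<le> \<bar>\<mu>\<^sub>2\<bar> * \<bar>\<Phi>\<^sub>2 r\<bar> + \<bar>\<mu>\<^sub>1\<bar> * \<bar>\<Phi>\<^sub>1 r\<bar>"
          unfolding abs_mult[symmetric] by linarith
        also have "\<dots> \<le> \<bar>\<mu>\<^sub>2\<bar> * W2.weight_bound + \<bar>\<mu>\<^sub>1\<bar> * W1.weight_bound"
          using W1.abs_weight_le[OF rR(2)] W2.abs_weight_le[OF rR(2)]
          by (intro add_mono mult_left_mono) auto
        finally show ?thesis unfolding C_def using rR V0 by (intro mult_mono) auto
      qed
      \<comment> \<open>Expanding the sine of \<open>\<theta>\<^sub>1 r + \<delta> r\<close> leaves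
        a square times a nonnegative cosine and a term of size at most
        \<open>sin (\<delta> r)\<close>. So where the product of the solutions is negative, the
        Wronskian itself controls it.\<close>
      have "- (sin (\<delta> r)) \<le> sin (\<theta>\<^sub>1 r) * sin (\<theta>\<^sub>2 r)"
      proof -
        have "\<theta>\<^sub>2 r = \<theta>\<^sub>1 r + \<delta> r" by (simp add: \<delta>_def)
        then have "sin (\<theta>\<^sub>1 r) * sin (\<theta>\<^sub>2 r) =
            (sin (\<theta>\<^sub>1 r))\<^sup>2 * cos (\<delta> r) + (sin (\<theta>\<^sub>1 r) * cos (\<theta>\<^sub>1 r)) * sin (\<delta> r)"
          by (simp add: sin_add power2_eq_square algebra_simps)
        moreover have "\<bar>sin (\<theta>\<^sub>1 r) * cos (\<theta>\<^sub>1 r)\<bar> \<le> 1"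
          unfolding abs_mult by (intro mult_le_one) auto
        then have "(sin (\<theta>\<^sub>1 r) * cos (\<theta>\<^sub>1 r)) * sin (\<delta> r) \<ge> (- 1) * sin (\<delta> r)"
          using sin0 by (intro mult_right_mono) auto
        moreover have "0 \<le> (sin (\<theta>\<^sub>1 r))\<^sup>2 * cos (\<delta> r)" using sin0 by simp
        ultimately show ?thesis by linarith
      qed
      then have "r * ?V * (?N * - sin (\<delta> r)) \<le> r * ?V * (?N * (sin (\<theta>\<^sub>1 r) * sin (\<theta>\<^sub>2 r)))"
        using V0 N0 rR by (intro mult_left_mono) auto
      also have "\<dots> = r ^ (2 * k + 1) * ?V * (?h1 r * ?h2 r)"
        unfolding h_eq[OF rR(2)] by (simp add: mult_ac)
      finally have "- (r * ?V * S r) \<le> r ^ (2 * k + 1) * ?V * (?h1 r * ?h2 r)"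
        unfolding S_eq[OF rR(2)] by (simp add: mult_ac)
      moreover have "r * ?V * S r \<le> C * S r"
        using VC N0 sin0 unfolding S_eq[OF rR(2)]
        by (intro mult_right_mono) (auto simp: mult.assoc[symmetric] intro!: mult_nonneg_nonneg[of "?N"])
      ultimately have "0 \<le> r ^ (2 * k + 1) * ?V * (?h1 r * ?h2 r) + C * S r"
        by (rule gen)
      then have "0 \<le> (r ^ (2 * k + 1) * ?V * (?h1 r * ?h2 r) + C * S r) * exp (C * r)" by simp
      moreover have "((\<lambda>r. S r * exp (C * r)) has_real_derivative
          (r ^ (2 * k + 1) * ?V * (?h1 r * ?h2 r) + C * S r) * exp (C * r)) (at r)"
        by (rule derivative_eq_intros refl dS[OF rR(1)] | simp add: algebra_simps)+
      ultimately show "\<exists>y. ((\<lambda>r. S r * exp (C * r)) has_real_derivative y) (at r) \<and> 0 \<le> y"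
        by blast
    qed
    moreover have "S c = 0" using S_eq[of c] c0 c e by simp
    moreover have "0 < S b"
    proof -
      have "b \<in> {0..R}" "0 < b" using b c e by auto
      moreover have "0 < sin (\<delta> b)"
      proof (rule sin_gt_zero)
        show "0 < \<delta> b" using before[of b] b(1,2) by simp
        have "\<delta> b < pi / 2" using b(3)[of b] b(2) by simp
        then show "\<delta> b < pi" using pi_gt_zero by linarith
      qed
      ultimately show ?thesis
        using n_pos[of b] by (simp add: S_eq)
    qed
    ultimately show False by (simp add: mult_le_0_iff)
  qed
  then show ?thesis by (simp add: \<delta>_def)
qed

lemma radial_weight_one: "0 < R \<Longrightarrow> radial_weight R (\<lambda>_. 1)"
  by unfold_locales auto

text \<open>The target angle lies strictly between the angles of \<open>\<Phi>\<close> at the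
  parameters 0 and \<kappa>, because at 0 both weights have the same angle. A zero at
  \<open>R\<close> means that the sine of the angle vanishes, so it is transferred along with the
  angle.\<close>

lemma mode_eigenvalue_injection:
  assumes W: "radial_weight R \<Phi>"
    and ge: "\<And>r. r \<in> {0..R} \<Longrightarrow> 1 \<le> \<Phi> r"
    and gr: "0 < d" "\<And>r. r \<in> {0<..<d} \<Longrightarrow> 1 < \<Phi> r"
  shows "\<exists>f. inj_on f {\<kappa>. radial_weight.rad_sol (\<lambda>_. 1) k \<kappa> R = 0} \<and>
    (\<forall>\<kappa>. radial_weight.rad_sol (\<lambda>_. 1) k \<kappa> R = 0 \<longrightarrow>
      f \<kappa> < \<kappa> \<and> radial_weight.rad_sol \<Phi> k (f \<kappa>) R = 0)"
proof -
  interpret W2: radial_weight R \<Phi> by fact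
  note R = W2.R_pos
  interpret W1: radial_weight R "\<lambda>_. 1" by (rule radial_weight_one[OF R])
  have RR: "R \<in> {0..R}" using R by simp
  obtain \<theta>1 where t1: "continuous_on ({0..R} \<times> UNIV) (\<lambda>(r, \<mu>). \<theta>1 r \<mu>)"
    "\<And>r \<mu>. r \<in> {0..R} \<Longrightarrow> W1.rad_phase k \<mu> r = of_real (cmod (W1.rad_phase k \<mu> r)) * cis (\<theta>1 r \<mu>)"
    "\<And>\<mu>. \<theta>1 0 \<mu> = Arg (Complex k 1)" "\<And>r. r \<in> {0..R} \<Longrightarrow> \<theta>1 r 0 = Arg (Complex k 1)"
    by (rule W1.exists_angle[of k], rule that)
  obtain \<theta>2 where t2: "continuous_on ({0..R} \<times> UNIV) (\<lambda>(r, \<mu>). \<theta>2 r \<mu>)"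
    "\<And>r \<mu>. r \<in> {0..R} \<Longrightarrow> W2.rad_phase k \<mu> r = of_real (cmod (W2.rad_phase k \<mu> r)) * cis (\<theta>2 r \<mu>)"
    "\<And>\<mu>. \<theta>2 0 \<mu> = Arg (Complex k 1)" "\<And>r. r \<in> {0..R} \<Longrightarrow> \<theta>2 r 0 = Arg (Complex k 1)"
    by (rule W2.exists_angle[of k], rule that)
  have slice: "continuous_on {0..R} (\<lambda>r. \<theta> r \<mu>)" "continuous_on UNIV (\<lambda>\<mu>. \<theta> R \<mu>)"
    if "continuous_on ({0..R} \<times> UNIV) (\<lambda>(r, \<mu>). \<theta> r \<mu>)" for \<theta> :: "real \<Rightarrow> real \<Rightarrow> real" and \<mu>
    using continuous_on_compose2[OF that, of "{0..R}" "\<lambda>r. (r, \<mu>)"]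
      continuous_on_compose2[OF that, of UNIV "\<lambda>\<mu>. (R, \<mu>)"] RR
    by (force intro!: continuous_intros)+
  let ?E = "{\<kappa>. W1.rad_sol k \<kappa> R = 0}"
  have pos: "0 < \<kappa>" if "\<kappa> \<in> ?E" for \<kappa>
    using W1.rad_sol_ge_1[of \<kappa> R k] that RR by (cases "\<kappa> \<le> 0") auto
  \<comment> \<open>Comparison of the constant weight with itself at two parameters.\<close>
  have mono1: "\<theta>1 R \<kappa> < \<theta>1 R \<kappa>'" if "\<kappa> < \<kappa>'" for \<kappa> \<kappa>'
    by (rule angle_comparison[OF W1.radial_weight_axioms W1.radial_weight_axioms, where d = 1 and k = k
          and \<mu>\<^sub>1 = \<kappa> and \<mu>\<^sub>2 = \<kappa>'])
      (use that slice(1)[OF t1(1)] t1 in auto)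
  have mono2: "\<theta>1 R \<kappa> < \<theta>2 R \<kappa>" if "0 < \<kappa>" for \<kappa>
    by (rule angle_comparison[OF W1.radial_weight_axioms W2.radial_weight_axioms, where d = d and k = k
          and \<mu>\<^sub>1 = \<kappa> and \<mu>\<^sub>2 = \<kappa>])
      (use that ge gr slice(1)[OF t1(1)] slice(1)[OF t2(1)] t1 t2 in auto)
  have sin1: "W1.rad_sol k \<kappa> R = 0 \<longleftrightarrow> sin (\<theta>1 R \<kappa>) = 0" for \<kappa>
    using arg_cong[OF t1(2)[OF RR, of \<kappa>], of Im] W1.rad_phase_nonzero[OF RR, of k \<kappa>] by auto
  have sin2: "W2.rad_sol k \<kappa> R = 0 \<longleftrightarrow> sin (\<theta>2 R \<kappa>) = 0" for \<kappa>
    using arg_cong[OF t2(2)[OF RR, of \<kappa>], of Im] W2.rad_phase_nonzero[OF RR, of k \<kappa>] by auto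
  have ex: "\<exists>\<nu>. \<nu> < \<kappa> \<and> \<theta>2 R \<nu> = \<theta>1 R \<kappa>" if \<kappa>: "\<kappa> \<in> ?E" for \<kappa>
  proof -
    have a: "\<theta>2 R 0 = \<theta>1 R 0" using t1(4) t2(4) RR by simp
    have "\<theta>2 R 0 < \<theta>1 R \<kappa>" "\<theta>1 R \<kappa> < \<theta>2 R \<kappa>"
      using mono1[OF pos[OF \<kappa>]] mono2[OF pos[OF \<kappa>]] a by auto
    moreover have "continuous_on {0..\<kappa>} (\<theta>2 R)"
      by (rule continuous_on_subset[OF slice(2)[OF t2(1)]]) simp
    ultimately obtain \<nu> where "0 \<le> \<nu>" "\<nu> \<le> \<kappa>" "\<theta>2 R \<nu> = \<theta>1 R \<kappa>"
      using IVT'[of "\<theta>2 R" 0 "\<theta>1 R \<kappa>" \<kappa>] pos[OF \<kappa>] by auto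
    then show ?thesis using \<open>\<theta>1 R \<kappa> < \<theta>2 R \<kappa>\<close>
      by (intro exI[of _ \<nu>]) (auto simp: order_less_le)
  qed
  then obtain f where f: "\<And>\<kappa>. \<kappa> \<in> ?E \<Longrightarrow> f \<kappa> < \<kappa> \<and> \<theta>2 R (f \<kappa>) = \<theta>1 R \<kappa>"
    by metis
  have "inj_on f ?E"
  proof (rule inj_onI)
    fix x y assume "x \<in> ?E" "y \<in> ?E" "f x = f y"
    then have "\<theta>1 R x = \<theta>1 R y" using f by metis
    then show "x = y" using mono1[of x y] mono1[of y x] by (cases x y rule: linorder_cases) auto
  qed
  moreover have "f \<kappa> < \<kappa> \<and> W2.rad_sol k (f \<kappa>) R = 0" if "W1.rad_sol k \<kappa> R = 0" for \<kappa>
    using f[of \<kappa>] that sin1[of \<kappa>] sin2[of "f \<kappa>"] by auto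
  ultimately show ?thesis by blast
qed

section \<open>Fourier coefficients on circles\<close>

definition polar :: "real \<Rightarrow> real \<Rightarrow> real^2" where
  "polar r t = vector [r * cos t, r * sin t]"

lemma polar_component [simp]: "polar r t $ 1 = r * cos t" "polar r t $ 2 = r * sin t"
  by (simp_all add: polar_def)

lemma norm_polar [simp]: "norm (polar r t) = \<bar>r\<bar>"
proof -
  have "(r * cos t)\<^sup>2 + (r * sin t)\<^sup>2 = r\<^sup>2 * ((cos t)\<^sup>2 + (sin t)\<^sup>2)"
    unfolding power_mult_distrib by (simp only: distrib_left)
  then show ?thesis by (simp add: norm_vec_def L2_set_def sum_2)
qed

lemma polar_surj:
  assumes "norm z = r" "0 < r"
  obtains t where "t \<in> {0..2 * pi}" "z = polar r t"
proof -
  have "(z $ 1 / r)\<^sup>2 + (z $ 2 / r)\<^sup>2 = ((z $ 1)\<^sup>2 + (z $ 2)\<^sup>2) / r\<^sup>2"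
    by (simp add: power_divide add_divide_distrib)
  also have "(z $ 1)\<^sup>2 + (z $ 2)\<^sup>2 = r\<^sup>2"
    unfolding assms(1)[symmetric] by (simp add: norm_vec_def L2_set_def sum_2)
  finally obtain t where "0 \<le> t" "t < 2 * pi" "z $ 1 / r = cos t" "z $ 2 / r = sin t"
    using sincos_total_2pi[of "z $ 1 / r" "z $ 2 / r"] assms by auto
  then show ?thesis using assms
    by (intro that[of t]) (auto simp: vec_eq_iff forall_2 field_simps)
qed

lemma continuous_on_vector_2:
  fixes f g :: "'a::topological_space \<Rightarrow> real"
  assumes "continuous_on A f" "continuous_on A g"
  shows "continuous_on A (\<lambda>x. vector [f x, g x] :: real^2)"
proof (rule continuous_on_vec_lambda[where f = "\<lambda>i x. (vector [f x, g x] :: real^2) $ i", simplified])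
  fix i :: 2
  show "continuous_on A (\<lambda>x. (vector [f x, g x] :: real^2) $ i)"
    using assms exhaust_2[of i] by auto
qed

lemma continuous_on_polar [continuous_intros]:
  fixes f g :: "'a::t2_space \<Rightarrow> real"
  shows "continuous_on A f \<Longrightarrow> continuous_on A g \<Longrightarrow> continuous_on A (\<lambda>x. polar (f x) (g x))"
  unfolding polar_def by (intro continuous_on_vector_2 continuous_intros)

text \<open>The real harmonics \<open>cos (k t)\<close> and \<open>sin (k t)\<close> are \<open>Re (c e\<^sup>i\<^sup>k\<^sup>t)\<close> for \<open>c = 1\<close> and \<open>c = -\<i>\<close>.\<close>

definition circ :: "nat \<Rightarrow> complex \<Rightarrow> real \<Rightarrow> real" where
  "circ k c t = Re (c * cis (real k * t))"

text \<open>The pair \<open>(0, - \<i>)\<close> is left out because its harmonic is identically 0;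
  the others are orthogonal on the circle.\<close>

definition modes :: "(nat \<times> complex) set" where
  "modes = {(k, c). c = 1 \<or> (c = - \<i> \<and> 1 \<le> k)}"

definition circ_coeff :: "nat \<Rightarrow> complex \<Rightarrow> (real^2 \<Rightarrow> real) \<Rightarrow> real \<Rightarrow> real" where
  "circ_coeff k c u r = integral {0..2 * pi} (\<lambda>t. u (polar r t) * circ k c t)"

lemma circ_eq: "circ k c t = Re c * cos (k * t) - Im c * sin (k * t)"
  by (simp add: circ_def)

lemma continuous_on_circ [continuous_intros]:
  fixes f :: "'a::t2_space \<Rightarrow> real"
  shows "continuous_on A f \<Longrightarrow> continuous_on A (\<lambda>x. circ k c (f x))"
  unfolding circ_eq by (intro continuous_intros)

lemma has_integral_cis_period:
  assumes "n \<noteq> 0"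
  shows "((\<lambda>t. Re (a * cis (of_int n * t))) has_integral 0) {0..2 * pi}"
proof -
  let ?F = "\<lambda>t. (Re a * sin (of_int n * t) + Im a * cos (of_int n * t)) / of_int n"
  have "((\<lambda>t. Re (a * cis (of_int n * t))) has_integral (?F (2 * pi) - ?F 0)) {0..2 * pi}"
  proof (rule fundamental_theorem_of_calculus)
    fix x
    have "(?F has_real_derivative Re (a * cis (of_int n * x))) (at x within {0..2 * pi})"
      using assms by (auto intro!: derivative_eq_intros simp: field_simps)
    then show "(?F has_vector_derivative Re (a * cis (of_int n * x))) (at x within {0..2 * pi})"
      by (simp add: has_real_derivative_iff_has_vector_derivative)
  qed simp
  moreover have "sin (of_int n * (2 * pi)) = 0" "cos (of_int n * (2 * pi)) = 1"
    using sin_int_2pin[of n] cos_int_2pin[of n] by (simp_all add: mult_ac)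
  ultimately show ?thesis by simp
qed

text \<open>From \<open>2 * Re a * Re b = Re (a * b) + Re (a * cnj b)\<close>. It serves both the
  orthogonality of the harmonics and the closure of trigonometric polynomials under
  products.\<close>

lemma circ_mult:
  "circ k c t * circ k' c' t =
    (Re (c * c' * cis (of_int (int k + int k') * t)) +
     Re (c * cnj c' * cis (of_int (int k - int k') * t))) / 2"
proof -
  have e: "of_int (int k + int k') * t = k * t + k' * t" "of_int (int k - int k') * t = k * t - k' * t"
    by (simp_all add: algebra_simps)
  show ?thesis
    unfolding e circ_def
    by (simp add: cos_add sin_add cos_diff sin_diff) (simp add: algebra_simps)
qed

text \<open>In the product formula every nonzero frequency integrates to 0 over the period. For
  \<open>k = 0\<close> the sum and the difference of the frequencies both vanish, which doubles the
  norm.\<close>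

lemma has_integral_circ_mult:
  assumes "(k, c) \<in> modes" "(k', c') \<in> modes"
  shows "((\<lambda>t. circ k c t * circ k' c' t) has_integral
    (if (k, c) = (k', c') then (if k = 0 then 2 * pi else pi) else 0)) {0..2 * pi}"
proof -
  let ?A = "\<lambda>t. Re (c * c' * cis (of_int (int k + int k') * t))"
  let ?B = "\<lambda>t. Re (c * cnj c' * cis (of_int (int k - int k') * t))"
  have A: "(?A has_integral (if k + k' = 0 then Re (c * c') * (2 * pi) else 0)) {0..2 * pi}"
  proof (cases "k + k' = 0")
    case True
    then show ?thesis using has_integral_const_real[of "Re (c * c')" 0 "2 * pi"] by (simp add: mult_ac)
  next
    case False
    then show ?thesis using has_integral_cis_period[of "int k + int k'" "c * c'"] by auto
  qed
  have B: "(?B has_integral (if k = k' then Re (c * cnj c') * (2 * pi) else 0)) {0..2 * pi}"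
  proof (cases "k = k'")
    case True
    then show ?thesis using has_integral_const_real[of "Re (c * cnj c')" 0 "2 * pi"] by (simp add: mult_ac)
  next
    case False
    then show ?thesis using has_integral_cis_period[of "int k - int k'" "c * cnj c'"] by auto
  qed
  have "((\<lambda>t. circ k c t * circ k' c' t) has_integral
      ((if k + k' = 0 then Re (c * c') * (2 * pi) else 0) +
       (if k = k' then Re (c * cnj c') * (2 * pi) else 0)) / 2) {0..2 * pi}"
    unfolding circ_mult by (intro has_integral_divide has_integral_add A B)
  moreover have "((if k + k' = 0 then Re (c * c') * (2 * pi) else 0) +
       (if k = k' then Re (c * cnj c') * (2 * pi) else 0)) / 2 =
      (if (k, c) = (k', c') then (if k = 0 then 2 * pi else pi) else 0)"
    using assms by (auto simp: modes_def)
  ultimately show ?thesis by (simp only:)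
qed

text \<open>Complex amplitudes absorb scalar multiples and phase shifts, so sums of single harmonics
  already form an algebra.\<close>

inductive trig_poly :: "(real \<Rightarrow> real) \<Rightarrow> bool" where
  trig_monom: "trig_poly (\<lambda>t. circ k c t)"
| trig_add: "trig_poly f \<Longrightarrow> trig_poly g \<Longrightarrow> trig_poly (\<lambda>t. f t + g t)"

lemma trig_poly_cis_int: "trig_poly (\<lambda>t. Re (c * cis (of_int n * t)))"
proof (cases "0 \<le> n")
  case True
  then have "(\<lambda>t. Re (c * cis (of_int n * t))) = (\<lambda>t. circ (nat n) c t)"
    by (auto simp: circ_def of_nat_nat)
  then show ?thesis by (simp add: trig_monom)
next
  case False
  then have "(\<lambda>t. Re (c * cis (of_int n * t))) = (\<lambda>t. circ (nat (- n)) (cnj c) t)"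
    by (auto simp: circ_eq)
  then show ?thesis by (simp add: trig_monom)
qed

lemma trig_poly_mult:
  assumes "trig_poly f" "trig_poly g"
  shows "trig_poly (\<lambda>t. f t * g t)"
  using assms
proof (induction f)
  case (trig_monom k c)
  from trig_monom.prems show ?case
  proof (induction g)
    case (trig_monom k' c')
    have "(\<lambda>t. circ k c t * circ k' c' t) =
      (\<lambda>t. Re ((c * c' / 2) * cis (of_int (int k + int k') * t)) +
        Re ((c * cnj c' / 2) * cis (of_int (int k - int k') * t)))"
      unfolding circ_mult by (simp add: fun_eq_iff add_divide_distrib diff_divide_distrib)
    then show ?case by (simp only:) (intro trig_add trig_poly_cis_int)
  next
    case (trig_add f g)
    then show ?case using trig_poly.trig_add by (simp add: distrib_left)
  qed
next
  case (trig_add f g)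
  then show ?case using trig_poly.trig_add by (simp add: distrib_right)
qed

text \<open>On a circle the coordinates are harmonics of order 1 and constants are harmonics of
  order 0. This links Stone-Weierstrass approximation in the plane to Fourier coefficients.\<close>

lemma trig_poly_real_polynomial:
  fixes p :: "real^2 \<Rightarrow> real"
  assumes "real_polynomial_function p"
  shows "trig_poly (\<lambda>t. p (polar r t))"
  using assms
proof induction
  case (linear f)
  interpret bounded_linear f by fact
  have "polar r t = (r * cos t) *\<^sub>R axis 1 1 + (r * sin t) *\<^sub>R axis 2 1" for t
    by (simp add: vec_eq_iff forall_2 axis_def)
  then have "f (polar r t) = (r * cos t) * f (axis 1 1) + (r * sin t) * f (axis 2 1)" for t
    by (simp add: add scaleR)
  then have "(\<lambda>t. f (polar r t)) = (\<lambda>t. circ 1 (Complex (r * f (axis 1 1)) (- r * f (axis 2 1))) t)"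
    by (simp add: circ_eq fun_eq_iff)
  then show ?case by (simp only:) (rule trig_monom)
next
  case (const c)
  have "(\<lambda>t. c) = (\<lambda>t. circ 0 (of_real c) t)" by (simp add: circ_eq)
  then show ?case by (simp only:) (rule trig_monom)
next
  case (add f g)
  then show ?case by (intro trig_add)
next
  case (mult f g)
  then show ?case by (intro trig_poly_mult)
qed

text \<open>Vanishing coefficients make \<open>u\<close> orthogonal on the circle to all
  trigonometric polynomials, hence to every restricted polynomial. Approximating \<open>u\<close>
  uniformly by such a polynomial makes the integral of its square arbitrarily small.\<close>

lemma circ_coeff_complete:
  assumes r: "0 < r" and cont: "continuous_on (sphere 0 r) u"
    and zero: "\<And>k c. (k, c) \<in> modes \<Longrightarrow> circ_coeff k c u r = 0"
    and z: "norm z = r"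
  shows "u z = 0"
proof -
  define U where "U t = u (polar r t)" for t
  have contU: "continuous_on A U" for A
    unfolding U_def using r
    by (intro continuous_on_compose2[OF cont] continuous_intros) auto
  have int: "(\<lambda>t. U t * f t) integrable_on {0..2 * pi}" if "continuous_on {0..2 * pi} f" for f :: "real \<Rightarrow> real"
    by (intro integrable_continuous_interval continuous_intros contU that)
  have ann: "continuous_on {0..2 * pi} f \<and> integral {0..2 * pi} (\<lambda>t. U t * f t) = 0" if "trig_poly f" for f
    using that
  proof induction
    case (trig_monom k c)
    have eq: "U t * circ k c t = Re c * (U t * circ k 1 t) - Im c * (U t * circ k (- \<i>) t)" for t
      by (simp add: circ_eq algebra_simps)
    have "integral {0..2 * pi} (\<lambda>t. U t * circ k 1 t) = 0"
      using zero[of k 1] by (simp add: modes_def circ_coeff_def U_def)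
    \<comment> \<open>For \<open>k = 0\<close> the pair is not in \<open>modes\<close>, but then the
      harmonic is 0.\<close>
    moreover have "integral {0..2 * pi} (\<lambda>t. U t * circ k (- \<i>) t) = 0"
      using zero[of k "- \<i>"] by (cases "k = 0") (auto simp: modes_def circ_coeff_def U_def circ_eq)
    moreover have "integral {0..2 * pi} (\<lambda>t. U t * circ k c t) =
        Re c * integral {0..2 * pi} (\<lambda>t. U t * circ k 1 t) -
        Im c * integral {0..2 * pi} (\<lambda>t. U t * circ k (- \<i>) t)"
      unfolding eq
      by (subst integral_diff) (auto intro!: integrable_on_mult_right int continuous_intros)
    ultimately show ?case by (auto intro!: continuous_intros)
  next
    case (trig_add f g)
    then show ?case
      by (auto simp: distrib_left integral_add[OF int int] intro!: continuous_intros)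
  qed
  have "integral {0..2 * pi} (\<lambda>t. U t * U t) \<le> e" if e: "0 < e" for e
  proof -
    let ?M = "integral {0..2 * pi} (\<lambda>t. \<bar>U t\<bar>)"
    have M0: "0 \<le> ?M"
      by (intro integral_nonneg integrable_continuous_interval continuous_intros contU) auto
    \<comment> \<open>The added 1 keeps the denominator positive when the integral vanishes.\<close>
    define d where "d = e / (?M + 1)"
    have d: "0 < d" "d * ?M \<le> e"
      using e M0 by (auto simp: d_def field_simps)
    obtain g where g: "real_polynomial_function g" "\<And>x. x \<in> sphere 0 r \<Longrightarrow> \<bar>u x - g x\<bar> < d"
      using Stone_Weierstrass_real_polynomial_function[OF compact_sphere cont d(1)] by blast
    define G where "G t = g (polar r t)" for t
    have G: "continuous_on {0..2 * pi} G" "integral {0..2 * pi} (\<lambda>t. U t * G t) = 0"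
      using ann[OF trig_poly_real_polynomial[OF g(1), of r]] by (auto simp: G_def)
    have "integral {0..2 * pi} (\<lambda>t. U t * U t) =
        integral {0..2 * pi} (\<lambda>t. U t * U t) - integral {0..2 * pi} (\<lambda>t. U t * G t)"
      using G(2) by simp
    also have "\<dots> = integral {0..2 * pi} (\<lambda>t. U t * U t - U t * G t)"
      by (intro integral_diff[symmetric] int contU G)
    also have "\<dots> \<le> integral {0..2 * pi} (\<lambda>t. d * \<bar>U t\<bar>)"
    proof (rule integral_le)
      show "(\<lambda>t. U t * U t - U t * G t) integrable_on {0..2 * pi}"
        by (intro integrable_continuous_interval continuous_intros contU G)
      show "(\<lambda>t. d * \<bar>U t\<bar>) integrable_on {0..2 * pi}"
        by (intro integrable_continuous_interval continuous_intros contU)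
      fix t
      have "U t * U t - U t * G t = U t * (U t - G t)" by (simp add: algebra_simps)
      also have "\<dots> \<le> \<bar>U t\<bar> * \<bar>U t - G t\<bar>" by (simp add: abs_mult[symmetric])
      also have "\<dots> \<le> \<bar>U t\<bar> * d"
        using g(2)[of "polar r t"] r by (intro mult_left_mono) (auto simp: U_def G_def)
      finally show "U t * U t - U t * G t \<le> d * \<bar>U t\<bar>" by (simp add: mult_ac)
    qed
    also have "\<dots> \<le> e" using d by simp
    finally show ?thesis .
  qed
  then have le0: "integral {0..2 * pi} (\<lambda>t. U t * U t) \<le> 0"
    by (metis add.left_neutral field_le_epsilon)
  have "0 \<le> integral {0..2 * pi} (\<lambda>t. U t * U t)"
    by (intro integral_nonneg int contU) auto
  with le0 have "integral {0..2 * pi} (\<lambda>t. U t * U t) = 0" by simp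
  then have "\<forall>t\<in>{0..2 * pi}. U t * U t = 0"
    by (subst (asm) integral_eq_0_iff) (auto intro!: continuous_intros contU)
  then show ?thesis using polar_surj[OF z r] by (metis U_def mult_eq_0_iff)
qed

section \<open>Partial derivatives in the plane\<close>

text \<open>A relation, since \<open>partial_deriv\<close> has some value even where no derivative
  exists.\<close>

definition has_partial :: "2 \<Rightarrow> (real^2 \<Rightarrow> real) \<Rightarrow> real^2 \<Rightarrow> real \<Rightarrow> bool" where
  "has_partial i u z d \<longleftrightarrow> ((\<lambda>t. u (z + t *\<^sub>R axis i 1)) has_real_derivative d) (at 0)"

lemma has_partial_imp_partial_deriv: "has_partial i u z d \<Longrightarrow> partial_deriv (axis i 1) u z = d"
  unfolding has_partial_def partial_deriv_def
  by (simp add: has_real_derivative_iff_has_vector_derivative vector_derivative_at)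

lemma eventually_line_shift:
  fixes z b :: "'a::real_normed_vector"
  assumes "open U" "z \<in> U"
  shows "\<forall>\<^sub>F t in nhds (0::real). z + t *\<^sub>R b \<in> U"
proof -
  have "((\<lambda>t::real. z + t *\<^sub>R b) \<longlongrightarrow> z + 0 *\<^sub>R b) (nhds 0)"
    by (intro tendsto_intros filterlim_ident)
  then show ?thesis using topological_tendstoD[of _ z "nhds 0" U] assms by simp
qed

lemma has_vector_derivative_line_cong:
  fixes u v :: "'a::real_normed_vector \<Rightarrow> 'b::real_normed_vector"
  assumes "open U" "z \<in> U" "\<And>w. w \<in> U \<Longrightarrow> u w = v w"
  shows "((\<lambda>t. u (z + t *\<^sub>R b)) has_vector_derivative d) (at 0) \<longleftrightarrow>
    ((\<lambda>t. v (z + t *\<^sub>R b)) has_vector_derivative d) (at 0)"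
proof (rule has_vector_derivative_cong_ev)
  show "\<forall>\<^sub>F t in nhds 0. t \<in> UNIV \<longrightarrow> u (z + t *\<^sub>R b) = v (z + t *\<^sub>R b)"
    using eventually_line_shift[OF assms(1,2), of b] by eventually_elim (simp add: assms(3))
qed (use assms in auto)

lemma partial_deriv_cong:
  assumes "open U" "z \<in> U" "\<And>w. w \<in> U \<Longrightarrow> u w = v w"
  shows "partial_deriv b u z = partial_deriv b v z"
  unfolding partial_deriv_def vector_derivative_def
  by (subst has_vector_derivative_line_cong[OF assms]) simp_all

lemma has_partial_cong:
  assumes "open U" "z \<in> U" "\<And>w. w \<in> U \<Longrightarrow> u w = v w"
  shows "has_partial i u z d \<longleftrightarrow> has_partial i v z d"
  unfolding has_partial_def has_real_derivative_iff_has_vector_derivative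
  by (rule has_vector_derivative_line_cong[OF assms])

lemma has_partial_const: "has_partial i (\<lambda>z. c) z 0"
  by (simp add: has_partial_def)

lemma has_partial_component: "has_partial i (\<lambda>z. z $ j) z (if i = j then 1 else 0)"
  unfolding has_partial_def by (auto simp: axis_def intro!: derivative_eq_intros)

lemma has_partial_add: "has_partial i u z d \<Longrightarrow> has_partial i v z e \<Longrightarrow>
    has_partial i (\<lambda>z. u z + v z) z (d + e)"
  unfolding has_partial_def by (auto intro!: derivative_eq_intros)

lemma has_partial_mult: "has_partial i u z d \<Longrightarrow> has_partial i v z e \<Longrightarrow>
    has_partial i (\<lambda>z. u z * v z) z (d * v z + u z * e)"
  unfolding has_partial_def by (auto intro!: derivative_eq_intros)

lemma has_partial_compose: "has_partial i u z d \<Longrightarrow> (g has_real_derivative e) (at (u z)) \<Longrightarrow>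
    has_partial i (\<lambda>z. g (u z)) z (e * d)"
  unfolding has_partial_def
  using DERIV_chain'[of "\<lambda>t. u (z + t *\<^sub>R axis i 1)" d 0 UNIV g e] by simp

lemma norm_vec2: "norm (z :: real^2) = sqrt ((z $ 1)\<^sup>2 + (z $ 2)\<^sup>2)"
  by (simp add: norm_vec_def L2_set_def sum_2)

lemma norm_vec2_power2: "(norm (z :: real^2))\<^sup>2 = (z $ 1)\<^sup>2 + (z $ 2)\<^sup>2"
  by (simp add: norm_vec2)

lemma has_partial_norm:
  assumes "z \<noteq> 0"
  shows "has_partial i norm z (z $ i / norm z)"
proof -
  have p: "(z $ 1)\<^sup>2 + (z $ 2)\<^sup>2 > 0"
    using assms by (simp add: sum_power2_gt_zero_iff vec_eq_iff forall_2)
  have "((\<lambda>t. sqrt ((z $ 1 + t * axis i 1 $ 1)\<^sup>2 + (z $ 2 + t * axis i 1 $ 2)\<^sup>2)) has_real_derivative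
      (z $ i / norm z)) (at 0)"
    using p exhaust_2[of i]
    by (auto intro!: derivative_eq_intros simp: axis_def norm_vec2 field_simps)
  then show ?thesis unfolding has_partial_def by (simp add: norm_vec2)
qed

lemma Ck_on_cong:
  fixes u v :: "'a::euclidean_space \<Rightarrow> 'b::real_normed_vector"
  assumes "open U" "\<And>w. w \<in> U \<Longrightarrow> u w = v w"
  shows "Ck_on k U u \<longleftrightarrow> Ck_on k U v"
  using assms(2)
proof (induction k arbitrary: u v)
  case 0
  then show ?case by (simp cong: continuous_on_cong)
next
  case (Suc k)
  have df: "(\<lambda>t. u (z + t *\<^sub>R b)) differentiable (at (0::real)) \<longleftrightarrow>
      (\<lambda>t. v (z + t *\<^sub>R b)) differentiable (at 0)" if "z \<in> U" for z b
  proof -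
    have "w differentiable (at 0) \<longleftrightarrow> (\<exists>d. (w has_vector_derivative d) (at 0))"
      for w :: "real \<Rightarrow> 'b"
      using vector_derivative_works differentiableI_vector by blast
    moreover have "((\<lambda>t. u (z + t *\<^sub>R b)) has_vector_derivative d) (at 0) \<longleftrightarrow>
        ((\<lambda>t. v (z + t *\<^sub>R b)) has_vector_derivative d) (at 0)" for d
      by (rule has_vector_derivative_line_cong[OF assms(1) that]) (rule Suc.prems)
    ultimately show ?thesis by simp
  qed
  have pd: "partial_deriv b u z = partial_deriv b v z" if "z \<in> U" for z b
    by (rule partial_deriv_cong[OF assms(1) that]) (rule Suc.prems)
  have "Ck_on k U (partial_deriv b u) \<longleftrightarrow> Ck_on k U (partial_deriv b v)" for b
    by (rule Suc.IH) (rule pd)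
  then show ?case
    using df Suc.prems by (simp cong: continuous_on_cong)
qed

text \<open>The partial derivatives are parameters so that closed formulas can be supplied for them;
  translations to and from \<open>Ck_on 2\<close> follow.\<close>

definition C2_partials :: "(real^2) set \<Rightarrow> (real^2 \<Rightarrow> real) \<Rightarrow> (2 \<Rightarrow> real^2 \<Rightarrow> real) \<Rightarrow>
    (2 \<Rightarrow> 2 \<Rightarrow> real^2 \<Rightarrow> real) \<Rightarrow> bool" where
  "C2_partials U u u' u'' \<longleftrightarrow> continuous_on U u \<and>
    (\<forall>i. continuous_on U (u' i) \<and> (\<forall>z\<in>U. has_partial i u z (u' i z)) \<and>
      (\<forall>j. continuous_on U (u'' i j) \<and> (\<forall>z\<in>U. has_partial j (u' i) z (u'' i j z))))"

lemma Basis_vec2: "b \<in> (Basis :: (real^2) set) \<longleftrightarrow> (\<exists>i. b = axis i 1)"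
  by (auto simp: Basis_vec_def)

lemma has_partial_differentiable:
  "has_partial i u z d \<Longrightarrow> (\<lambda>t. u (z + t *\<^sub>R axis i 1)) differentiable (at (0::real))"
  unfolding has_partial_def has_real_derivative_iff_has_vector_derivative
  by (rule differentiableI_vector)

lemma has_partial_partial_deriv:
  fixes u :: "real^2 \<Rightarrow> real"
  assumes "(\<lambda>t. u (z + t *\<^sub>R axis i 1)) differentiable (at (0::real))"
  shows "has_partial i u z (partial_deriv (axis i 1) u z)"
  using assms unfolding has_partial_def has_real_derivative_iff_has_vector_derivative partial_deriv_def
  by (simp add: vector_derivative_works)

lemma C2_partials_imp_Ck_on:
  assumes "open U" "C2_partials U u u' u''"
  shows "Ck_on 2 U u"
proof -
  have 1: "partial_deriv (axis i 1) u z = u' i z" if "z \<in> U" for i z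
    using assms(2) that unfolding C2_partials_def by (intro has_partial_imp_partial_deriv) auto
  have 2: "partial_deriv (axis j 1) (u' i) z = u'' i j z" if "z \<in> U" for i j z
    using assms(2) that unfolding C2_partials_def by (intro has_partial_imp_partial_deriv) auto
  have d1: "(\<lambda>t. u (z + t *\<^sub>R axis i 1)) differentiable (at (0::real))" if "z \<in> U" for i z
    using assms(2) that has_partial_differentiable[of i u z "u' i z"] by (simp add: C2_partials_def)
  have d2: "(\<lambda>t. u' i (z + t *\<^sub>R axis j 1)) differentiable (at (0::real))" if "z \<in> U" for i j z
    using assms(2) that has_partial_differentiable[of j "u' i" z "u'' i j z"]
    by (simp add: C2_partials_def)
  have "Ck_on 0 U (partial_deriv (axis j 1) (u' i))" for i j
  proof -
    have "Ck_on 0 U (u'' i j)" using assms(2) by (simp add: C2_partials_def)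
    moreover have "Ck_on 0 U (partial_deriv (axis j 1) (u' i)) \<longleftrightarrow> Ck_on 0 U (u'' i j)"
      by (rule Ck_on_cong[OF assms(1)]) (rule 2)
    ultimately show ?thesis by blast
  qed
  then have "Ck_on (Suc 0) U (u' i)" for i
    using assms(2) unfolding Ck_on.simps C2_partials_def
    by (auto simp: Basis_vec2 d1 d2)
  then have *: "Ck_on (Suc 0) U (u' i)" for i .
  have "Ck_on (Suc 0) U (partial_deriv (axis i 1) u)" for i
  proof -
    have "Ck_on (Suc 0) U (partial_deriv (axis i 1) u) \<longleftrightarrow> Ck_on (Suc 0) U (u' i)"
      by (rule Ck_on_cong[OF assms(1)]) (rule 1)
    with * show ?thesis by blast
  qed
  then have "Ck_on (Suc (Suc 0)) U u"
    using assms(2) d1 unfolding Ck_on.simps(2)[of "Suc 0"] C2_partials_def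
    by (auto simp: Basis_vec2 simp del: Ck_on.simps)
  then show ?thesis by (simp add: numeral_2_eq_2)
qed

lemma Ck_on_imp_C2_partials:
  fixes u :: "real^2 \<Rightarrow> real"
  assumes "Ck_on 2 U u"
  shows "C2_partials U u (\<lambda>i. partial_deriv (axis i 1) u)
    (\<lambda>i j. partial_deriv (axis j 1) (partial_deriv (axis i 1) u))"
proof -
  have "axis i 1 \<in> (Basis :: (real^2) set)" for i by (auto simp: Basis_vec2)
  then show ?thesis
    using assms unfolding C2_partials_def numeral_2_eq_2
    by (auto intro!: has_partial_partial_deriv)
qed

lemma C2_partials_mult:
  assumes "C2_partials U u u' u''" "C2_partials U v v' v''"
  shows "C2_partials U (\<lambda>z. u z * v z) (\<lambda>i z. u' i z * v z + u z * v' i z)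
    (\<lambda>i j z. (u'' i j z * v z + u' i z * v' j z) + (u' j z * v' i z + u z * v'' i j z))"
  using assms unfolding C2_partials_def
  by (auto intro!: continuous_intros has_partial_add has_partial_mult)

text \<open>The classical theorem on continuous partial derivatives, applied in a product of two
  real intervals and transferred through the coordinates. It provides the chain rule along curves,
  in particular in polar coordinates.\<close>

lemma C1_has_derivative:
  assumes U: "open U" "z \<in> U"
    and part: "\<And>i w. w \<in> U \<Longrightarrow> has_partial i u w (u' i w)"
    and cont: "\<And>i. continuous_on U (u' i)"
  shows "(u has_derivative (\<lambda>h. u' 1 z * h $ 1 + u' 2 z * h $ 2)) (at z)"
proof -
  define f where "f x y = u (vector [x, y])" for x y
  obtain e where e: "e > 0" "ball z e \<subseteq> U" using U by (auto simp: open_contains_ball)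
  \<comment> \<open>Half the radius in each coordinate keeps the rectangle inside the ball, by the
    l1 bound on the norm.\<close>
  let ?X = "{z $ 1 - e / 2 <..< z $ 1 + e / 2}" and ?Y = "{z $ 2 - e / 2 <..< z $ 2 + e / 2}"
  have inU: "vector [x, y] \<in> U" if "x \<in> ?X" "y \<in> ?Y" for x y
  proof -
    have "dist z (vector [x, y]) \<le> \<bar>z $ 1 - x\<bar> + \<bar>z $ 2 - y\<bar>"
      using norm_le_l1_cart[of "z - vector [x, y]"] by (simp add: dist_norm sum_2)
    also have "\<dots> < e" using that by auto
    finally show ?thesis using e by auto
  qed
  have shift: "vector [x, y] + t *\<^sub>R axis 1 1 = (vector [x + t, y] :: real^2)"
    "vector [x, y] + t *\<^sub>R axis 2 1 = (vector [x, y + t] :: real^2)" for x y t :: real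
    by (simp_all add: vec_eq_iff forall_2 axis_def)
  have fx: "((\<lambda>x. f x y) has_real_derivative u' 1 (vector [x, y])) (at x)"
    and fy: "((\<lambda>y. f x y) has_real_derivative u' 2 (vector [x, y])) (at y)"
    if "x \<in> ?X" "y \<in> ?Y" for x y
    using part[OF inU[OF that], of 1] part[OF inU[OF that], of 2]
    unfolding has_partial_def shift f_def
    using DERIV_shift[of "\<lambda>s. u (vector [s, y])" "u' 1 (vector [x, y])" 0 x]
      DERIV_shift[of "\<lambda>s. u (vector [x, s])" "u' 2 (vector [x, y])" 0 y]
    by (simp_all add: add.commute)
  have cv: "continuous_on (?X \<times> ?Y) (\<lambda>(x, y). u' 2 (vector [x, y]))"
  proof -
    have "continuous_on (?X \<times> ?Y) (\<lambda>p. vector [fst p, snd p] :: real^2)"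
    proof -
      have "(\<lambda>p. vector [fst p, snd p] :: real^2) = (\<lambda>p. fst p *\<^sub>R axis 1 1 + snd p *\<^sub>R axis 2 1)"
        by (simp add: fun_eq_iff vec_eq_iff forall_2 axis_def)
      then show ?thesis by (simp only:) (intro continuous_intros)
    qed
    then show ?thesis unfolding case_prod_beta
      by (rule continuous_on_compose2[OF cont]) (use inU in auto)
  qed
  have zXY: "z $ 1 \<in> ?X" "z $ 2 \<in> ?Y" using e by auto
  have z_eq: "vector [z $ 1, z $ 2] = z" by (simp add: vec_eq_iff forall_2)
  have "((\<lambda>(x, y). f x y) has_derivative
      (\<lambda>(tx, ty). u' 1 z * tx + blinfun_apply (blinfun_mult_right (u' 2 (vector [z $ 1, z $ 2]))) ty))
      (at (z $ 1, z $ 2) within ?X \<times> ?Y)"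
  proof (rule has_derivative_partialsI)
    show "((\<lambda>x. f x (z $ 2)) has_derivative (*) (u' 1 z)) (at (z $ 1) within ?X)"
      using fx[OF zXY] unfolding z_eq has_field_derivative_def by (rule has_derivative_at_withinI)
    show "((\<lambda>y. f x y) has_derivative blinfun_apply (blinfun_mult_right (u' 2 (vector [x, y])))) (at y within ?Y)"
      if "x \<in> ?X" "y \<in> ?Y" for x y
      using fy[OF that] unfolding has_field_derivative_def
      by (auto simp: blinfun_mult_right.rep_eq intro: has_derivative_at_withinI)
    show "continuous (at (z $ 1, z $ 2) within ?X \<times> ?Y) (\<lambda>(x, y). blinfun_mult_right (u' 2 (vector [x, y])))"
    proof -
      have "continuous_on (?X \<times> ?Y) (\<lambda>p. blinfun_mult_right (case p of (x, y) \<Rightarrow> u' 2 (vector [x, y])))"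
        by (intro continuous_intros bounded_linear.continuous_on[OF bounded_linear_blinfun_mult_right] cv)
      then show ?thesis using zXY
        unfolding continuous_on_eq_continuous_within case_prod_beta by blast
    qed
  qed (use zXY in auto)
  moreover have "at (z $ 1, z $ 2) within ?X \<times> ?Y = at (z $ 1, z $ 2)"
    by (rule at_within_open) (use zXY in \<open>auto intro: open_Times\<close>)
  ultimately have D: "((\<lambda>(x, y). f x y) has_derivative (\<lambda>(tx, ty). u' 1 z * tx + u' 2 z * ty))
      (at (z $ 1, z $ 2))"
    by (simp add: z_eq blinfun_mult_right.rep_eq)
  have "((\<lambda>w. (w $ 1, w $ 2)) has_derivative (\<lambda>h. (h $ 1, h $ 2))) (at z)"
    by (intro has_derivative_Pair bounded_linear_imp_has_derivative bounded_linear_vec_nth)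
  from has_derivative_compose[OF this D]
  have "((\<lambda>w. f (w $ 1) (w $ 2)) has_derivative (\<lambda>h. u' 1 z * h $ 1 + u' 2 z * h $ 2)) (at z)"
    by simp
  moreover have "(\<lambda>w. f (w $ 1) (w $ 2)) = u"
  proof
    fix w :: "real^2"
    have "vector [w $ 1, w $ 2] = w" by (simp add: vec_eq_iff forall_2)
    then show "f (w $ 1) (w $ 2) = u w" by (simp add: f_def)
  qed
  ultimately show ?thesis by simp
qed

section \<open>Dirichlet eigenfunctions of the disc\<close>

text \<open>With \<open>w = r ^ k * rad_sol k \<mu> r\<close> and \<open>v = r * w'\<close> this is
  the first-order form of
  \<open>r * (r * w')' = (k\<^sup>2 - \<mu> * r\<^sup>2 * \<Phi>) * w\<close>.\<close>

lemma (in radial_weight) rad_mode_derivs: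
  assumes r: "r \<in> {0<..<R}"
  shows "((\<lambda>r. r ^ k * rad_sol k \<mu> r) has_real_derivative
      (r ^ k * (real k * rad_sol k \<mu> r - \<mu> * r\<^sup>2 * rad_flux k \<mu> r)) / r) (at r)"
    and "((\<lambda>r. r ^ k * (real k * rad_sol k \<mu> r - \<mu> * r\<^sup>2 * rad_flux k \<mu> r)) has_real_derivative
      ((real k)\<^sup>2 / r - \<mu> * r * \<Phi> r) * (r ^ k * rad_sol k \<mu> r)) (at r)"
proof -
  have p: "((\<lambda>r. r ^ k) has_real_derivative k * r ^ k / r) (at r)"
  proof -
    have "real k * r ^ (k - Suc 0) = k * r ^ k / r" using r by (cases k) auto
    then show ?thesis using DERIV_pow[of k r UNIV] by simp
  qed
  show "((\<lambda>r. r ^ k * rad_sol k \<mu> r) has_real_derivative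
      (r ^ k * (real k * rad_sol k \<mu> r - \<mu> * r\<^sup>2 * rad_flux k \<mu> r)) / r) (at r)"
    by (rule derivative_eq_intros p DERIV_rad_sol r refl)+
      (use r in \<open>simp add: field_simps power2_eq_square\<close>)
  show "((\<lambda>r. r ^ k * (real k * rad_sol k \<mu> r - \<mu> * r\<^sup>2 * rad_flux k \<mu> r)) has_real_derivative
      ((real k)\<^sup>2 / r - \<mu> * r * \<Phi> r) * (r ^ k * rad_sol k \<mu> r)) (at r)"
    by (rule derivative_eq_intros p DERIV_rad_sol DERIV_rad_flux r refl)+
      (use r in \<open>simp add: field_simps power2_eq_square\<close>)
qed

lemma DERIV_plane_curve:
  assumes U: "open U" "vector [\<gamma>1 s, \<gamma>2 s] \<in> U"
    and part: "\<And>i w. w \<in> U \<Longrightarrow> has_partial i u w (u' i w)"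
    and cont: "\<And>i. continuous_on U (u' i)"
    and \<gamma>: "(\<gamma>1 has_real_derivative a) (at s)" "(\<gamma>2 has_real_derivative b) (at s)"
  shows "((\<lambda>s. u (vector [\<gamma>1 s, \<gamma>2 s])) has_real_derivative
    u' 1 (vector [\<gamma>1 s, \<gamma>2 s]) * a + u' 2 (vector [\<gamma>1 s, \<gamma>2 s]) * b) (at s)"
proof -
  have eq: "(\<lambda>s. vector [\<gamma>1 s, \<gamma>2 s] :: real^2) = (\<lambda>s. \<gamma>1 s *\<^sub>R axis 1 1 + \<gamma>2 s *\<^sub>R axis 2 1)"
    by (simp add: fun_eq_iff vec_eq_iff forall_2 axis_def)
  have "((\<lambda>s. vector [\<gamma>1 s, \<gamma>2 s] :: real^2) has_derivative
      (\<lambda>h. (h * a) *\<^sub>R axis 1 1 + (h * b) *\<^sub>R axis 2 1)) (at s)"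
    unfolding eq using \<gamma> unfolding has_field_derivative_def
    by (auto intro!: derivative_eq_intros simp: mult.commute)
  from has_derivative_compose[OF this C1_has_derivative[OF U part cont]]
  show ?thesis
    unfolding has_field_derivative_def
    by (rule has_derivative_eq_rhs) (auto simp: fun_eq_iff axis_def algebra_simps)
qed

lemma DERIV_polar:
  assumes U: "open U" "polar r t \<in> U"
    and part: "\<And>i w. w \<in> U \<Longrightarrow> has_partial i u w (u' i w)"
    and cont: "\<And>i. continuous_on U (u' i)"
  shows "((\<lambda>r. u (polar r t)) has_real_derivative
      u' 1 (polar r t) * cos t + u' 2 (polar r t) * sin t) (at r)"
    and "((\<lambda>t. u (polar r t)) has_real_derivative
      u' 1 (polar r t) * (- r * sin t) + u' 2 (polar r t) * (r * cos t)) (at t)"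
proof -
  show "((\<lambda>r. u (polar r t)) has_real_derivative
      u' 1 (polar r t) * cos t + u' 2 (polar r t) * sin t) (at r)"
    using U(2) unfolding polar_def
    by (intro DERIV_plane_curve[OF U(1) _ part cont]) (auto intro!: derivative_eq_intros)
  show "((\<lambda>t. u (polar r t)) has_real_derivative
      u' 1 (polar r t) * (- r * sin t) + u' 2 (polar r t) * (r * cos t)) (at t)"
    using U(2) unfolding polar_def
    by (intro DERIV_plane_curve[OF U(1) _ part cont]) (auto intro!: derivative_eq_intros)
qed

lemma DERIV_circ: "(circ k c has_real_derivative real k * circ k (\<i> * c) t) (at t within S)"
  unfolding circ_eq[abs_def] by (auto intro!: derivative_eq_intros simp: algebra_simps)

text \<open>Radial derivatives pass under the integral; angular ones are moved onto the harmonic by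
  two integrations by parts and become the factor \<open>- k\<^sup>2\<close>. Continuity of
  \<open>m1\<close> down to 0 is recorded because it makes \<open>r * m1 r\<close> vanish
  continuously at the centre.\<close>

lemma circ_coeff_radial_equation:
  assumes R: "0 < R" and C2: "C2_partials (ball 0 R) u u' u''"
    and helmholtz: "\<And>z. z \<in> ball 0 R \<Longrightarrow> u'' 1 1 z + u'' 2 2 z = - \<mu> * u z"
  obtains m1 where
    "continuous_on {0..<R} (circ_coeff k c u)" "continuous_on {0..<R} m1"
    "\<And>r. r \<in> {0<..<R} \<Longrightarrow> (circ_coeff k c u has_real_derivative m1 r) (at r)"
    "\<And>r. r \<in> {0<..<R} \<Longrightarrow> ((\<lambda>r. r * m1 r) has_real_derivative
      ((real k)\<^sup>2 / r - \<mu> * r) * circ_coeff k c u r) (at r)"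
proof -
  let ?I = "{0..2 * pi}"
  have contu: "continuous_on (ball 0 R) u" "continuous_on (ball 0 R) (u' i)"
    "continuous_on (ball 0 R) (u'' i j)" for i j
    using C2 by (auto simp: C2_partials_def)
  have part: "z \<in> ball 0 R \<Longrightarrow> has_partial i u z (u' i z)"
    "z \<in> ball 0 R \<Longrightarrow> has_partial j (u' i) z (u'' i j z)" for z i j
    using C2 by (auto simp: C2_partials_def)
  note d1 = DERIV_polar[OF open_ball _ part(1) contu(2)]
  note d2 = DERIV_polar[OF open_ball _ part(2) contu(3)]
  have cpol: "continuous_on ({0..<R} \<times> A) (\<lambda>p. f (polar (fst p) (snd p)))"
    if "continuous_on (ball 0 R) f" for f :: "real^2 \<Rightarrow> real" and A
    by (rule continuous_on_compose2[OF that]) (auto intro!: continuous_intros)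
  define Ur where "Ur r t = u' 1 (polar r t) * cos t + u' 2 (polar r t) * sin t" for r t
  define Urr where "Urr r t = (u'' 1 1 (polar r t) * cos t + u'' 1 2 (polar r t) * sin t) * cos t +
      (u'' 2 1 (polar r t) * cos t + u'' 2 2 (polar r t) * sin t) * sin t" for r t
  define Ut where "Ut r t = u' 1 (polar r t) * (- r * sin t) + u' 2 (polar r t) * (r * cos t)" for r t
  define Utt where "Utt r t =
      (u'' 1 1 (polar r t) * (- r * sin t) + u'' 1 2 (polar r t) * (r * cos t)) * (- r * sin t) +
      u' 1 (polar r t) * (- r * cos t) +
      ((u'' 2 1 (polar r t) * (- r * sin t) + u'' 2 2 (polar r t) * (r * cos t)) * (r * cos t) +
      u' 2 (polar r t) * (- r * sin t))" for r t
  have dU: "((\<lambda>r. u (polar r t)) has_real_derivative Ur r t) (at r)"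
    "((\<lambda>r. Ur r t) has_real_derivative Urr r t) (at r)"
    "((\<lambda>t. u (polar r t)) has_real_derivative Ut r t) (at t)"
    "((\<lambda>t. Ut r t) has_real_derivative Utt r t) (at t)" if "r \<in> {0..<R}" for r t
  proof -
    have p: "polar r t \<in> ball 0 R" using that by simp
    show "((\<lambda>r. u (polar r t)) has_real_derivative Ur r t) (at r)"
      unfolding Ur_def by (rule d1(1)[OF p])
    show "((\<lambda>t. u (polar r t)) has_real_derivative Ut r t) (at t)"
      unfolding Ut_def by (rule d1(2)[OF p])
    show "((\<lambda>r. Ur r t) has_real_derivative Urr r t) (at r)"
      unfolding Ur_def Urr_def
      by (rule derivative_eq_intros d2(1)[OF p, of 1] d2(1)[OF p, of 2] refl | simp)+
    show "((\<lambda>t. Ut r t) has_real_derivative Utt r t) (at t)"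
      unfolding Ut_def Utt_def
      by (rule derivative_eq_intros d2(2)[OF p, of 1] d2(2)[OF p, of 2] refl | simp)+
  qed
  have cU: "continuous_on ({0..<R} \<times> ?I) (\<lambda>(r, t). u (polar r t) * circ k c t)"
    "continuous_on ({0..<R} \<times> ?I) (\<lambda>(r, t). Ur r t * circ k c t)"
    "continuous_on ({0..<R} \<times> ?I) (\<lambda>(r, t). Urr r t * circ k c t)"
    unfolding case_prod_beta Ur_def Urr_def by (intro continuous_intros cpol contu)+
  have sl: "continuous_on ?I (\<lambda>t. f (polar r t))" if "continuous_on (ball 0 R) f" "r \<in> {0..<R}"
    for f :: "real^2 \<Rightarrow> real" and r
    by (rule continuous_on_compose2[OF that(1)]) (use that in \<open>auto intro!: continuous_intros\<close>)
  have int: "(\<lambda>t. u (polar r t) * circ k c t) integrable_on ?I"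
    "(\<lambda>t. Ur r t * circ k c t) integrable_on ?I"
    "(\<lambda>t. Urr r t * circ k c t) integrable_on ?I"
    "(\<lambda>t. Utt r t * circ k c t) integrable_on ?I" if "r \<in> {0..<R}" for r
    unfolding Ur_def Urr_def Utt_def
    by (intro integrable_continuous_interval continuous_intros sl contu that)+
  define m1 where "m1 r = integral ?I (\<lambda>t. Ur r t * circ k c t)" for r
  define m2 where "m2 r = integral ?I (\<lambda>t. Urr r t * circ k c t)" for r
  have at_in: "at r within {0<..<R} = at r" if "r \<in> {0<..<R}" for r :: real
    using that by (intro at_within_open) auto
  have dm: "(circ_coeff k c u has_real_derivative m1 r) (at r)" if r: "r \<in> {0<..<R}" for r
  proof -
    have "((\<lambda>r. integral (cbox 0 (2 * pi)) (\<lambda>t. u (polar r t) * circ k c t)) has_real_derivative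
        integral (cbox 0 (2 * pi)) (\<lambda>t. Ur r t * circ k c t)) (at r within {0<..<R})"
    proof (rule leibniz_rule_field_derivative)
      fix x t :: real assume "x \<in> {0<..<R}"
      then have x: "x \<in> {0..<R}" by simp
      show "((\<lambda>x. u (polar x t) * circ k c t) has_real_derivative Ur x t * circ k c t) (at x within {0<..<R})"
        by (rule DERIV_cmult_right[OF has_field_derivative_at_within[OF dU(1)[OF x]]])
    next
      show "continuous_on ({0<..<R} \<times> cbox 0 (2 * pi)) (\<lambda>(x, t). Ur x t * circ k c t)"
        by (rule continuous_on_subset[OF cU(2)]) auto
    qed (use r int(1) in auto)
    then show ?thesis unfolding at_in[OF r] m1_def circ_coeff_def[abs_def] by simp
  qed
  have dm1: "(m1 has_real_derivative m2 r) (at r)" if r: "r \<in> {0<..<R}" for r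
  proof -
    have "((\<lambda>r. integral (cbox 0 (2 * pi)) (\<lambda>t. Ur r t * circ k c t)) has_real_derivative
        integral (cbox 0 (2 * pi)) (\<lambda>t. Urr r t * circ k c t)) (at r within {0<..<R})"
    proof (rule leibniz_rule_field_derivative)
      fix x t :: real assume "x \<in> {0<..<R}"
      then have x: "x \<in> {0..<R}" by simp
      show "((\<lambda>x. Ur x t * circ k c t) has_real_derivative Urr x t * circ k c t) (at x within {0<..<R})"
        by (rule DERIV_cmult_right[OF has_field_derivative_at_within[OF dU(2)[OF x]]])
    next
      show "continuous_on ({0<..<R} \<times> cbox 0 (2 * pi)) (\<lambda>(x, t). Urr x t * circ k c t)"
        by (rule continuous_on_subset[OF cU(3)]) auto
    qed (use r int(2) in auto)
    then show ?thesis unfolding at_in[OF r] m1_def[abs_def] m2_def by simp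
  qed
  have key: "m1 r + r * m2 r = ((real k)\<^sup>2 / r - \<mu> * r) * circ_coeff k c u r" if r: "r \<in> {0<..<R}" for r
  proof -
    have r0: "r \<in> {0..<R}" "r \<noteq> 0" using r by auto
    \<comment> \<open>The antiderivative behind the two integrations by parts; it is periodic, so no
      boundary terms remain.\<close>
    let ?Q = "\<lambda>t. Ut r t * circ k c t - u (polar r t) * (real k * circ k (\<i> * c) t)"
    have "((\<lambda>t. Utt r t * circ k c t + (real k)\<^sup>2 * (u (polar r t) * circ k c t)) has_integral
        ?Q (2 * pi) - ?Q 0) ?I"
    proof (rule fundamental_theorem_of_calculus)
      fix t
      have gen: "(A * B + q * C * D) - (D * (q * C) + q * (q * (- B)) * E) = A * B + q\<^sup>2 * (E * B)"
        for A B C D E q :: real by (simp add: algebra_simps power2_eq_square)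
      have neg: "circ k (\<i> * (\<i> * c)) t = - circ k c t" by (simp add: circ_eq)
      have "(?Q has_real_derivative
          (Utt r t * circ k c t + real k * circ k (\<i> * c) t * Ut r t) -
          (Ut r t * (real k * circ k (\<i> * c) t) +
            real k * (real k * circ k (\<i> * (\<i> * c)) t) * u (polar r t))) (at t)"
        by (intro DERIV_diff DERIV_mult DERIV_cmult DERIV_circ dU(3) dU(4) r0)
      then have "(?Q has_real_derivative Utt r t * circ k c t + (real k)\<^sup>2 * (u (polar r t) * circ k c t)) (at t)"
        unfolding neg by (rule DERIV_cong) (rule gen)
      then show "(?Q has_vector_derivative Utt r t * circ k c t + (real k)\<^sup>2 * (u (polar r t) * circ k c t))
          (at t within ?I)"
        unfolding has_real_derivative_iff_has_vector_derivative
        by (rule has_vector_derivative_at_within)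
    qed simp
    moreover have "?Q (2 * pi) = ?Q 0"
    proof -
      have "sin (k * (2 * pi)) = 0" "cos (k * (2 * pi)) = 1"
        using sin_2npi[of k] cos_2npi[of k] by (simp_all add: mult_ac)
      then have "circ k c' (2 * pi) = circ k c' 0" for c' by (simp add: circ_eq)
      moreover have "polar r (2 * pi) = polar r 0" by (simp add: polar_def)
      ultimately show ?thesis by (simp add: Ut_def)
    qed
    ultimately have z: "((\<lambda>t. Utt r t * circ k c t + (real k)\<^sup>2 * (u (polar r t) * circ k c t)) has_integral 0) ?I"
      by simp
    \<comment> \<open>The equation in polar form,
      \<open>r\<^sup>2 u_rr + r u_r + u_tt = - \<mu> r\<^sup>2 u\<close>, times the harmonic. The
      mixed partial derivatives cancel between \<open>Urr\<close> and \<open>Utt\<close>.\<close>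
    have ptw: "(- (Utt r t * circ k c t + (real k)\<^sup>2 * (u (polar r t) * circ k c t))) =
        r * (Ur r t * circ k c t) + r\<^sup>2 * (Urr r t * circ k c t) -
        ((real k)\<^sup>2 - \<mu> * r\<^sup>2) * (u (polar r t) * circ k c t)" for t
    proof -
      have "u'' 2 2 (polar r t) = - \<mu> * u (polar r t) - u'' 1 1 (polar r t)"
        using helmholtz[of "polar r t"] r by (simp add: algebra_simps)
      moreover have "(sin t)\<^sup>2 = 1 - (cos t)\<^sup>2" by (simp add: sin_squared_eq)
      ultimately have "r * Ur r t + r\<^sup>2 * Urr r t + Utt r t = - \<mu> * r\<^sup>2 * u (polar r t)"
        unfolding Ur_def Urr_def Utt_def by algebra
      then have "r * Ur r t + r\<^sup>2 * Urr r t = - \<mu> * r\<^sup>2 * u (polar r t) - Utt r t" by simp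
      then have "(r * Ur r t + r\<^sup>2 * Urr r t) * circ k c t = (- \<mu> * r\<^sup>2 * u (polar r t) - Utt r t) * circ k c t"
        by simp
      then show ?thesis by (simp add: algebra_simps)
    qed
    have "((\<lambda>t. - (Utt r t * circ k c t + (real k)\<^sup>2 * (u (polar r t) * circ k c t))) has_integral
        r * m1 r + r\<^sup>2 * m2 r - ((real k)\<^sup>2 - \<mu> * r\<^sup>2) * circ_coeff k c u r) ?I"
      unfolding ptw m1_def m2_def circ_coeff_def
      by (intro has_integral_diff has_integral_add has_integral_mult_right integrable_integral int r0)
    from has_integral_unique[OF this has_integral_neg[OF z]]
    have "r * m1 r + r\<^sup>2 * m2 r = ((real k)\<^sup>2 - \<mu> * r\<^sup>2) * circ_coeff k c u r" by simp
    moreover have "r * (((real k)\<^sup>2 / r - \<mu> * r) * circ_coeff k c u r) =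
        ((real k)\<^sup>2 - \<mu> * r\<^sup>2) * circ_coeff k c u r"
    proof -
      have "r * ((real k)\<^sup>2 / r - \<mu> * r) = (real k)\<^sup>2 - \<mu> * r\<^sup>2"
        using r0 by (simp add: right_diff_distrib power2_eq_square)
      then show ?thesis by (simp only: mult.assoc[symmetric])
    qed
    moreover have "r * (m1 r + r * m2 r) = r * m1 r + r\<^sup>2 * m2 r"
      by (simp add: distrib_left power2_eq_square)
    ultimately have "r * (m1 r + r * m2 r) = r * (((real k)\<^sup>2 / r - \<mu> * r) * circ_coeff k c u r)"
      by (simp only:)
    then show ?thesis using r0 by simp
  qed
  show ?thesis
  proof (rule that[of m1])
    show "continuous_on {0..<R} (circ_coeff k c u)"
      using integral_continuous_on_param[of "{0..<R}" 0 "2 * pi" "\<lambda>r t. u (polar r t) * circ k c t"] cU(1)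
      by (simp add: circ_coeff_def[abs_def])
    show "continuous_on {0..<R} m1"
      using integral_continuous_on_param[of "{0..<R}" 0 "2 * pi" "\<lambda>r t. Ur r t * circ k c t"] cU(2)
      by (simp add: m1_def[abs_def])
    show "((\<lambda>r. r * m1 r) has_real_derivative ((real k)\<^sup>2 / r - \<mu> * r) * circ_coeff k c u r) (at r)"
      if r: "r \<in> {0<..<R}" for r
      unfolding key[OF r, symmetric]
      by (rule derivative_eq_intros dm1[OF r] refl)+ simp
  qed (rule dm)
qed

text \<open>The coefficient and the regular solution satisfy the same equation and their Wronskian
  vanishes at the centre, so they are proportional. If the regular solution is nonzero at
  \<open>R\<close>, the boundary condition kills the coefficient; otherwise its value at the single
  radius \<open>r0\<close> decides.\<close>

lemma circ_coeff_mode_zero: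
  assumes R: "0 < R" and C2: "C2_partials (ball 0 R) u u' u''"
    and helmholtz: "\<And>z. z \<in> ball 0 R \<Longrightarrow> u'' 1 1 z + u'' 2 2 z = - \<mu> * u z"
    and cont: "continuous_on (cball 0 R) u" and bdry: "\<And>z. norm z = R \<Longrightarrow> u z = 0"
    and r0: "r0 \<in> {0<..<R}" "radial_weight.rad_sol (\<lambda>_. 1) k \<mu> r0 \<noteq> 0"
    and zero: "radial_weight.rad_sol (\<lambda>_. 1) k \<mu> R = 0 \<Longrightarrow> circ_coeff k c u r0 = 0"
    and r: "r \<in> {0<..<R}"
  shows "circ_coeff k c u r = 0"
proof -
  interpret W: radial_weight R "\<lambda>_. 1" by (rule radial_weight_one[OF R])
  obtain m1 where m: "continuous_on {0..<R} (circ_coeff k c u)" "continuous_on {0..<R} m1"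
    "\<And>r. r \<in> {0<..<R} \<Longrightarrow> (circ_coeff k c u has_real_derivative m1 r) (at r)"
    "\<And>r. r \<in> {0<..<R} \<Longrightarrow> ((\<lambda>r. r * m1 r) has_real_derivative
      ((real k)\<^sup>2 / r - \<mu> * r) * circ_coeff k c u r) (at r)"
    by (rule circ_coeff_radial_equation[OF R C2 helmholtz, of k c], assumption, rule that)
  define x where "x = circ_coeff k c u"
  define y where "y r = r * m1 r" for r
  define w where "w r = r ^ k * W.rad_sol k \<mu> r" for r
  define v where "v r = r ^ k * (real k * W.rad_sol k \<mu> r - \<mu> * r\<^sup>2 * W.rad_flux k \<mu> r)" for r
  let ?b = "\<lambda>r. (real k)\<^sup>2 / r - \<mu> * r"
  have dx: "(x has_real_derivative 1 / r * y r) (at r)" if "r \<in> {0<..<R}" for r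
    using m(3)[OF that] that by (simp add: x_def y_def)
  have dy: "(y has_real_derivative ?b r * x r) (at r)" if "r \<in> {0<..<R}" for r
    using m(4)[OF that] by (simp add: x_def y_def[abs_def])
  have dw: "(w has_real_derivative 1 / r * v r) (at r)" if "r \<in> {0<..<R}" for r
    using W.rad_mode_derivs(1)[OF that, of k \<mu>] by (simp add: w_def[abs_def] v_def)
  have dv: "(v has_real_derivative ?b r * w r) (at r)" if "r \<in> {0<..<R}" for r
    using W.rad_mode_derivs(2)[OF that, of k \<mu>] by (simp add: w_def v_def[abs_def])
  have cx: "continuous_on {0..<R} x" and cy: "continuous_on {0..<R} y"
    unfolding x_def y_def by (intro continuous_intros m)+
  have cw: "continuous_on {0..R} w" and cv: "continuous_on {0..R} v"
    unfolding w_def v_def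
    by (intro continuous_intros W.continuous_on_rad_sol W.continuous_on_rad_flux)+
  have wronskian: "y r * w r = x r * v r" if r: "r \<in> {0<..<R}" for r
  proof -
    have "y r * w r - x r * v r = y 0 * w 0 - x 0 * v 0"
    proof (rule DERIV_isconst2[where f = "\<lambda>r. y r * w r - x r * v r" and a = 0 and b = r])
      show "continuous_on {0..r} (\<lambda>r. y r * w r - x r * v r)"
        by (intro continuous_intros continuous_on_subset[OF cx] continuous_on_subset[OF cy]
            continuous_on_subset[OF cw] continuous_on_subset[OF cv]) (use r in auto)
      fix s assume "0 < s" "s < r"
      then have s: "s \<in> {0<..<R}" using r by auto
      have "((\<lambda>r. y r * w r - x r * v r) has_real_derivative
          (?b s * x s * w s + 1 / s * v s * y s) - (1 / s * y s * v s + ?b s * w s * x s)) (at s)"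
        by (intro DERIV_diff DERIV_mult dx dy dw dv s)
      then show "((\<lambda>r. y r * w r - x r * v r) has_real_derivative 0) (at s)"
        by (simp add: mult_ac)
    qed (use r in auto)
    \<comment> \<open>At 0, \<open>y\<close> vanishes through its factor \<open>r\<close>, and
      \<open>v\<close> through \<open>r ^ k\<close> or, when \<open>k = 0\<close>, through its
      remaining factors.\<close>
    also have "\<dots> = 0" by (cases k) (auto simp: y_def v_def)
    finally show ?thesis by simp
  qed
  have uniq: "p r = 0" if "continuous_on {0<..<R} p" "continuous_on {0<..<R} q"
    "\<And>r. r \<in> {0<..<R} \<Longrightarrow> (p has_real_derivative 1 / r * q r) (at r)"
    "\<And>r. r \<in> {0<..<R} \<Longrightarrow> (q has_real_derivative ?b r * p r) (at r)"
    "p r0 = 0" "q r0 = 0" "r \<in> {0<..<R}" for p q r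
  proof -
    define a b where "a = min r r0" and "b = max r r0"
    have ab: "0 < a" "b < R" "a \<le> b" "{a..b} \<subseteq> {0<..<R}"
      using that(7) r0 by (auto simp: a_def b_def)
    define C where "C = max (1 / a) ((real k)\<^sup>2 / a + \<bar>\<mu>\<bar> * R)"
    have "p r = 0 \<and> q r = 0"
    proof (rule linear_system_zero[where c = r0 and C = C and a = a and b = b and x = p and y = q
          and \<alpha> = "\<lambda>r. 1 / r" and \<beta> = ?b and t = r])
      show "continuous_on {a..b} p" "continuous_on {a..b} q"
        using that(1,2) ab(4) by (auto intro: continuous_on_subset)
      fix t assume t: "t \<in> {a<..<b}"
      then have tR: "t \<in> {0<..<R}" using ab by auto
      show "(p has_real_derivative 1 / t * q t) (at t)" "(q has_real_derivative ?b t * p t) (at t)"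
        using that(3,4) tR by auto
      have "1 / t \<le> 1 / a" using t ab by (intro divide_left_mono) auto
      then show "\<bar>1 / t\<bar> \<le> C" using tR by (simp add: C_def)
      have "(real k)\<^sup>2 / t \<le> (real k)\<^sup>2 / a" using t ab by (intro divide_left_mono) auto
      moreover have "\<bar>\<mu>\<bar> * t \<le> \<bar>\<mu>\<bar> * R" using tR by (intro mult_left_mono) auto
      moreover have "\<bar>?b t\<bar> \<le> (real k)\<^sup>2 / t + \<bar>\<mu>\<bar> * t"
        using tR abs_triangle_ineq4[of "(real k)\<^sup>2 / t" "\<mu> * t"] by (simp add: abs_mult)
      ultimately show "\<bar>?b t\<bar> \<le> C" unfolding C_def by linarith
    qed (use that in \<open>auto simp: a_def b_def\<close>)
    then show ?thesis by simp
  qed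
  have sub: "{0<..<R} \<subseteq> {0..<R}" "{0<..<R} \<subseteq> {0..R}" by auto
  note conts = continuous_on_subset[OF cx sub(1)] continuous_on_subset[OF cy sub(1)]
    continuous_on_subset[OF cw sub(2)] continuous_on_subset[OF cv sub(2)]
  have w0: "w r0 \<noteq> 0" using r0 by (simp add: w_def)
  have "x r0 = 0"
  proof (cases "W.rad_sol k \<mu> R = 0")
    case True
    then show ?thesis using zero by (simp add: x_def)
  next
    case False
    \<comment> \<open>The combination vanishes at \<open>r0\<close> by construction and its
      companion \<open>q\<close> by the Wronskian identity, so uniqueness applies.\<close>
    have propn: "x r * w r0 - x r0 * w r = 0" if "r \<in> {0<..<R}" for r
    proof (rule uniq[where p = "\<lambda>r. x r * w r0 - x r0 * w r" and q = "\<lambda>r. y r * w r0 - x r0 * v r"])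
      fix s assume s: "s \<in> {0<..<R}"
      have "((\<lambda>r. x r * w r0 - x r0 * w r) has_real_derivative
          1 / s * y s * w r0 - x r0 * (1 / s * v s)) (at s)"
        by (intro DERIV_diff DERIV_cmult DERIV_cmult_right dx dw s)
      then show "((\<lambda>r. x r * w r0 - x r0 * w r) has_real_derivative
          1 / s * (y s * w r0 - x r0 * v s)) (at s)"
        by (simp add: algebra_simps)
      have "((\<lambda>r. y r * w r0 - x r0 * v r) has_real_derivative
          ?b s * x s * w r0 - x r0 * (?b s * w s)) (at s)"
        by (intro DERIV_diff DERIV_cmult DERIV_cmult_right dy dv s)
      then show "((\<lambda>r. y r * w r0 - x r0 * v r) has_real_derivative
          ?b s * (x s * w r0 - x r0 * w s)) (at s)"
        by (rule DERIV_cong) (simp only: right_diff_distrib mult_ac)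
    qed (use that wronskian[OF r0(1)] in \<open>auto intro!: continuous_intros conts\<close>)
    have cxR: "continuous_on {0<..R} x"
      unfolding x_def circ_coeff_def[abs_def]
    proof -
      have "continuous_on ({0<..R} \<times> cbox 0 (2 * pi)) (\<lambda>(r, t). u (polar r t) * circ k c t)"
        unfolding case_prod_beta
        by (intro continuous_intros continuous_on_compose2[OF cont]) auto
      from integral_continuous_on_param[OF this]
      show "continuous_on {0<..R} (\<lambda>r. integral {0..2 * pi} (\<lambda>t. u (polar r t) * circ k c t))"
        by simp
    qed
    have "x R * w r0 - x r0 * w R = 0"
    proof (rule continuous_constant_on_closure[where S = "{r0<..<R}" and f = "\<lambda>r. x r * w r0 - x r0 * w r"])
      show "continuous_on (closure {r0<..<R}) (\<lambda>r. x r * w r0 - x r0 * w r)"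
        using r0 by (intro continuous_intros continuous_on_subset[OF cxR] continuous_on_subset[OF cw]) auto
    qed (use propn r0 in auto)
    moreover have "x R = 0"
      using R by (simp add: x_def circ_coeff_def bdry)
    moreover have "w R \<noteq> 0" using False R by (simp add: w_def)
    ultimately show ?thesis by simp
  qed
  moreover from this have "y r0 = 0" using wronskian[OF r0(1)] w0 by simp
  ultimately show ?thesis
    using uniq[of x y r] conts dx dy r by (simp add: x_def)
qed

text \<open>Elimination by induction on the equations: an unknown with nonzero coefficient in the
  new equation is solved for and substituted into the others.\<close>

lemma homogeneous_system_nontrivial:
  fixes M :: "'a \<Rightarrow> 'b \<Rightarrow> real"
  assumes "finite A" "finite B" "card A < card B"
  shows "\<exists>c. (\<exists>b\<in>B. c b \<noteq> 0) \<and> (\<forall>a\<in>A. (\<Sum>b\<in>B. c b * M a b) = 0)"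
  using assms
proof (induction A arbitrary: B M rule: finite_induct)
  case empty
  then obtain b where "b \<in> B" by (metis card.empty card_gt_0_iff ex_in_conv)
  then show ?case by (intro exI[of _ "\<lambda>_. 1"]) auto
next
  case (insert a A)
  show ?case
  proof (cases "\<forall>b\<in>B. M a b = 0")
    case True
    have "card A < card B" using insert by simp
    from insert.IH[OF insert.prems(1) this, of M] True show ?thesis by auto
  next
    case False
    then obtain b0 where b0: "b0 \<in> B" "M a b0 \<noteq> 0" by auto
    let ?B = "B - {b0}"
    have "finite ?B" "card A < card ?B" using insert b0 by auto
    from insert.IH[OF this, of "\<lambda>a' b. M a' b - M a' b0 * M a b / M a b0"]
    obtain c where c: "\<exists>b\<in>?B. c b \<noteq> 0"
      "\<forall>a'\<in>A. (\<Sum>b\<in>?B. c b * (M a' b - M a' b0 * M a b / M a b0)) = 0" by blast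
    define s where "s = - (\<Sum>b\<in>?B. c b * M a b) / M a b0"
    define d where "d b = (if b = b0 then s else c b)" for b
    have split: "(\<Sum>b\<in>B. d b * M a' b) = s * M a' b0 + (\<Sum>b\<in>?B. c b * M a' b)" for a'
    proof -
      have "(\<Sum>b\<in>?B. d b * M a' b) = (\<Sum>b\<in>?B. c b * M a' b)"
        by (intro sum.cong) (auto simp: d_def)
      then show ?thesis
        using sum.remove[OF insert.prems(1) b0(1), of "\<lambda>b. d b * M a' b"] by (simp add: d_def)
    qed
    have "(\<Sum>b\<in>B. d b * M a b) = 0" unfolding split s_def using b0 by simp
    moreover have "(\<Sum>b\<in>B. d b * M a' b) = 0" if "a' \<in> A" for a'
    proof -
      have "(\<Sum>b\<in>?B. c b * (M a' b - M a' b0 * M a b / M a b0)) =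
          (\<Sum>b\<in>?B. c b * M a' b) - M a' b0 / M a b0 * (\<Sum>b\<in>?B. c b * M a b)"
        by (simp add: right_diff_distrib sum_subtractf sum_distrib_left mult_ac)
      then show ?thesis using c(2) that unfolding split s_def by (simp add: field_simps)
    qed
    moreover have "\<exists>b\<in>B. d b \<noteq> 0" using c(1) by (auto simp: d_def)
    ultimately show ?thesis by (intro exI[of _ d]) auto
  qed
qed

section \<open>Counting modes in an eigenspace of the disc\<close>

lemma laplacian_vec2:
  fixes u :: "real^2 \<Rightarrow> real"
  shows "laplacian u z = partial_deriv (axis 1 1) (partial_deriv (axis 1 1) u) z +
    partial_deriv (axis 2 1) (partial_deriv (axis 2 1) u) z"
proof -
  have B: "(Basis :: (real^2) set) = (\<lambda>i. axis i 1) ` UNIV" by (auto simp: Basis_vec2)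
  have inj: "inj (\<lambda>i::2. axis i (1::real))" by (auto simp: inj_on_def axis_eq_axis)
  have "laplacian u z =
      (\<Sum>i\<in>UNIV. partial_deriv (axis i 1) (partial_deriv (axis i 1) u) z)"
    unfolding laplacian_def B by (subst sum.reindex[OF inj]) (simp add: o_def)
  then show ?thesis by (simp add: sum_2)
qed

lemma sum_scaled_fun_apply: "(\<Sum>v\<in>B. (\<lambda>x. c v * v x)) x = (\<Sum>v\<in>B. c v * (v x :: real))"
  by (induction B rule: infinite_finite_induct) auto

lemma circ_coeff_sum:
  assumes "\<And>a. a \<in> A \<Longrightarrow> continuous_on (ball 0 R) (v a)" "r \<in> {0<..<R}"
  shows "circ_coeff k c (\<lambda>x. \<Sum>a\<in>A. s a * v a x) r = (\<Sum>a\<in>A. s a * circ_coeff k c (v a) r)"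
proof (cases "finite A")
  case True
  have 1: "(\<lambda>t. v a (polar r t) * circ k c t) integrable_on {0..2 * pi}" if "a \<in> A" for a
    by (intro integrable_continuous_interval continuous_intros continuous_on_compose2[OF assms(1)[OF that]])
      (use assms(2) in auto)
  have "circ_coeff k c (\<lambda>x. \<Sum>a\<in>A. s a * v a x) r =
      integral {0..2 * pi} (\<lambda>t. \<Sum>a\<in>A. s a * (v a (polar r t) * circ k c t))"
    unfolding circ_coeff_def by (simp add: sum_distrib_right mult.assoc)
  also have "\<dots> = (\<Sum>a\<in>A. integral {0..2 * pi} (\<lambda>t. s a * (v a (polar r t) * circ k c t)))"
    by (intro integral_sum True integrable_on_mult_right 1)
  finally show ?thesis by (simp add: circ_coeff_def)
qed (simp add: circ_coeff_def)

text \<open>The coefficient functionals of the modes that vanish at \<open>R\<close>, each taken at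
  one sample radius, separate the points of the eigenspace. If they were fewer than the basis
  elements, a nonzero eigenfunction would be annihilated by all of them. So at least
  \<open>card B\<close> such modes exist, and exactly that many are selected.\<close>

lemma disc_eigenspace_modes:
  fixes R :: real
  assumes R: "0 < R" and B: "finite B" "\<not> fun_space.dependent B"
    "fun_space.span B = dirichlet_eigenspace laplacian (ball (0 :: real^2) R) \<mu>"
  shows "\<exists>A. finite A \<and> card A = card B \<and> A \<subseteq> modes \<and>
    (\<forall>(k, c)\<in>A. radial_weight.rad_sol (\<lambda>_. 1) k \<mu> R = 0)"
proof -
  interpret W: radial_weight R "\<lambda>_. 1" by (rule radial_weight_one[OF R])
  let ?E = "dirichlet_eigenspace laplacian (ball (0 :: real^2) R) \<mu>"
  let ?A = "{(k, c) \<in> modes. W.rad_sol k \<mu> R = 0}"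
  have "\<exists>r\<in>{0<..<R}. W.rad_sol k \<mu> r \<noteq> 0" for k
  proof (rule ccontr)
    assume neg: "\<not> ?thesis"
    have "W.rad_sol k \<mu> 0 = 0"
    proof (rule continuous_constant_on_closure[where S = "{0<..<R}" and f = "W.rad_sol k \<mu>"])
      show "continuous_on (closure {0<..<R}) (W.rad_sol k \<mu>)"
        using R W.continuous_on_rad_sol[of k \<mu>] by simp
    qed (use neg R in auto)
    then show False by (simp add: W.rad_sol_0)
  qed
  \<comment> \<open>Sample radii, one for each frequency; they exist because the regular solution
    equals 1 at the centre.\<close>
  then obtain \<rho> where \<rho>: "\<And>k. \<rho> k \<in> {0<..<R}" "\<And>k. W.rad_sol k \<mu> (\<rho> k) \<noteq> 0"
    by metis
  have contE: "continuous_on (ball 0 R) u" if "u \<in> ?E" for u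
    using that continuous_on_subset[OF _ closure_subset] by (auto simp: dirichlet_eigenspace_def)
  have separate: "u = (\<lambda>_. 0)"
    if u: "u \<in> ?E" and zero: "\<And>k c. (k, c) \<in> ?A \<Longrightarrow> circ_coeff k c u (\<rho> k) = 0" for u
  proof -
    let ?u' = "\<lambda>i. partial_deriv (axis i 1) u"
    let ?u'' = "\<lambda>i j. partial_deriv (axis j 1) (partial_deriv (axis i 1) u)"
    have C2: "C2_partials (ball 0 R) u ?u' ?u''"
      using u by (intro Ck_on_imp_C2_partials) (simp add: dirichlet_eigenspace_def)
    have hel: "?u'' 1 1 z + ?u'' 2 2 z = - \<mu> * u z" if "z \<in> ball 0 R" for z
    proof -
      have "- laplacian u z = \<mu> * u z" using u that by (simp add: dirichlet_eigenspace_def)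
      then show ?thesis unfolding laplacian_vec2 by linarith
    qed
    have cont: "continuous_on (cball 0 R) u"
      using u R by (simp add: dirichlet_eigenspace_def)
    have bdry: "u z = 0" if "z \<notin> ball 0 R" for z
      using u that unfolding dirichlet_eigenspace_def by blast
    have coeff: "circ_coeff k c u r = 0" if "(k, c) \<in> modes" "r \<in> {0<..<R}" for k c r
      by (rule circ_coeff_mode_zero[OF R C2 hel cont _ \<rho>(1)[of k] \<rho>(2)])
        (use that zero[of k c] bdry in auto)
    have ball0: "u z = 0" if "z \<in> ball 0 R - {0}" for z
      by (rule circ_coeff_complete[of "norm z"])
        (use that coeff in \<open>auto intro: continuous_on_subset[OF cont]\<close>)
    \<comment> \<open>Completeness concerns circles of positive radius; the centre is reached by
      continuity along a ray.\<close>
    have "u (polar 0 0) = 0"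
    proof (rule continuous_constant_on_closure[where S = "{0<..<R}" and f = "\<lambda>r. u (polar r 0)"])
      show "continuous_on (closure {0<..<R}) (\<lambda>r. u (polar r 0))"
        by (rule continuous_on_compose2[OF cont]) (use R in \<open>auto intro!: continuous_intros\<close>)
      show "u (polar r 0) = 0" if "r \<in> {0<..<R}" for r
      proof (rule ball0)
        have "norm (polar r 0) \<noteq> 0" using that unfolding norm_polar by simp
        then show "polar r 0 \<in> ball 0 R - {0}" using that unfolding norm_eq_zero by simp
      qed
    qed (use R in auto)
    moreover have "polar 0 0 = 0" by (simp add: vec_eq_iff forall_2)
    ultimately have "u 0 = 0" by simp
    then show ?thesis using ball0 bdry by (metis Diff_iff singletonD)
  qed
  have "\<not> (finite ?A \<and> card ?A < card B)"
  proof
    assume fin: "finite ?A \<and> card ?A < card B"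
    then obtain a where a: "\<exists>b\<in>B. a b \<noteq> 0"
      "\<forall>m\<in>?A. (\<Sum>b\<in>B. a b * circ_coeff (fst m) (snd m) b (\<rho> (fst m))) = 0"
      using homogeneous_system_nontrivial[of ?A B "\<lambda>m b. circ_coeff (fst m) (snd m) b (\<rho> (fst m))"] B(1)
      by blast
    let ?u = "\<lambda>x. \<Sum>v\<in>B. a v * v x"
    have BE: "b \<in> ?E" if "b \<in> B" for b
      using that B(3) fun_space.span_base by blast
    have eq: "?u = (\<Sum>v\<in>B. (\<lambda>x. a v * v x))" by (simp add: fun_eq_iff sum_scaled_fun_apply)
    have "?u \<in> fun_space.span B"
      unfolding eq by (intro fun_space.span_sum fun_space.span_scale fun_space.span_base)
    then have "?u = (\<lambda>_. 0)"
      unfolding B(3)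
    proof (rule separate)
      fix k c assume "(k, c) \<in> ?A"
      then have "(\<Sum>b\<in>B. a b * circ_coeff k c b (\<rho> k)) = 0" using a(2) by fastforce
      then show "circ_coeff k c ?u (\<rho> k) = 0"
        by (subst circ_coeff_sum[where R = R and v = "\<lambda>v. v"]) (use contE BE \<rho>(1) in auto)
    qed
    then have "(\<Sum>v\<in>B. (\<lambda>x. a v * v x)) = 0" unfolding eq by (simp add: zero_fun_def)
    then have "\<forall>b\<in>B. a b = 0" using fun_space.independentD[OF B(2) B(1) subset_refl] by blast
    then show False using a(1) by blast
  qed
  then obtain A where A: "A \<subseteq> ?A" "finite A" "card A = card B"
  proof (cases "finite ?A")
    case True
    with \<open>\<not> (finite ?A \<and> card ?A < card B)\<close> have "card B \<le> card ?A" by simp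
    then obtain T where "T \<subseteq> ?A" "card T = card B" "finite T"
      by (rule obtain_subset_with_card_n)
    then show ?thesis by (intro that)
  next
    case False
    then obtain T where "finite T" "card T = card B" "T \<subseteq> ?A"
      using infinite_arbitrarily_large by blast
    then show ?thesis by (intro that)
  qed
  show ?thesis
  proof (intro exI conjI)
    show "finite A" "card A = card B" by fact+
    show "A \<subseteq> modes" "\<forall>(k, c)\<in>A. W.rad_sol k \<mu> R = 0" using A(1) by auto
  qed
qed

section \<open>Radial functions and harmonic polynomials\<close>

text \<open>For a function \<open>K\<close> of the distance \<open>r\<close>, \<open>J = r K'\<close> and its vanishing at the origin is what makes
  \<open>K (norm z) * z\<^sub>i\<close> continuously differentiable there.\<close>

definition euler_deriv :: "real \<Rightarrow> (real \<Rightarrow> real) \<Rightarrow> (real \<Rightarrow> real) \<Rightarrow> bool" where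
  "euler_deriv L K J \<longleftrightarrow> continuous_on {0..<L} K \<and> continuous_on {0..<L} J \<and> J 0 = 0 \<and>
    (\<forall>r\<in>{0<..<L}. (K has_real_derivative J r / r) (at r))"

section \<open>Algebra of Euler derivatives\<close>

lemma euler_deriv_const: "euler_deriv L (\<lambda>r. c) (\<lambda>r. 0)"
  by (simp add: euler_deriv_def)

lemma euler_deriv_power2: "euler_deriv L (\<lambda>r. r\<^sup>2) (\<lambda>r. 2 * r\<^sup>2)"
  unfolding euler_deriv_def
  by (auto intro!: continuous_intros derivative_eq_intros simp: power2_eq_square)

lemma euler_deriv_add:
  "euler_deriv L K J \<Longrightarrow> euler_deriv L K' J' \<Longrightarrow> euler_deriv L (\<lambda>r. K r + K' r) (\<lambda>r. J r + J' r)"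
  unfolding euler_deriv_def
  by (auto intro!: continuous_intros derivative_eq_intros simp: add_divide_distrib)

lemma euler_deriv_mult:
  assumes "euler_deriv L K J" "euler_deriv L K' J'"
  shows "euler_deriv L (\<lambda>r. K r * K' r) (\<lambda>r. J r * K' r + K r * J' r)"
  unfolding euler_deriv_def
proof (intro conjI ballI)
  fix r assume r: "r \<in> {0<..<L}"
  have "((\<lambda>r. K r * K' r) has_real_derivative J r / r * K' r + J' r / r * K r) (at r)"
    by (intro DERIV_mult) (use assms r in \<open>auto simp: euler_deriv_def\<close>)
  then show "((\<lambda>r. K r * K' r) has_real_derivative (J r * K' r + K r * J' r) / r) (at r)"
    by (simp add: add_divide_distrib mult.commute)
qed (use assms in \<open>auto simp: euler_deriv_def intro!: continuous_intros\<close>)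

lemma euler_deriv_inverse:
  assumes "euler_deriv L K J" "\<And>r. r \<in> {0..<L} \<Longrightarrow> K r \<noteq> 0"
  shows "euler_deriv L (\<lambda>r. inverse (K r)) (\<lambda>r. - J r * (inverse (K r))\<^sup>2)"
  unfolding euler_deriv_def
proof (intro conjI ballI)
  fix r assume r: "r \<in> {0<..<L}"
  have "((\<lambda>r. inverse (K r)) has_real_derivative - (inverse (K r) * (J r / r) * inverse (K r))) (at r)"
    by (rule DERIV_inverse') (use assms r in \<open>auto simp: euler_deriv_def\<close>)
  then show "((\<lambda>r. inverse (K r)) has_real_derivative - J r * (inverse (K r))\<^sup>2 / r) (at r)"
    by (simp add: power2_eq_square mult_ac)
qed (use assms in \<open>auto simp: euler_deriv_def intro!: continuous_intros\<close>)

lemma euler_deriv_power: "euler_deriv L K J \<Longrightarrow> \<exists>J'. euler_deriv L (\<lambda>r. K r ^ n) J'"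
proof (induction n)
  case 0
  then show ?case using euler_deriv_const[of L 1] by auto
next
  case (Suc n)
  then show ?case using euler_deriv_mult by (simp, blast)
qed

section \<open>Radial functions at the origin\<close>

lemma DERIV_zero_of_quadratic_bound:
  fixes \<phi> :: "real \<Rightarrow> real"
  assumes "0 < e" "\<And>t. \<bar>t\<bar> < e \<Longrightarrow> \<bar>\<phi> t - \<phi> 0\<bar> \<le> B * t\<^sup>2"
  shows "(\<phi> has_real_derivative 0) (at 0)"
proof -
  have "((\<lambda>t. (\<phi> t - \<phi> 0) / t) \<longlongrightarrow> 0) (at 0)"
  proof (rule tendsto_rabs_zero_cancel, rule tendsto_sandwich)
    show "\<forall>\<^sub>F t in at 0. 0 \<le> \<bar>(\<phi> t - \<phi> 0) / t\<bar>" by simp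
    show "\<forall>\<^sub>F t in at 0. \<bar>(\<phi> t - \<phi> 0) / t\<bar> \<le> \<bar>B\<bar> * \<bar>t\<bar>"
      unfolding eventually_at
    proof (intro exI conjI ballI impI)
      fix t :: real assume t: "t \<noteq> 0 \<and> dist t 0 < e"
      have "\<bar>\<phi> t - \<phi> 0\<bar> \<le> B * t\<^sup>2" using assms(2)[of t] t by (simp add: dist_real_def)
      also have "\<dots> \<le> \<bar>B\<bar> * \<bar>t\<bar> * \<bar>t\<bar>"
        using abs_ge_self[of B] by (simp add: power2_eq_square mult_right_mono mult.assoc)
      finally show "\<bar>(\<phi> t - \<phi> 0) / t\<bar> \<le> \<bar>B\<bar> * \<bar>t\<bar>" using t by (simp add: divide_le_eq)
    qed (rule assms(1))
    show "((\<lambda>t. \<bar>B\<bar> * \<bar>t\<bar>) \<longlongrightarrow> 0) (at 0)"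
      by (rule tendsto_eq_intros refl | simp)+
  qed simp
  then show ?thesis by (simp add: DERIV_def)
qed

text \<open>If \<open>B\<close> bounds \<open>K\<close>, then \<open>H r + B * r\<^sup>2\<close>
  increases and \<open>H r - B * r\<^sup>2\<close> decreases. The range stops at
  \<open>L / 2\<close> so that \<open>K\<close> is bounded by compactness.\<close>

lemma radial_quadratic_bound:
  assumes L: "0 < L" and H: "continuous_on {0..<L} H" and K: "continuous_on {0..<L} K"
    and dH: "\<And>r. r \<in> {0<..<L} \<Longrightarrow> (H has_real_derivative r * K r) (at r)"
  obtains B where "\<And>r. r \<in> {0..L / 2} \<Longrightarrow> \<bar>H r - H 0\<bar> \<le> B * r\<^sup>2"
proof -
  have "continuous_on {0..L / 2} K" by (rule continuous_on_subset[OF K]) (use L in auto)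
  then have "bounded (K ` {0..L / 2})" by (intro compact_imp_bounded compact_continuous_image) auto
  then obtain B where "\<forall>x\<in>K ` {0..L / 2}. norm x \<le> B" unfolding bounded_iff by blast
  then have B: "\<bar>K r\<bar> \<le> B" if "r \<in> {0..L / 2}" for r using that by auto
  show ?thesis
  proof (rule that[of B])
    fix r assume r: "r \<in> {0..L / 2}"
    have Hr: "continuous_on {0..r} H" by (rule continuous_on_subset[OF H]) (use L r in auto)
    have bd: "\<bar>s * K s\<bar> \<le> 2 * B * s" if "0 < s" "s < r" for s
    proof -
      have "s * \<bar>K s\<bar> \<le> s * B" using B[of s] that r by (intro mult_left_mono) auto
      moreover have "0 \<le> s * B" using B[of s] that r by (intro mult_nonneg_nonneg) auto
      ultimately show ?thesis using that by (simp add: abs_mult)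
    qed
    have "H 0 + B * 0\<^sup>2 \<le> H r + B * r\<^sup>2"
    proof (rule DERIV_nonneg_imp_increasing_open[where f = "\<lambda>s. H s + B * s\<^sup>2"])
      fix s assume s: "0 < s" "s < r"
      have "((\<lambda>s. H s + B * s\<^sup>2) has_real_derivative s * K s + 2 * B * s) (at s)"
        using s r L by (auto intro!: derivative_eq_intros dH)
      moreover have "0 \<le> s * K s + 2 * B * s" using bd[OF s] by linarith
      ultimately show "\<exists>y. ((\<lambda>s. H s + B * s\<^sup>2) has_real_derivative y) (at s) \<and> 0 \<le> y" by blast
    qed (use r in \<open>auto intro!: continuous_intros Hr\<close>)
    moreover have "H r - B * r\<^sup>2 \<le> H 0 - B * 0\<^sup>2"
    proof (rule DERIV_nonpos_imp_decreasing_open[where f = "\<lambda>s. H s - B * s\<^sup>2"])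
      fix s assume s: "0 < s" "s < r"
      have "((\<lambda>s. H s - B * s\<^sup>2) has_real_derivative s * K s - 2 * B * s) (at s)"
        using s r L by (auto intro!: derivative_eq_intros dH)
      moreover have "s * K s - 2 * B * s \<le> 0" using bd[OF s] by linarith
      ultimately show "\<exists>y. ((\<lambda>s. H s - B * s\<^sup>2) has_real_derivative y) (at s) \<and> y \<le> 0" by blast
    qed (use r in \<open>auto intro!: continuous_intros Hr\<close>)
    ultimately show "\<bar>H r - H 0\<bar> \<le> B * r\<^sup>2" by simp
  qed
qed

text \<open>This is the profile of \<open>H (norm z)\<close> on a coordinate line through the
  origin; the quadratic bound smooths out the corner of the absolute value.\<close>

lemma DERIV_even_radial:
  assumes "0 < L" "continuous_on {0..<L} H" "continuous_on {0..<L} K"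
    "\<And>r. r \<in> {0<..<L} \<Longrightarrow> (H has_real_derivative r * K r) (at r)"
  shows "((\<lambda>t. H \<bar>t\<bar>) has_real_derivative 0) (at 0)"
proof -
  obtain B where B: "\<And>r. r \<in> {0..L / 2} \<Longrightarrow> \<bar>H r - H 0\<bar> \<le> B * r\<^sup>2"
    by (rule radial_quadratic_bound[OF assms(1-3)]) (use assms(4) in auto)
  show ?thesis
    by (rule DERIV_zero_of_quadratic_bound[of "L / 2" _ B]) (use assms(1) B[of "\<bar>_\<bar>"] in auto)
qed

text \<open>This is the profile of \<open>K (norm z) * z $ i\<close> on the coordinate line through
  the origin; its difference quotient at 0 is \<open>K \<bar>t\<bar>\<close>.\<close>

lemma DERIV_odd_radial:
  assumes L: "0 < L" and K: "continuous_on {0..<L} K"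
  shows "((\<lambda>t. K \<bar>t\<bar> * t) has_real_derivative K 0) (at 0)"
proof -
  have "((\<lambda>t. K \<bar>t\<bar>) \<longlongrightarrow> K \<bar>0\<bar>) (at 0)"
  proof -
    have "continuous_on {- L<..<L} (\<lambda>t. K \<bar>t\<bar>)"
      by (rule continuous_on_compose2[OF K]) (auto intro!: continuous_intros)
    then have "isCont (\<lambda>t. K \<bar>t\<bar>) 0"
      using L by (simp add: continuous_on_eq_continuous_at)
    then show ?thesis by (simp add: isCont_def)
  qed
  moreover have "((\<lambda>t. (K \<bar>t\<bar> * t - K \<bar>0\<bar> * 0) / (t - 0)) \<longlongrightarrow> K 0) (at 0) \<longleftrightarrow>
      ((\<lambda>t. K \<bar>t\<bar>) \<longlongrightarrow> K 0) (at 0)"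
    by (rule LIM_equal) auto
  ultimately show ?thesis by (simp add: DERIV_def)
qed

lemma norm_axis_scaled [simp]: "norm (t *\<^sub>R axis i (1::real) :: real^2) = \<bar>t\<bar>"
  by simp

text \<open>Away from the origin this is the chain rule. At the origin the term with
  \<open>J\<close> is 0, and it is continuous there since \<open>\<bar>J (norm z)\<bar>\<close>
  bounds it and \<open>J 0 = 0\<close>.\<close>

lemma radial_C2_partials:
  assumes L: "0 < L" and H: "continuous_on {0..<L} H" and KJ: "euler_deriv L K J"
    and dH: "\<And>r. r \<in> {0<..<L} \<Longrightarrow> (H has_real_derivative r * K r) (at r)"
  shows "C2_partials (ball 0 L) (\<lambda>z. H (norm z)) (\<lambda>i z. K (norm z) * z $ i)
    (\<lambda>i j z. (if i = j then K (norm z) else 0) + z $ i * z $ j * (J (norm z) / (norm z)\<^sup>2))"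
proof -
  have K: "continuous_on {0..<L} K" and J: "continuous_on {0..<L} J" "J 0 = 0"
    and dK: "\<And>r. r \<in> {0<..<L} \<Longrightarrow> (K has_real_derivative J r / r) (at r)"
    using KJ by (auto simp: euler_deriv_def)
  have cnorm: "continuous_on (ball 0 L) (\<lambda>z::real^2. f (norm z))" if "continuous_on {0..<L} f" for f :: "real \<Rightarrow> real"
    by (rule continuous_on_compose2[OF that]) (auto intro!: continuous_intros)
  have p1: "has_partial i (\<lambda>z. H (norm z)) z (K (norm z) * z $ i)" if z: "z \<in> ball 0 L" for i z
  proof (cases "z = 0")
    case True
    then show ?thesis
      using DERIV_even_radial[OF L H K dH] by (simp add: has_partial_def)
  next
    case False
    have "has_partial i (\<lambda>z. H (norm z)) z (norm z * K (norm z) * (z $ i / norm z))"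
      by (rule has_partial_compose[OF has_partial_norm[OF False]]) (use dH[of "norm z"] z False in auto)
    then show ?thesis using False by simp
  qed
  have p2: "has_partial j (\<lambda>z. K (norm z) * z $ i) z
      ((if i = j then K (norm z) else 0) + z $ i * z $ j * (J (norm z) / (norm z)\<^sup>2))"
    if z: "z \<in> ball 0 L" for i j z
  proof (cases "z = 0")
    case True
    have "axis j (1::real) $ i = (if i = j then 1 else 0)" by (simp add: axis_def)
    with True show ?thesis
      using DERIV_odd_radial[OF L K] by (auto simp: has_partial_def)
  next
    case False
    have "has_partial j (\<lambda>z. K (norm z)) z (J (norm z) / norm z * (z $ j / norm z))"
      by (rule has_partial_compose[OF has_partial_norm[OF False]]) (use dK[of "norm z"] z False in auto)
    from has_partial_mult[OF this has_partial_component[of j i z]]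
    show ?thesis by (rule back_subst) (auto simp: power2_eq_square)
  qed
  have c2: "continuous_on (ball 0 L) (\<lambda>z::real^2. z $ i * z $ j * (J (norm z) / (norm z)\<^sup>2))" for i j
    unfolding continuous_on_eq_continuous_within
  proof
    fix z :: "real^2" assume z: "z \<in> ball 0 L"
    show "continuous (at z within ball 0 L) (\<lambda>z::real^2. z $ i * z $ j * (J (norm z) / (norm z)\<^sup>2))"
    proof (cases "z = 0")
      case False
      have "continuous_on (ball 0 L - {0}) (\<lambda>z::real^2. z $ i * z $ j * (J (norm z) / (norm z)\<^sup>2))"
        by (intro continuous_intros continuous_on_subset[OF cnorm[OF J(1)]]) auto
      moreover have "open (ball (0 :: real^2) L - {0})" by (intro open_Diff) auto
      ultimately have "isCont (\<lambda>z::real^2. z $ i * z $ j * (J (norm z) / (norm z)\<^sup>2)) z"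
        using z False by (simp add: continuous_on_eq_continuous_at)
      then show ?thesis by (rule continuous_at_imp_continuous_at_within)
    next
      case True
      have "((\<lambda>z::real^2. z $ i * z $ j * (J (norm z) / (norm z)\<^sup>2)) \<longlongrightarrow> 0) (at 0 within ball 0 L)"
      proof (rule tendsto_rabs_zero_cancel, rule tendsto_sandwich)
        show "\<forall>\<^sub>F z::real^2 in at 0 within ball 0 L. 0 \<le> \<bar>z $ i * z $ j * (J (norm z) / (norm z)\<^sup>2)\<bar>"
          by simp
        show "\<forall>\<^sub>F z::real^2 in at 0 within ball 0 L. \<bar>z $ i * z $ j * (J (norm z) / (norm z)\<^sup>2)\<bar> \<le> \<bar>J (norm z)\<bar>"
        proof (rule always_eventually, rule allI)
          fix z :: "real^2"
          have "\<bar>z $ i\<bar> * \<bar>z $ j\<bar> \<le> norm z * norm z"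
            by (intro mult_mono component_le_norm_cart) auto
          then have "\<bar>z $ i * z $ j\<bar> / (norm z)\<^sup>2 \<le> 1"
            by (cases "z = 0") (auto simp: abs_mult power2_eq_square divide_le_eq_1 zero_less_mult_iff)
          then have "(\<bar>z $ i * z $ j\<bar> / (norm z)\<^sup>2) * \<bar>J (norm z)\<bar> \<le> 1 * \<bar>J (norm z)\<bar>"
            by (intro mult_right_mono) auto
          then show "\<bar>z $ i * z $ j * (J (norm z) / (norm z)\<^sup>2)\<bar> \<le> \<bar>J (norm z)\<bar>"
            by (simp add: abs_mult)
        qed
        have "((\<lambda>z::real^2. J (norm z)) \<longlongrightarrow> J (norm (0::real^2))) (at 0 within ball 0 L)"
          by (rule bspec[OF cnorm[OF J(1), unfolded continuous_on_def]]) (use L in simp)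
        then show "((\<lambda>z::real^2. \<bar>J (norm z)\<bar>) \<longlongrightarrow> 0) (at 0 within ball 0 L)"
          using J(2) by (intro tendsto_rabs_zero) simp
      qed simp
      then show ?thesis using True by (simp add: continuous_within)
    qed
  qed
  show ?thesis
    unfolding C2_partials_def
  proof (intro conjI allI ballI)
    fix i j :: 2
    show "continuous_on (ball 0 L) (\<lambda>z. (if i = j then K (norm z) else 0) + z $ i * z $ j * (J (norm z) / (norm z)\<^sup>2))"
    proof (rule continuous_on_add[OF _ c2])
      show "continuous_on (ball 0 L) (\<lambda>z::real^2. if i = j then K (norm z) else 0)"
        by (cases "i = j") (simp_all add: cnorm[OF K])
    qed
  next
    fix i :: 2
    show "continuous_on (ball 0 L) (\<lambda>z::real^2. K (norm z) * z $ i)"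
      by (intro continuous_intros cnorm K)
  qed (assumption | rule p1 p2 cnorm[OF H])+
qed

text \<open>The solid harmonic of degree \<open>k\<close>, in polar coordinates
  \<open>r ^ k * circ k c t\<close>; the power of \<open>r\<close> makes the angular factor smooth
  at the origin.\<close>

definition hpoly :: "nat \<Rightarrow> complex \<Rightarrow> real^2 \<Rightarrow> real" where
  "hpoly k c z = Re (c * Complex (z $ 1) (z $ 2) ^ k)"

text \<open>The coordinate direction as a complex number: differentiating along it multiplies the
  amplitude by it.\<close>

definition axis_unit :: "2 \<Rightarrow> complex" where
  "axis_unit i = (if i = 1 then 1 else \<i>)"

text \<open>Complex differentiation of the power in the direction \<open>axis_unit i\<close>. For
  \<open>k = 0\<close> the truncated \<open>k - 1\<close> is harmless because of the factor
  \<open>k\<close>.\<close>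

lemma has_partial_hpoly: "has_partial i (hpoly k c) z (k * hpoly (k - 1) (c * axis_unit i) z)"
proof -
  let ?w = "Complex (z $ 1) (z $ 2)"
  have "Complex ((z + t *\<^sub>R axis i 1) $ 1) ((z + t *\<^sub>R axis i 1) $ 2) = ?w + of_real t * axis_unit i" for t
    using exhaust_2[of i] by (auto simp: axis_unit_def axis_def complex_eq_iff)
  then have eq: "(\<lambda>t. hpoly k c (z + t *\<^sub>R axis i 1)) = (\<lambda>t. Re (c * (?w + of_real t * axis_unit i) ^ k))"
    by (simp add: hpoly_def)
  have "((\<lambda>s. c * (?w + s * axis_unit i) ^ k) has_field_derivative
      of_nat k * (c * axis_unit i * ?w ^ (k - 1))) (at (of_real 0))"
    by (auto intro!: derivative_eq_intros)
  from bounded_linear.has_vector_derivative[OF bounded_linear_Re has_vector_derivative_real_field[OF this]]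
  show ?thesis
    unfolding has_partial_def eq has_real_derivative_iff_has_vector_derivative
    by (simp add: hpoly_def)
qed

lemma continuous_on_hpoly: "continuous_on A (hpoly k c)"
proof -
  have "continuous_on A (\<lambda>z. Re (c * (of_real (z $ 1) + \<i> * of_real (z $ 2)) ^ k))"
    by (intro continuous_intros)
  then show ?thesis by (simp add: hpoly_def[abs_def] Complex_eq)
qed

lemma C2_partials_hpoly:
  "C2_partials U (hpoly k c) (\<lambda>i z. k * hpoly (k - 1) (c * axis_unit i) z)
    (\<lambda>i j z. k * (real (k - 1) * hpoly (k - 1 - 1) (c * axis_unit i * axis_unit j) z))"
proof -
  have "has_partial j (\<lambda>z. real k * hpoly (k - 1) (c * axis_unit i) z) z
      (k * (real (k - 1) * hpoly (k - 1 - 1) (c * axis_unit i * axis_unit j) z))" for i j z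
    using has_partial_mult[OF has_partial_const[of j "real k" z] has_partial_hpoly[of j "k - 1" "c * axis_unit i" z]]
    by simp
  then show ?thesis
    unfolding C2_partials_def
    using has_partial_hpoly
    by (auto intro!: continuous_intros continuous_on_hpoly)
qed

text \<open>Euler's relation for homogeneous functions; it turns the radial part of the gradient
  into a multiple of the polynomial.\<close>

lemma hpoly_euler:
  "z $ 1 * (k * hpoly (k - 1) (c * axis_unit 1) z) + z $ 2 * (k * hpoly (k - 1) (c * axis_unit 2) z) = k * hpoly k c z"
proof (cases k)
  case (Suc n)
  let ?w = "Complex (z $ 1) (z $ 2)"
  have "of_real (z $ 1) * (c * ?w ^ n) + of_real (z $ 2) * (c * \<i> * ?w ^ n) = c * ?w ^ Suc n"
    by (simp add: Complex_eq algebra_simps)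
  from arg_cong[OF this, of Re]
  have "z $ 1 * hpoly n c z + z $ 2 * hpoly n (c * \<i>) z = hpoly (Suc n) c z"
    by (simp add: hpoly_def)
  then show ?thesis using Suc by (simp add: axis_unit_def) (metis (no_types, opaque_lifting) distrib_left mult.left_commute)
qed simp

lemma hpoly_polar: "hpoly k c (polar r t) = r ^ k * circ k c t"
proof -
  have "Complex (r * cos t) (r * sin t) = of_real r * cis t" by (simp add: complex_eq_iff)
  then have eq: "c * Complex (r * cos t) (r * sin t) ^ k = of_real (r ^ k) * (c * cis (k * t))"
    by (simp add: power_mult_distrib Complex.DeMoivre)
  show ?thesis unfolding hpoly_def circ_def polar_component eq by simp
qed

section \<open>The meridian\<close>

text \<open>The meridian in terms of the distance \<open>r = L - t\<close> to the pole, \<open>f r = F (L - r)\<close> and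
  \<open>g r = G (L - r)\<close>; the limits at \<open>r = 0\<close> are what smoothness at the pole contributes.\<close>

locale meridian =
  fixes R L :: real and f g f1 g1 :: "real \<Rightarrow> real" and a :: real
  assumes L_pos: "0 < L" and f_L: "f L = R" and g_L: "g L = 0" and f_0: "f 0 = 0"
    and f_pos: "\<And>r. r \<in> {0<..L} \<Longrightarrow> 0 < f r"
    and f_cont: "continuous_on {0..L} f" and g_cont: "continuous_on {0..L} g"
    and f1_cont: "continuous_on {0<..<L} f1"
    and f_deriv: "\<And>r. r \<in> {0<..<L} \<Longrightarrow> (f has_real_derivative f1 r) (at r)"
    and g_deriv: "\<And>r. r \<in> {0<..<L} \<Longrightarrow> (g has_real_derivative g1 r) (at r)"
    and unit_speed: "\<And>r. r \<in> {0<..<L} \<Longrightarrow> (f1 r)\<^sup>2 + (g1 r)\<^sup>2 = 1"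
    and f_pole: "((\<lambda>r. (f r - r) / r ^ 3) \<longlongrightarrow> a) (at_right 0)"
    and f1_pole: "((\<lambda>r. (f1 r - 1) / r\<^sup>2) \<longlongrightarrow> 3 * a) (at_right 0)"
    and g_pole: "((\<lambda>r. (g r - g 0) / r) \<longlongrightarrow> 0) (at_right 0)"

text \<open>One statement for both parities, used with \<open>s = 1\<close> and
  \<open>s = - 1\<close>.\<close>

lemma even_imp_deriv_odd:
  fixes b b' :: "real \<Rightarrow> real"
  assumes "\<And>x. x \<in> {- L<..<L} \<Longrightarrow> (b has_real_derivative b' x) (at x)"
    and "\<And>x. x \<in> {- L<..<L} \<Longrightarrow> b (- x) = s * b x" and x: "x \<in> {- L<..<L}"
  shows "b' (- x) = - s * b' x"
proof -
  have "((\<lambda>x. b (- x)) has_real_derivative - b' (- x)) (at x)"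
    using DERIV_mirror[of b "b' (- x)" x] assms(1)[of "- x"] x by simp
  moreover have "((\<lambda>x. s * b x) has_real_derivative s * b' x) (at x)"
    by (intro DERIV_cmult assms(1) x)
  then have "((\<lambda>x. b (- x)) has_real_derivative s * b' x) (at x)"
    by (rule has_field_derivative_transform_within_open[of _ _ _ "{- L<..<L}"]) (use assms x in auto)
  ultimately have "- b' (- x) = s * b' x" by (rule DERIV_unique)
  then show ?thesis by simp
qed

text \<open>Smoothness at the pole is read off the diameter of the parameter disc along the first
  axis. There the first component is the odd extension of \<open>f\<close> and the third the even
  extension of \<open>g\<close>, and both are smooth. Parity removes the second derivative of
  \<open>f\<close> and the first derivative of \<open>g\<close> at the pole, unit speed then gives
  slope 1 for \<open>f\<close>, and l'Hopital's rule yields the limits.\<close>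

lemma surface_of_revolution_meridian:
  assumes S: "surface_of_revolution R L F G"
  obtains f1 g1 a where "meridian R L (\<lambda>r. F (L - r)) (\<lambda>r. G (L - r)) f1 g1 a"
proof -
  define f g where "f r = F (L - r)" and "g r = G (L - r)" for r
  from S have L: "0 < L" and F0: "F 0 = R" "G 0 = 0" "F L = 0"
    and Fpos: "\<And>t. t \<in> {0..<L} \<Longrightarrow> 0 < F t"
    and sm: "smooth_on (cball 0 L) (revolve L F G)"
    by (auto simp: surface_of_revolution_def)
  from S obtain F' G' where FG: "\<And>t. t \<in> {0..L} \<Longrightarrow> (F has_real_derivative F' t) (at t within {0..L})"
    "\<And>t. t \<in> {0..L} \<Longrightarrow> (G has_real_derivative G' t) (at t within {0..L})"
    "\<And>t. t \<in> {0..L} \<Longrightarrow> (F' t)\<^sup>2 + (G' t)\<^sup>2 = 1"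
    unfolding surface_of_revolution_def by blast
  from sm obtain U X where U: "open U" "cball 0 L \<subseteq> U" and X: "\<And>k. Ck_on k U X"
    and XX: "\<And>z. z \<in> cball 0 L \<Longrightarrow> X z = revolve L F G z"
    unfolding smooth_on_def by blast
  let ?e = "axis 1 1 :: real^2"
  define d where "d n = ((partial_deriv ?e) ^^ n) X" for n
  have e: "?e \<in> Basis" by (auto simp: Basis_vec2)
  have dC: "Ck_on k U (d n)" for k n
  proof (induction n arbitrary: k)
    case 0
    then show ?case using X by (simp add: d_def)
  next
    case (Suc n)
    show ?case using Suc[of "Suc k"] e by (simp add: d_def)
  qed
  define V where "V = {x. x *\<^sub>R ?e \<in> U}"
  have V: "{- L..L} \<subseteq> V"
  proof
    fix x assume "x \<in> {- L..L}"
    then have "x *\<^sub>R ?e \<in> cball 0 L" by auto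
    then show "x \<in> V" using U(2) by (auto simp: V_def)
  qed
  have dd: "((\<lambda>x. d n (x *\<^sub>R ?e)) has_vector_derivative d (Suc n) (x *\<^sub>R ?e)) (at x)" if "x \<in> V" for n x
  proof -
    have "(\<lambda>t. d n (x *\<^sub>R ?e + t *\<^sub>R ?e)) differentiable (at 0)"
      using dC[of "Suc 0" n] e that by (auto simp: V_def)
    then have "((\<lambda>t. d n (x *\<^sub>R ?e + t *\<^sub>R ?e)) has_vector_derivative d (Suc n) (x *\<^sub>R ?e)) (at 0)"
      by (simp add: vector_derivative_works d_def partial_deriv_def)
    then have "((\<lambda>t. d n (x *\<^sub>R ?e + t *\<^sub>R ?e)) has_vector_derivative d (Suc n) (x *\<^sub>R ?e)) (at (- x + x))"
      by simp
    moreover have "((\<lambda>s. - x + s) has_vector_derivative 1) (at x)"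
      unfolding has_real_derivative_iff_has_vector_derivative[symmetric]
      by (auto intro!: derivative_eq_intros)
    ultimately
    have "((\<lambda>t. d n (x *\<^sub>R ?e + t *\<^sub>R ?e)) \<circ> (\<lambda>s. - x + s) has_vector_derivative d (Suc n) (x *\<^sub>R ?e)) (at x)"
      using vector_diff_chain_at by fastforce
    then show ?thesis by (simp add: o_def scaleR_add_left[symmetric])
  qed
  \<comment> \<open>Derivatives of order \<open>n\<close> of the first and third components along
    the diameter, with the pole in the middle.\<close>
  define p where "p n x = d n (x *\<^sub>R ?e) $ 1" for n x
  define b where "b n x = d n (x *\<^sub>R ?e) $ 3" for n x
  have dp: "(p n has_real_derivative p (Suc n) x) (at x)" "(b n has_real_derivative b (Suc n) x) (at x)"
    if "x \<in> {- L..L}" for n x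
    unfolding p_def[abs_def] b_def[abs_def] has_real_derivative_iff_has_vector_derivative
    using bounded_linear.has_vector_derivative[OF bounded_linear_vec_nth dd[of x n]] V that by auto
  have cp: "continuous_on {- L..L} (p n)" "continuous_on {- L..L} (b n)" for n
    by (intro continuous_at_imp_continuous_on ballI DERIV_isCont[OF dp(1)] DERIV_isCont[OF dp(2)]; simp)+
  have val: "p 0 x = F (L - \<bar>x\<bar>) * (x / \<bar>x\<bar>)" "b 0 x = G (L - \<bar>x\<bar>)" if "x \<in> {- L..L}" for x
  proof -
    have "x *\<^sub>R ?e \<in> cball 0 L" using that by auto
    from XX[OF this] have "d 0 (x *\<^sub>R ?e) = revolve L F G (x *\<^sub>R ?e)" by (simp add: d_def)
    moreover have comp: "?e $ 1 = 1" "?e $ 2 = 0" by (simp_all add: axis_def)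
    moreover have "norm (x *\<^sub>R ?e) = \<bar>x\<bar>" by simp
    ultimately show "p 0 x = F (L - \<bar>x\<bar>) * (x / \<bar>x\<bar>)" "b 0 x = G (L - \<bar>x\<bar>)"
      using comp by (simp_all add: p_def b_def revolve_def vector_3)
  qed
  have pf: "p 0 r = f r" if "r \<in> {0..L}" for r
    using val(1)[of r] that F0 L by (cases "r = 0") (auto simp: f_def)
  have bg: "b 0 r = g r" if "r \<in> {0..L}" for r
    using val(2)[of r] that L by (auto simp: g_def)
  have odd: "p 0 (- x) = - 1 * p 0 x" "b 0 (- x) = 1 * b 0 x" if "x \<in> {- L<..<L}" for x
    using val[of x] val[of "- x"] that by auto
  have p1_even: "p 1 (- x) = 1 * p 1 x" if "x \<in> {- L<..<L}" for x
    using even_imp_deriv_odd[of L "p 0" "p 1" "- 1" x] dp(1)[of _ 0] odd(1) that by auto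
  have "p 2 (- 0) = - 1 * p 2 0"
    by (rule even_imp_deriv_odd[of L "p 1" "p 2"]) (use dp(1)[of _ 1] p1_even L in \<open>auto simp: numeral_2_eq_2\<close>)
  then have p2_0: "p 2 0 = 0" by simp
  have "b 1 (- 0) = - 1 * b 1 0"
    by (rule even_imp_deriv_odd[of L "b 0" "b 1"]) (use dp(2)[of _ 0] odd(2) L in auto)
  then have b1_0: "b 1 0 = 0" by simp
  have f_deriv: "(f has_real_derivative p 1 r) (at r)" if "r \<in> {0<..<L}" for r
  proof -
    have "(p 0 has_real_derivative p 1 r) (at r)" using dp(1)[of r 0] that by simp
    then show ?thesis
      by (rule has_field_derivative_transform_within_open[of _ _ _ "{0<..<L}"]) (use that pf in auto)
  qed
  have g_deriv: "(g has_real_derivative b 1 r) (at r)" if "r \<in> {0<..<L}" for r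
  proof -
    have "(b 0 has_real_derivative b 1 r) (at r)" using dp(2)[of r 0] that by simp
    then show ?thesis
      by (rule has_field_derivative_transform_within_open[of _ _ _ "{0<..<L}"]) (use that bg in auto)
  qed
  have unit: "(p 1 r)\<^sup>2 + (b 1 r)\<^sup>2 = 1" if r: "r \<in> {0<..<L}" for r
  proof -
    have t: "L - r \<in> {0..L}" "at (L - r) within {0..L} = at (L - r)"
      using r by (auto intro!: at_within_interior)
    have FG': "(F has_real_derivative F' (L - r)) (at (L - r))" "(G has_real_derivative G' (L - r)) (at (L - r))"
      using FG(1,2)[OF t(1)] unfolding t(2) by auto
    have s: "((\<lambda>r. L - r) has_real_derivative - 1) (at r)" by (auto intro!: derivative_eq_intros)
    have "(f has_real_derivative F' (L - r) * (- 1)) (at r)" "(g has_real_derivative G' (L - r) * (- 1)) (at r)"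
      unfolding f_def g_def by (rule DERIV_chain2[OF FG'(1) s], rule DERIV_chain2[OF FG'(2) s])
    then have "p 1 r = - F' (L - r)" "b 1 r = - G' (L - r)"
      using DERIV_unique[OF f_deriv[OF r]] DERIV_unique[OF g_deriv[OF r]] by auto
    then show ?thesis using FG(3)[OF t(1)] by simp
  qed
  have rt: "(p n \<longlongrightarrow> p n 0) (at_right 0)" "(b n \<longlongrightarrow> b n 0) (at_right 0)" for n
  proof -
    have "isCont (p n) 0" "isCont (b n) 0" using dp[of 0 n] L by (auto intro: DERIV_isCont)
    then show "(p n \<longlongrightarrow> p n 0) (at_right 0)" "(b n \<longlongrightarrow> b n 0) (at_right 0)"
      unfolding isCont_def by (auto intro: tendsto_within_subset)
  qed
  have ev: "\<forall>\<^sub>F r in at_right 0. r \<in> {0<..<L}"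
    using L eventually_at_right_real by blast
  \<comment> \<open>Unit speed passes to the limit at the pole, where \<open>b 1 0 = 0\<close>; the
    sign of \<open>p 1 0\<close> then comes from positivity of \<open>f\<close>.\<close>
  have "((\<lambda>r. (p 1 r)\<^sup>2 + (b 1 r)\<^sup>2) \<longlongrightarrow> (p 1 0)\<^sup>2 + (b 1 0)\<^sup>2) (at_right 0)"
    by (intro tendsto_intros rt)
  moreover have "((\<lambda>r. (p 1 r)\<^sup>2 + (b 1 r)\<^sup>2) \<longlongrightarrow> 1) (at_right 0)"
    by (rule tendsto_eventually) (use ev unit in \<open>auto elim: eventually_mono\<close>)
  ultimately have "(p 1 0)\<^sup>2 + (b 1 0)\<^sup>2 = 1"
    by (rule tendsto_unique[rotated]) simp
  then have "p 1 0 = 1 \<or> p 1 0 = - 1" using b1_0 by (simp add: power2_eq_1_iff)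
  moreover have slope: "((\<lambda>r. (q 0 r - q 0 0) / r) \<longlongrightarrow> q 1 0) (at_right 0)"
    if "(q 0 has_real_derivative q 1 0) (at 0)" for q :: "nat \<Rightarrow> real \<Rightarrow> real"
    using that by (auto simp: DERIV_def intro: tendsto_within_subset)
  have "0 \<le> p 1 0"
  proof (rule tendsto_lowerbound[OF slope])
    show "(p 0 has_real_derivative p 1 0) (at 0)" using dp(1)[of 0 0] L by simp
    show "\<forall>\<^sub>F r in at_right 0. 0 \<le> (p 0 r - p 0 0) / r"
      using ev
    proof eventually_elim
      case (elim r)
      then show ?case using pf[of r] pf[of 0] Fpos[of "L - r"] F0 by (auto simp: f_def)
    qed
  qed simp
  ultimately have p1_0: "p 1 0 = 1" by auto
  have p3: "((\<lambda>r. p 2 r / (2 * r)) \<longlongrightarrow> p 3 0 / 2) (at_right 0)"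
  proof -
    have "(p 2 has_real_derivative p 3 0) (at 0)" using dp(1)[of 0 2] L by (simp add: numeral_3_eq_3 numeral_2_eq_2)
    then have "((\<lambda>r. p 2 r / r) \<longlongrightarrow> p 3 0) (at_right 0)"
      using p2_0 by (auto simp: DERIV_def intro: tendsto_within_subset)
    from tendsto_divide[OF this tendsto_const[of 2]] show ?thesis by (simp add: mult.commute)
  qed
  have lim1: "((\<lambda>r. (p 1 r - 1) / r\<^sup>2) \<longlongrightarrow> p 3 0 / 2) (at_right 0)"
  proof (rule lhopital_right_0[OF _ _ _ _ _ _ p3])
    show "((\<lambda>r. p 1 r - 1) \<longlongrightarrow> 0) (at_right 0)"
      using tendsto_diff[OF rt(1)[of 1] tendsto_const[of 1]] p1_0 by simp
    show "((\<lambda>r::real. r\<^sup>2) \<longlongrightarrow> 0) (at_right 0)" by (rule tendsto_eq_intros refl | simp)+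
    show "\<forall>\<^sub>F r::real in at_right 0. r\<^sup>2 \<noteq> 0" "\<forall>\<^sub>F r::real in at_right 0. 2 * r \<noteq> 0"
      by (auto simp: eventually_at_filter)
    show "\<forall>\<^sub>F r in at_right 0. ((\<lambda>r. p 1 r - 1) has_real_derivative p 2 r) (at r)"
      using ev by eventually_elim (use dp(1)[of _ 1] in \<open>auto intro!: derivative_eq_intros simp: numeral_2_eq_2\<close>)
    show "\<forall>\<^sub>F r::real in at_right 0. ((\<lambda>r. r\<^sup>2) has_real_derivative 2 * r) (at r)"
      by (auto intro!: always_eventually derivative_eq_intros)
  qed
  \<comment> \<open>The constant \<open>a\<close> of the locale is the third Taylor coefficient of
    the odd extension.\<close>
  have lim0: "((\<lambda>r. (p 0 r - r) / r ^ 3) \<longlongrightarrow> p 3 0 / 6) (at_right 0)"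
  proof (rule lhopital_right_0)
    show "((\<lambda>r. (p 1 r - 1) / (3 * r\<^sup>2)) \<longlongrightarrow> p 3 0 / 6) (at_right 0)"
      using tendsto_divide[OF lim1 tendsto_const[of 3]] by (simp add: mult.commute)
    show "((\<lambda>r. p 0 r - r) \<longlongrightarrow> 0) (at_right 0)"
      using tendsto_diff[OF rt(1)[of 0] tendsto_ident_at[of 0 "{0<..}"]] pf[of 0] F0 L by (simp add: f_def)
    show "((\<lambda>r::real. r ^ 3) \<longlongrightarrow> 0) (at_right 0)" by (rule tendsto_eq_intros refl | simp)+
    show "\<forall>\<^sub>F r::real in at_right 0. r ^ 3 \<noteq> 0" "\<forall>\<^sub>F r::real in at_right 0. 3 * r\<^sup>2 \<noteq> 0"
      by (auto simp: eventually_at_filter)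
    show "\<forall>\<^sub>F r in at_right 0. ((\<lambda>r. p 0 r - r) has_real_derivative p 1 r - 1) (at r)"
      using ev by eventually_elim (use dp(1)[of _ 0] in \<open>auto intro!: derivative_eq_intros\<close>)
    show "\<forall>\<^sub>F r::real in at_right 0. ((\<lambda>r. r ^ 3) has_real_derivative 3 * r\<^sup>2) (at r)"
      by (auto intro!: always_eventually derivative_eq_intros)
  qed
  have cong: "(h \<longlongrightarrow> l) (at_right 0)" if "(h' \<longlongrightarrow> l) (at_right 0)" "\<And>r. r \<in> {0<..<L} \<Longrightarrow> h' r = h r"
    for h h' :: "real \<Rightarrow> real" and l
    using Lim_transform_eventually[OF that(1)] ev that(2) by (metis (mono_tags, lifting) eventually_mono)
  have "meridian R L f g (p 1) (b 1) (p 3 0 / 6)"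
  proof
    show "continuous_on {0..L} f"
      using continuous_on_cong[of "{0..L}" "{0..L}" "p 0" f] pf continuous_on_subset[OF cp(1)[of 0], of "{0..L}"] by auto
    show "continuous_on {0..L} g"
      using continuous_on_cong[of "{0..L}" "{0..L}" "b 0" g] bg continuous_on_subset[OF cp(2)[of 0], of "{0..L}"] by auto
    show "continuous_on {0<..<L} (p 1)"
      by (rule continuous_on_subset[OF cp(1)]) auto
    show "((\<lambda>r. (f r - r) / r ^ 3) \<longlongrightarrow> p 3 0 / 6) (at_right 0)"
      by (rule cong[OF lim0]) (use pf in auto)
    show "((\<lambda>r. (p 1 r - 1) / r\<^sup>2) \<longlongrightarrow> 3 * (p 3 0 / 6)) (at_right 0)"
      using lim1 by simp
    have "((\<lambda>r. (b 0 r - b 0 0) / r) \<longlongrightarrow> b 1 0) (at_right 0)"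
      using slope[of b] dp(2)[of 0 0] L by simp
    then show "((\<lambda>r. (g r - g 0) / r) \<longlongrightarrow> 0) (at_right 0)"
      unfolding b1_0 by (rule cong) (use bg L in auto)
  qed (use L F0 Fpos f_deriv g_deriv unit in \<open>auto simp: f_def g_def\<close>)
  then show ?thesis using that unfolding f_def g_def by blast
qed

section \<open>Conformal parametrization by the disc\<close>

lemma continuous_on_extend_zero:
  fixes h :: "real \<Rightarrow> real"
  assumes S: "S \<subseteq> {0..}" and cont: "continuous_on (S - {0}) h" and lim: "(h \<longlongrightarrow> h 0) (at_right 0)"
  shows "continuous_on S h"
  unfolding continuous_on_eq_continuous_within
proof
  fix r assume r: "r \<in> S"
  show "continuous (at r within S) h"
  proof (cases "r = 0")
    case True
    have "(h \<longlongrightarrow> h 0) (at 0 within S - {0})"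
      by (rule tendsto_within_subset[OF lim]) (use S in auto)
    moreover have "at 0 within S = at (0::real) within S - {0}" by (simp add: at_within_def)
    ultimately show ?thesis using True by (simp add: continuous_within)
  next
    case False
    have "continuous (at r within S - {0}) h"
      using cont r False by (simp add: continuous_on_eq_continuous_within)
    moreover have "at r within S = at r within S - {0}"
      by (rule at_within_nhd[of r "- {0}"]) (use False in auto)
    ultimately show ?thesis by simp
  qed
qed

section \<open>Conformal radius and conformal weight\<close>

context meridian
begin

text \<open>The cubic Taylor remainder in \<open>f r = r + r ^ 3 * om r\<close>, extended
  continuously to the pole.\<close>

definition om :: "real \<Rightarrow> real" where
  "om r = (if r = 0 then a else (f r - r) / r ^ 3)"

text \<open>\<open>q r = f r / r\<close>, with the value 1 at the pole.\<close>

definition q :: "real \<Rightarrow> real" where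
  "q r = 1 + r\<^sup>2 * om r"

lemma f_eq: "f r = r * q r"
proof (cases "r = 0")
  case False
  then have "r * (r\<^sup>2 * ((f r - r) / r ^ 3)) = f r - r" by (simp add: power2_eq_square power3_eq_cube)
  with False show ?thesis by (simp add: q_def om_def distrib_left)
qed (simp add: f_0)

lemma q_0 [simp]: "q 0 = 1"
  by (simp add: q_def)

lemma q_pos:
  assumes "r \<in> {0..L}"
  shows "0 < q r"
proof (cases "r = 0")
  case False
  with assms have "0 < f r" by (intro f_pos) auto
  also have "f r = r * q r" by (rule f_eq)
  finally have "0 < r * q r" .
  then show ?thesis using assms False by (simp add: zero_less_mult_iff)
qed simp

lemma q_nonzero: "r \<in> {0..L} \<Longrightarrow> q r \<noteq> 0"
  using q_pos[of r] by simp

lemma continuous_on_om: "continuous_on {0..L} om"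
proof (rule continuous_on_extend_zero)
  have "continuous_on ({0..L} - {0}) (\<lambda>r. (f r - r) / r ^ 3)"
    by (intro continuous_intros continuous_on_subset[OF f_cont]) auto
  then show "continuous_on ({0..L} - {0}) om"
    by (rule continuous_on_eq) (auto simp: om_def)
  have "(om \<longlongrightarrow> a) (at_right 0)"
    by (rule Lim_transform_eventually[OF f_pole]) (auto simp: om_def eventually_at_filter)
  then show "(om \<longlongrightarrow> om 0) (at_right 0)" by (simp add: om_def)
qed auto

text \<open>The limit \<open>3 * a\<close> in \<open>f1_pole\<close> cancels three times the limit
  of \<open>om\<close>, so \<open>r\<close> times the derivative of \<open>om\<close> tends to 0 at
  the pole.\<close>

lemma euler_om: "euler_deriv L om (\<lambda>r. if r = 0 then 0 else (f1 r - 1) / r\<^sup>2 - 3 * om r)"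
  unfolding euler_deriv_def
proof (intro conjI ballI)
  show "continuous_on {0..<L} om" by (rule continuous_on_subset[OF continuous_on_om]) auto
  show "continuous_on {0..<L} (\<lambda>r. if r = 0 then 0 else (f1 r - 1) / r\<^sup>2 - 3 * om r)"
  proof (rule continuous_on_extend_zero)
    have "continuous_on ({0..<L} - {0}) (\<lambda>r. (f1 r - 1) / r\<^sup>2 - 3 * om r)"
      by (intro continuous_intros continuous_on_subset[OF f1_cont] continuous_on_subset[OF continuous_on_om]) auto
    then show "continuous_on ({0..<L} - {0}) (\<lambda>r. if r = 0 then 0 else (f1 r - 1) / r\<^sup>2 - 3 * om r)"
      by (rule continuous_on_eq) auto
    have "((\<lambda>r. (f1 r - 1) / r\<^sup>2 - 3 * ((f r - r) / r ^ 3)) \<longlongrightarrow> 3 * a - 3 * a) (at_right 0)"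
      by (intro tendsto_intros f_pole f1_pole)
    then have "((\<lambda>r. (f1 r - 1) / r\<^sup>2 - 3 * ((f r - r) / r ^ 3)) \<longlongrightarrow> 0) (at_right 0)" by simp
    then show "((\<lambda>r. if r = 0 then 0 else (f1 r - 1) / r\<^sup>2 - 3 * om r) \<longlongrightarrow>
        (if 0 = (0::real) then 0 else (f1 0 - 1) / 0\<^sup>2 - 3 * om 0)) (at_right 0)"
      by (simp, elim Lim_transform_eventually) (auto simp: om_def eventually_at_filter)
  qed auto
  fix r assume r: "r \<in> {0<..<L}"
  have "((\<lambda>r. (f r - r) / r ^ 3) has_real_derivative
      ((f1 r - 1) * r ^ 3 - (f r - r) * (3 * r\<^sup>2)) / (r ^ 3 * r ^ 3)) (at r)"
    by (rule DERIV_divide) (use r in \<open>auto intro!: derivative_eq_intros f_deriv\<close>)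
  also have "((f1 r - 1) * r ^ 3 - (f r - r) * (3 * r\<^sup>2)) / (r ^ 3 * r ^ 3) =
      ((f1 r - 1) / r\<^sup>2 - 3 * ((f r - r) / r ^ 3)) / r"
    using r by (simp add: field_simps power2_eq_square power3_eq_cube)
  finally have "((\<lambda>r. (f r - r) / r ^ 3) has_real_derivative
      ((f1 r - 1) / r\<^sup>2 - 3 * ((f r - r) / r ^ 3)) / r) (at r)" .
  then have "(om has_real_derivative ((f1 r - 1) / r\<^sup>2 - 3 * ((f r - r) / r ^ 3)) / r) (at r)"
    by (rule has_field_derivative_transform_within_open[of _ _ _ "{0<..<L}"]) (use r in \<open>auto simp: om_def\<close>)
  then show "(om has_real_derivative (if r = 0 then 0 else (f1 r - 1) / r\<^sup>2 - 3 * om r) / r) (at r)"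
    using r by (simp add: om_def)
qed simp

lemma continuous_on_q: "continuous_on {0..L} q"
  unfolding q_def by (intro continuous_intros continuous_on_om)

lemma euler_q: "\<exists>J. euler_deriv L q J"
  unfolding q_def[abs_def]
  by (rule exI, rule euler_deriv_add[OF euler_deriv_const euler_deriv_mult[OF euler_deriv_power2 euler_om]])

lemma DERIV_q:
  assumes "r \<in> {0<..<L}"
  shows "(q has_real_derivative (f1 r - q r) / r) (at r)"
proof -
  have "((\<lambda>r. f r / r) has_real_derivative (f1 r * r - f r * 1) / (r * r)) (at r)"
    by (rule DERIV_divide) (use assms f_deriv in auto)
  also have "(f1 r * r - f r * 1) / (r * r) = (f1 r - q r) / r"
    using assms by (simp add: f_eq field_simps)
  finally show ?thesis
    by (rule has_field_derivative_transform_within_open[of _ _ _ "{0<..<L}"])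
      (use assms in \<open>auto simp: f_eq\<close>)
qed

text \<open>For \<open>r > 0\<close>, \<open>r * chi r\<close> is \<open>1 / f r - 1 / r\<close>:
  what is left of the logarithmic derivative of \<open>rho\<close> once its singular part is split
  off. Expressed through \<open>om\<close> it is regular at the pole.\<close>

definition chi :: "real \<Rightarrow> real" where
  "chi r = - om r * inverse (q r)"

lemma one_plus_chi: "r \<in> {0..L} \<Longrightarrow> 1 + r\<^sup>2 * chi r = inverse (q r)"
proof -
  assume "r \<in> {0..L}"
  then have "q r \<noteq> 0" by (rule q_nonzero)
  then have "inverse (q r) * q r = 1" by simp
  moreover have "q r = 1 + r\<^sup>2 * om r" by (rule q_def)
  ultimately show ?thesis unfolding chi_def by algebra
qed

lemma continuous_on_chi: "continuous_on {0..L} chi"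
  unfolding chi_def
  by (intro continuous_intros continuous_on_om continuous_on_q ballI q_nonzero)

lemma euler_inverse_q: "\<exists>J. euler_deriv L (\<lambda>r. inverse (q r)) J"
proof -
  obtain J where "euler_deriv L q J" using euler_q by blast
  then have "euler_deriv L (\<lambda>r. inverse (q r)) (\<lambda>r. - J r * (inverse (q r))\<^sup>2)"
    by (rule euler_deriv_inverse) (rule q_nonzero, simp)
  then show ?thesis by blast
qed

lemma euler_chi: "\<exists>J. euler_deriv L chi J"
proof -
  obtain J where "euler_deriv L (\<lambda>r. inverse (q r)) J" using euler_inverse_q by blast
  from euler_deriv_mult[OF euler_deriv_mult[OF euler_deriv_const[of L "- 1"] euler_om] this]
  show ?thesis unfolding chi_def[abs_def] by auto
qed

text \<open>\<open>rho = r * eta\<close> is the radial part of the conformal map of the surface onto the disc of radius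
  \<open>R\<close>: it solves \<open>rho' / rho = 1 / f\<close> with \<open>rho L = R\<close>.\<close>

definition eta :: "real \<Rightarrow> real" where
  "eta r = R / L * exp (- integral {r..L} (\<lambda>t. t * chi t))"

definition rho :: "real \<Rightarrow> real" where
  "rho r = r * eta r"

lemma R_pos: "0 < R"
  using f_pos[of L] L_pos f_L by auto

lemma eta_pos: "0 < eta r"
  using R_pos L_pos by (simp add: eta_def)

lemma eta_nonzero: "eta r \<noteq> 0"
  using eta_pos[of r] by simp

lemma eta_L: "eta L = R / L"
  by (simp add: eta_def)

lemma DERIV_eta_within:
  assumes "r \<in> {0..L}"
  shows "(eta has_real_derivative r * chi r * eta r) (at r within {0..L})"
proof -
  have "continuous_on {0..L} (\<lambda>t. t * chi t)" by (intro continuous_intros continuous_on_chi)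
  from DERIV_minus[OF integral_has_real_derivative'[OF this assms]]
  have "((\<lambda>r. - integral {r..L} (\<lambda>t. t * chi t)) has_real_derivative r * chi r) (at r within {0..L})"
    by simp
  from DERIV_cmult[OF DERIV_chain2[OF DERIV_exp this], of "R / L"] show ?thesis
    unfolding eta_def[abs_def] by (simp only: mult_ac)
qed

lemma continuous_on_eta: "continuous_on {0..L} eta"
  by (rule DERIV_continuous_on[OF DERIV_eta_within])

lemma DERIV_eta: "r \<in> {0<..<L} \<Longrightarrow> (eta has_real_derivative r * chi r * eta r) (at r)"
  using DERIV_eta_within[of r] at_within_interior[of r "{0..L}"] by auto

lemma euler_eta: "euler_deriv L eta (\<lambda>r. r\<^sup>2 * chi r * eta r)"
  unfolding euler_deriv_def
proof (intro conjI ballI)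
  show "continuous_on {0..<L} eta" by (rule continuous_on_subset[OF continuous_on_eta]) auto
  show "continuous_on {0..<L} (\<lambda>r. r\<^sup>2 * chi r * eta r)"
    by (intro continuous_intros continuous_on_subset[OF continuous_on_eta] continuous_on_subset[OF continuous_on_chi]) auto
  show "(eta has_real_derivative r\<^sup>2 * chi r * eta r / r) (at r)" if "r \<in> {0<..<L}" for r
    using DERIV_eta[OF that] that by (simp add: power2_eq_square mult.assoc)
qed simp

lemma DERIV_rho:
  assumes "r \<in> {0<..<L}"
  shows "(rho has_real_derivative eta r * inverse (q r)) (at r)"
proof -
  have "(rho has_real_derivative eta r * (1 + r\<^sup>2 * chi r)) (at r)"
    unfolding rho_def[abs_def]
    by (rule DERIV_cong[OF DERIV_mult[OF DERIV_ident DERIV_eta[OF assms]]])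
      (simp add: algebra_simps power2_eq_square)
  then show ?thesis using one_plus_chi[of r] assms by simp
qed

lemma continuous_on_rho: "continuous_on {0..L} rho"
  unfolding rho_def by (intro continuous_intros continuous_on_eta)

lemma rho_0 [simp]: "rho 0 = 0"
  by (simp add: rho_def)

lemma rho_L [simp]: "rho L = R"
  using L_pos by (simp add: rho_def eta_L)

lemma rho_strict_mono:
  assumes "0 \<le> r" "r < s" "s \<le> L"
  shows "rho r < rho s"
proof (rule DERIV_pos_imp_increasing_open[OF assms(2)])
  fix x assume "r < x" "x < s"
  then have "x \<in> {0<..<L}" using assms by auto
  from DERIV_rho[OF this] eta_pos[of x] q_pos[of x] this
  show "\<exists>y. (rho has_real_derivative y) (at x) \<and> 0 < y"
    by (intro exI[of _ "eta x * inverse (q x)"]) auto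
qed (use assms in \<open>auto intro: continuous_on_subset[OF continuous_on_rho]\<close>)

lemma rho_in: "r \<in> {0..L} \<Longrightarrow> rho r \<in> {0..R}"
proof -
  assume r: "r \<in> {0..L}"
  have "0 \<le> rho r" using r rho_strict_mono[of 0 r] by (cases "r = 0") auto
  moreover have "rho r \<le> R" using r rho_strict_mono[of r L] by (cases "r = L") auto
  ultimately show ?thesis by simp
qed

lemma rho_in_open: "r \<in> {0<..<L} \<Longrightarrow> rho r \<in> {0<..<R}"
  using rho_strict_mono[of 0 r] rho_strict_mono[of r L] by auto

lemma inj_on_rho: "inj_on rho {0..L}"
proof (rule inj_onI)
  fix x y assume "x \<in> {0..L}" "y \<in> {0..L}" "rho x = rho y"
  then show "x = y" using rho_strict_mono[of x y] rho_strict_mono[of y x] by (cases x y rule: linorder_cases) auto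
qed

lemma rho_image: "rho ` {0..L} = {0..R}"
proof
  show "rho ` {0..L} \<subseteq> {0..R}" using rho_in by auto
  show "{0..R} \<subseteq> rho ` {0..L}"
  proof
    fix s assume "s \<in> {0..R}"
    then show "s \<in> rho ` {0..L}"
      using IVT'[of rho 0 s L] continuous_on_rho L_pos by auto
  qed
qed

text \<open>The square of \<open>f / rho\<close> as a function of the disc radius, hence the inverse
  of \<open>rho\<close>; written as \<open>q / eta\<close>, the quotient has a value at the pole as
  well.\<close>

definition Phi :: "real \<Rightarrow> real" where
  "Phi s = (let r = the_inv_into {0..L} rho s in (q r / eta r)\<^sup>2)"

lemma Phi_rho: "r \<in> {0..L} \<Longrightarrow> Phi (rho r) = (q r / eta r)\<^sup>2"
  by (simp add: Phi_def the_inv_into_f_f[OF inj_on_rho])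

lemma continuous_on_Phi: "continuous_on {0..R} Phi"
proof -
  have inv: "continuous_on {0..R} (the_inv_into {0..L} rho)"
    using continuous_on_inv_into[OF continuous_on_rho compact_Icc inj_on_rho] by (simp add: rho_image)
  have im: "the_inv_into {0..L} rho ` {0..R} \<subseteq> {0..L}"
    using the_inv_into_into[OF inj_on_rho _ subset_refl] by (auto simp: rho_image)
  have "continuous_on {0..L} (\<lambda>r. (q r / eta r)\<^sup>2)"
    by (intro continuous_intros continuous_on_q continuous_on_eta ballI eta_nonzero)
  from continuous_on_compose2[OF this inv im] show ?thesis
    by (simp add: Phi_def[abs_def] Let_def)
qed

sublocale W: radial_weight R Phi
  by unfold_locales (use R_pos continuous_on_Phi in \<open>auto simp: Phi_def Let_def\<close>)

section \<open>Monotonicity of the conformal factor\<close>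

lemma f1_le_1: "r \<in> {0<..<L} \<Longrightarrow> f1 r \<le> 1"
proof (rule power2_le_imp_le)
  assume "r \<in> {0<..<L}"
  from unit_speed[OF this] show "(f1 r)\<^sup>2 \<le> 1\<^sup>2"
    unfolding one_power2 using zero_le_power2[of "g1 r"] by linarith
qed simp

text \<open>Off the pole the quotient is \<open>f / rho\<close>, and \<open>rho' = rho / f\<close>
  turns its derivative into \<open>(f' - 1) / rho\<close>.\<close>

lemma DERIV_q_eta:
  assumes "r \<in> {0<..<L}"
  shows "((\<lambda>r. q r / eta r) has_real_derivative (f1 r - 1) / (r * eta r)) (at r)"
proof -
  have e: "eta r \<noteq> 0" "q r \<noteq> 0" using eta_pos[of r] q_pos[of r] assms by auto
  have c: "q r * (r\<^sup>2 * chi r) = 1 - q r"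
    using one_plus_chi[of r] e assms by (simp add: field_simps)
  have "((\<lambda>r. q r / eta r) has_real_derivative
      ((f1 r - q r) / r * eta r - q r * (r * chi r * eta r)) / (eta r * eta r)) (at r)"
    by (rule DERIV_divide[OF DERIV_q[OF assms] DERIV_eta[OF assms] e(1)])
  also have "((f1 r - q r) / r * eta r - q r * (r * chi r * eta r)) / (eta r * eta r) =
      ((f1 r - q r) - q r * (r\<^sup>2 * chi r)) / (r * eta r)"
    using assms e by (simp add: field_simps power2_eq_square)
  finally show ?thesis unfolding c by simp
qed

lemma continuous_on_q_eta: "continuous_on {0..L} (\<lambda>r. q r / eta r)"
  by (intro continuous_intros continuous_on_q continuous_on_eta ballI eta_nonzero)

lemma q_eta_antimono:
  assumes "0 \<le> r" "r \<le> s" "s \<le> L"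
  shows "q s / eta s \<le> q r / eta r"
proof (rule DERIV_nonpos_imp_decreasing_open[OF assms(2)])
  fix x assume "r < x" "x < s"
  then have x: "x \<in> {0<..<L}" using assms by auto
  have "(f1 x - 1) / (x * eta x) \<le> 0"
    using f1_le_1[OF x] x eta_pos[of x] by (intro divide_nonpos_pos mult_pos_pos) auto
  with DERIV_q_eta[OF x]
  show "\<exists>y. ((\<lambda>r. q r / eta r) has_real_derivative y) (at x) \<and> y \<le> 0" by blast
qed (use assms in \<open>auto intro: continuous_on_subset[OF continuous_on_q_eta]\<close>)

lemma q_eta_L: "q L / eta L = 1"
proof -
  have "q L = R / L" using f_eq[of L] f_L L_pos by (simp add: field_simps)
  then show ?thesis using L_pos R_pos by (simp add: eta_L)
qed

lemma q_eta_ge_1: "r \<in> {0..L} \<Longrightarrow> 1 \<le> q r / eta r"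
proof -
  assume "r \<in> {0..L}"
  then have "q L / eta L \<le> q r / eta r" by (intro q_eta_antimono) auto
  then show ?thesis by (simp only: q_eta_L)
qed

lemma Phi_ge_1: "s \<in> {0..R} \<Longrightarrow> 1 \<le> Phi s"
proof -
  assume "s \<in> {0..R}"
  then obtain r where r: "r \<in> {0..L}" "s = rho r" using rho_image by blast
  show ?thesis unfolding r(2) Phi_rho[OF r(1)] by (rule one_le_power[OF q_eta_ge_1[OF r(1)]])
qed

text \<open>Since the quotient is nonincreasing and at least 1, a single value different from 1
  forces values above 1 at all smaller radii.\<close>

lemma Phi_gt_1_near_0:
  assumes "r0 \<in> {0<..L}" "q r0 / eta r0 \<noteq> 1"
  shows "\<exists>d>0. \<forall>s\<in>{0<..<d}. 1 < Phi s"
proof (intro exI conjI ballI)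
  show "0 < rho r0" using rho_strict_mono[of 0 r0] assms by auto
  fix s assume s: "s \<in> {0<..<rho r0}"
  then have "s \<in> {0..R}" using rho_in[of r0] assms by auto
  then obtain r where r: "r \<in> {0..L}" "s = rho r" using rho_image by blast
  have "r < r0"
    using s r rho_strict_mono[of r0 r] assms by (cases "r = r0") (auto simp: not_less[symmetric] intro: ccontr)
  have "1 < q r / eta r"
  proof -
    have "q r0 / eta r0 \<le> q r / eta r"
      by (rule q_eta_antimono) (use \<open>r < r0\<close> r assms in auto)
    moreover have "1 \<le> q r0 / eta r0" by (rule q_eta_ge_1) (use assms in auto)
    ultimately show ?thesis using assms(2) by linarith
  qed
  then show "1 < Phi s" unfolding r(2) Phi_rho[OF r(1)] by (rule one_less_power) simp
qed

text \<open>A constant quotient forces \<open>f1 = 1\<close>, and unit speed then leaves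
  \<open>g1 = 0\<close>; the constants of integration come from \<open>f 0 = 0\<close> and
  \<open>g L = 0\<close>.\<close>

lemma flat_if_q_eta_1:
  assumes one: "\<And>r. r \<in> {0<..L} \<Longrightarrow> q r / eta r = 1"
  shows "L = R \<and> (\<forall>r\<in>{0..L}. f r = r \<and> g r = 0)"
proof -
  have f1: "f1 r = 1" if r: "r \<in> {0<..<L}" for r
  proof -
    have "((\<lambda>r. q r / eta r) has_real_derivative 0) (at r)"
    proof (rule has_field_derivative_transform_within_open[of "\<lambda>_. 1" _ _ "{0<..<L}"])
      show "1 = q x / eta x" if "x \<in> {0<..<L}" for x by (rule one[symmetric]) (use that in simp)
    qed (use r in auto)
    from DERIV_unique[OF this DERIV_q_eta[OF r]] r eta_pos[of r] show ?thesis by simp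
  qed
  have fr: "f r = r" if "r \<in> {0..L}" for r
  proof -
    have "f r - r = f 0 - 0"
    proof (rule DERIV_isconst2[where f = "\<lambda>r. f r - r" and b = L])
      show "((\<lambda>r. f r - r) has_real_derivative 0) (at x)" if "0 < x" "x < L" for x
        using that f1[of x] by (auto intro!: derivative_eq_intros f_deriv)
    qed (use that L_pos in \<open>auto intro!: continuous_intros f_cont\<close>)
    then show ?thesis using f_0 by simp
  qed
  have gr: "g r = 0" if "r \<in> {0..L}" for r
  proof -
    have c: "g r = g 0" if "r \<in> {0..L}" for r
    proof (rule DERIV_isconst2[where f = g and b = L])
      show "(g has_real_derivative 0) (at x)" if "0 < x" "x < L" for x
        using g_deriv[of x] unit_speed[of x] f1[of x] that by auto
    qed (use that L_pos in \<open>auto intro!: g_cont\<close>)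
    show ?thesis using c[OF that] c[of L] g_L L_pos by auto
  qed
  show ?thesis using fr[of L] f_L L_pos fr gr by auto
qed

text \<open>The disc mode at radius \<open>rho r\<close>, without the factor \<open>r ^ k\<close>,
  which \<open>hpoly\<close> will supply.\<close>

definition modeH :: "nat \<Rightarrow> real \<Rightarrow> real \<Rightarrow> real" where
  "modeH k \<mu> r = eta r ^ k * W.rad_sol k \<mu> (rho r)"

text \<open>The derivative of \<open>modeH\<close> divided by \<open>r\<close>, in a form that has a
  value at the pole.\<close>

definition modeK :: "nat \<Rightarrow> real \<Rightarrow> real \<Rightarrow> real" where
  "modeK k \<mu> r = eta r ^ k * (k * chi r * W.rad_sol k \<mu> (rho r)
    - \<mu> * (eta r)\<^sup>2 * W.rad_flux k \<mu> (rho r) * inverse (q r))"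

text \<open>The radial flux \<open>f * W'\<close> of \<open>W r = r ^ k * modeH k \<mu> r\<close>,
  divided by \<open>r ^ k\<close>.\<close>

definition modeN :: "nat \<Rightarrow> real \<Rightarrow> real \<Rightarrow> real" where
  "modeN k \<mu> r = q r * (k * modeH k \<mu> r + r\<^sup>2 * modeK k \<mu> r)"

lemma continuous_on_sol_rho: "continuous_on {0..L} (\<lambda>r. W.rad_sol k \<mu> (rho r))"
  "continuous_on {0..L} (\<lambda>r. W.rad_flux k \<mu> (rho r))" "continuous_on {0..L} (\<lambda>r. Phi (rho r))"
  using continuous_on_compose2[OF W.continuous_on_rad_sol continuous_on_rho]
    continuous_on_compose2[OF W.continuous_on_rad_flux continuous_on_rho]
    continuous_on_compose2[OF continuous_on_Phi continuous_on_rho] by (auto simp: rho_image)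

lemma euler_sol_rho: "\<exists>J. euler_deriv L (\<lambda>r. W.rad_sol k \<mu> (rho r)) J"
proof -
  have "euler_deriv L (\<lambda>r. W.rad_sol k \<mu> (rho r))
      (\<lambda>r. - \<mu> * (r\<^sup>2 * (eta r)\<^sup>2) * W.rad_flux k \<mu> (rho r) * inverse (q r))"
    unfolding euler_deriv_def
  proof (intro conjI ballI)
    show "continuous_on {0..<L} (\<lambda>r. W.rad_sol k \<mu> (rho r))"
      by (rule continuous_on_subset[OF continuous_on_sol_rho(1)]) auto
    have "continuous_on {0..L} (\<lambda>r. - \<mu> * (r\<^sup>2 * (eta r)\<^sup>2) * W.rad_flux k \<mu> (rho r) * inverse (q r))"
      by (intro continuous_intros continuous_on_sol_rho continuous_on_eta continuous_on_q ballI q_nonzero)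
    then show "continuous_on {0..<L} (\<lambda>r. - \<mu> * (r\<^sup>2 * (eta r)\<^sup>2) * W.rad_flux k \<mu> (rho r) * inverse (q r))"
      by (rule continuous_on_subset) auto
    fix r assume r: "r \<in> {0<..<L}"
    from DERIV_chain2[OF W.DERIV_rad_sol[OF rho_in_open[OF r]] DERIV_rho[OF r], of k \<mu>]
    show "((\<lambda>r. W.rad_sol k \<mu> (rho r)) has_real_derivative
        - \<mu> * (r\<^sup>2 * (eta r)\<^sup>2) * W.rad_flux k \<mu> (rho r) * inverse (q r) / r) (at r)"
      by (rule DERIV_cong) (use r in \<open>simp add: rho_def power2_eq_square mult_ac\<close>)
  qed simp
  then show ?thesis by blast
qed

lemma euler_flux_rho: "\<exists>J. euler_deriv L (\<lambda>r. W.rad_flux k \<mu> (rho r)) J"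
proof -
  let ?J = "\<lambda>r. (Phi (rho r) * W.rad_sol k \<mu> (rho r) - real (2 * k + 2) * W.rad_flux k \<mu> (rho r)) * inverse (q r)"
  have "euler_deriv L (\<lambda>r. W.rad_flux k \<mu> (rho r)) ?J"
    unfolding euler_deriv_def
  proof (intro conjI ballI)
    show "continuous_on {0..<L} (\<lambda>r. W.rad_flux k \<mu> (rho r))"
      by (rule continuous_on_subset[OF continuous_on_sol_rho(2)]) auto
    have "continuous_on {0..L} ?J"
      by (intro continuous_intros continuous_on_sol_rho continuous_on_q ballI q_nonzero)
    then show "continuous_on {0..<L} ?J"
      by (rule continuous_on_subset) auto
    show "?J 0 = 0" using W.rad_flux_0[of k \<mu>] by (simp add: W.rad_sol_0)
    fix r assume r: "r \<in> {0<..<L}"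
    from DERIV_chain2[OF W.DERIV_rad_flux[OF rho_in_open[OF r]] DERIV_rho[OF r], of k \<mu>]
    show "((\<lambda>r. W.rad_flux k \<mu> (rho r)) has_real_derivative ?J r / r) (at r)"
      by (rule DERIV_cong) (use r eta_pos[of r] in \<open>simp add: rho_def\<close>)
  qed
  then show ?thesis by blast
qed

lemma euler_modeK: "\<exists>J. euler_deriv L (modeK k \<mu>) J"
proof -
  obtain J1 J2 J3 J4 J5 J6 where J:
    "euler_deriv L (\<lambda>r. eta r ^ k) J1" "euler_deriv L chi J2"
    "euler_deriv L (\<lambda>r. W.rad_sol k \<mu> (rho r)) J3" "euler_deriv L (\<lambda>r. W.rad_flux k \<mu> (rho r)) J4"
    "euler_deriv L (\<lambda>r. inverse (q r)) J5" "euler_deriv L (\<lambda>r. (eta r)\<^sup>2) J6"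
    using euler_deriv_power[OF euler_eta] euler_chi euler_sol_rho euler_flux_rho euler_inverse_q by metis
  have 1: "euler_deriv L (\<lambda>r. real k * chi r * W.rad_sol k \<mu> (rho r))
      (\<lambda>r. (0 * chi r + real k * J2 r) * W.rad_sol k \<mu> (rho r) + real k * chi r * J3 r)"
    by (rule euler_deriv_mult[OF euler_deriv_mult[OF euler_deriv_const J(2)] J(3)])
  note 2 = euler_deriv_mult[OF euler_deriv_mult[OF euler_deriv_mult[OF euler_deriv_const[of L "- \<mu>"] J(6)] J(4)] J(5)]
  from euler_deriv_mult[OF J(1) euler_deriv_add[OF 1 2]]
  show ?thesis unfolding modeK_def[abs_def] by auto
qed

lemma continuous_on_modeH: "continuous_on {0..L} (modeH k \<mu>)"
  unfolding modeH_def by (intro continuous_intros continuous_on_eta continuous_on_sol_rho)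

lemma DERIV_modeH:
  assumes r: "r \<in> {0<..<L}"
  shows "(modeH k \<mu> has_real_derivative r * modeK k \<mu> r) (at r)"
proof -
  have p: "((\<lambda>r. eta r ^ k) has_real_derivative k * eta r ^ k * (r * chi r)) (at r)"
  proof -
    have "((\<lambda>r. eta r ^ k) has_real_derivative real k * (r * chi r * eta r * eta r ^ (k - Suc 0))) (at r)"
      by (rule DERIV_power[OF DERIV_eta[OF r]])
    moreover have "real k * (r * chi r * eta r * eta r ^ (k - Suc 0)) = k * eta r ^ k * (r * chi r)"
      by (cases k) auto
    ultimately show ?thesis by simp
  qed
  from DERIV_mult[OF p DERIV_chain2[OF W.DERIV_rad_sol[OF rho_in_open[OF r]] DERIV_rho[OF r], of k \<mu>]]
  show ?thesis
    unfolding modeH_def[abs_def]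
    by (rule DERIV_cong) (simp add: modeK_def rho_def power2_eq_square algebra_simps)
qed

text \<open>Conformality: \<open>f * d/dr\<close> equals \<open>rho * d/drho\<close>, so the flux on
  the surface is the flux on the disc.\<close>

lemma modeN_eq:
  assumes "r \<in> {0..L}"
  shows "modeN k \<mu> r = eta r ^ k * (k * W.rad_sol k \<mu> (rho r) - \<mu> * (rho r)\<^sup>2 * W.rad_flux k \<mu> (rho r))"
proof -
  have q: "q r \<noteq> 0" using q_pos[OF assms] by simp
  have "modeN k \<mu> r = eta r ^ k * (k * W.rad_sol k \<mu> (rho r) * (q r * (1 + r\<^sup>2 * chi r))
      - \<mu> * (r\<^sup>2 * (eta r)\<^sup>2) * W.rad_flux k \<mu> (rho r) * (q r * inverse (q r)))"
    unfolding modeN_def modeH_def modeK_def by (simp add: algebra_simps)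
  then show ?thesis
    unfolding one_plus_chi[OF assms] using q by (simp add: rho_def power_mult_distrib)
qed

text \<open>The separated equation of the surface with \<open>r ^ k\<close> divided out, inherited
  from the disc by the chain rule. The identity
  \<open>Phi (rho r) * (eta r)\<^sup>2 = (q r)\<^sup>2\<close> turns the weight of the disc into the
  length factor \<open>f r = r * q r\<close>.\<close>

lemma DERIV_modeN:
  assumes r: "r \<in> {0<..<L}"
  shows "(modeN k \<mu> has_real_derivative
    ((real k)\<^sup>2 / (r * q r) - \<mu> * r * q r) * modeH k \<mu> r - k * modeN k \<mu> r / r) (at r)"
proof -
  let ?s = "rho r"
  let ?v = "\<lambda>s. s ^ k * (real k * W.rad_sol k \<mu> s - \<mu> * s\<^sup>2 * W.rad_flux k \<mu> s)"
  have nz: "r \<noteq> 0" "eta r \<noteq> 0" "q r \<noteq> 0" using r eta_pos[of r] q_pos[of r] by auto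
  have eq: "modeN k \<mu> r = ?v (rho r) / r ^ k" if "r \<in> {0<..<L}" for r
    using that by (subst modeN_eq) (auto simp: rho_def power_mult_distrib)
  have p: "((\<lambda>r. r ^ k) has_real_derivative k * r ^ k / r) (at r)"
  proof -
    have "real k * r ^ (k - Suc 0) = k * r ^ k / r" using nz by (cases k) auto
    then show ?thesis using DERIV_pow[of k r UNIV] by simp
  qed
  have Ph: "Phi ?s * (eta r)\<^sup>2 = (q r)\<^sup>2"
    using Phi_rho[of r] r nz by (simp add: power_divide)
  have dv: "((\<lambda>r. ?v (rho r)) has_real_derivative
      (((real k)\<^sup>2 / ?s - \<mu> * ?s * Phi ?s) * (?s ^ k * W.rad_sol k \<mu> ?s)) * (eta r * inverse (q r))) (at r)"
    by (rule DERIV_chain2[OF W.rad_mode_derivs(2)[OF rho_in_open[OF r]] DERIV_rho[OF r]])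
  have c: "((real k)\<^sup>2 / ?s - \<mu> * ?s * Phi ?s) * (eta r * inverse (q r)) =
      (real k)\<^sup>2 / (r * q r) - \<mu> * r * q r"
  proof -
    have "((real k)\<^sup>2 / ?s - \<mu> * ?s * Phi ?s) * (eta r * inverse (q r)) =
        (real k)\<^sup>2 / (r * q r) - \<mu> * r * (Phi ?s * (eta r)\<^sup>2) / q r"
      using nz by (simp add: rho_def field_simps power2_eq_square)
    then show ?thesis unfolding Ph using nz by (simp add: power2_eq_square)
  qed
  have sk: "?s ^ k * W.rad_sol k \<mu> ?s = r ^ k * modeH k \<mu> r"
    by (simp add: modeH_def rho_def power_mult_distrib)
  have dv': "((\<lambda>r. ?v (rho r)) has_real_derivative
      ((real k)\<^sup>2 / (r * q r) - \<mu> * r * q r) * (r ^ k * modeH k \<mu> r)) (at r)"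
  proof -
    have "(C * S) * B = (C * B) * S" for C S B :: real by (simp only: mult_ac)
    from DERIV_cong[OF dv this] show ?thesis by (simp only: c sk)
  qed
  have "((\<lambda>r. ?v (rho r) / r ^ k) has_real_derivative
      (((real k)\<^sup>2 / (r * q r) - \<mu> * r * q r) * (r ^ k * modeH k \<mu> r) * r ^ k - ?v (rho r) * (k * r ^ k / r))
        / (r ^ k * r ^ k)) (at r)"
    by (rule DERIV_divide[OF dv' p]) (use nz in simp)
  also have "(((real k)\<^sup>2 / (r * q r) - \<mu> * r * q r) * (r ^ k * modeH k \<mu> r) * r ^ k - ?v (rho r) * (k * r ^ k / r))
        / (r ^ k * r ^ k) =
      ((real k)\<^sup>2 / (r * q r) - \<mu> * r * q r) * modeH k \<mu> r - k * (?v (rho r) / r ^ k) / r"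
  proof -
    have gen: "(A * (P * B) * P - V * (x * P / r)) / (P * P) = A * B - x * (V / P) / r"
      if "P \<noteq> 0" for A B P V x :: real using that nz by (simp add: diff_divide_distrib mult.commute)
    show ?thesis by (rule gen) (use nz in simp)
  qed
  finally have "((\<lambda>r. ?v (rho r) / r ^ k) has_real_derivative
      ((real k)\<^sup>2 / (r * q r) - \<mu> * r * q r) * modeH k \<mu> r - k * modeN k \<mu> r / r) (at r)"
    unfolding eq[OF r] .
  then show ?thesis
    by (rule has_field_derivative_transform_within_open[of _ _ _ "{0<..<L}"]) (use r eq in auto)
qed

end

section \<open>Eigenfunctions of the surface\<close>

lemma matrix_inv_eqI:
  fixes A B :: "real^'n^'n"
  assumes "A ** B = mat 1"
  shows "matrix_inv A = B"
  unfolding matrix_inv_def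
proof (rule someI2)
  show "A ** B = mat 1 \<and> B ** A = mat 1" using assms matrix_left_right_inverse by blast
  fix M assume M: "A ** M = mat 1 \<and> M ** A = mat 1"
  have "M = M ** (A ** B)" using assms by simp
  also have "\<dots> = B" using M by (simp add: matrix_mul_assoc)
  finally show "M = B" .
qed

lemma has_vector_derivative_vector_3:
  fixes x y z :: "real \<Rightarrow> real"
  assumes "(x has_real_derivative x') (at t)" "(y has_real_derivative y') (at t)"
    "(z has_real_derivative z') (at t)"
  shows "((\<lambda>t. vector [x t, y t, z t] :: real^3) has_vector_derivative vector [x', y', z']) (at t)"
proof -
  have eq: "(vector [a, b, c] :: real^3) = a *\<^sub>R axis 1 1 + b *\<^sub>R axis 2 1 + c *\<^sub>R axis 3 1" for a b c
    by (simp add: vec_eq_iff forall_3 axis_def)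
  show ?thesis
    unfolding eq using assms
    by (auto intro!: derivative_eq_intros simp: has_real_derivative_iff_has_vector_derivative)
qed

section \<open>The induced metric on the parameter disc\<close>

context meridian
begin

definition surf :: "real^2 \<Rightarrow> real^3" where
  "surf z = vector [f (norm z) * (z $ 1 / norm z), f (norm z) * (z $ 2 / norm z), g (norm z)]"

text \<open>Free of the division by \<open>norm z\<close>, hence suited to differentiation across
  the pole.\<close>

lemma surf_eq: "surf z = vector [q (norm z) * z $ 1, q (norm z) * z $ 2, g (norm z)]"
proof (cases "z = 0")
  case False
  have "f (norm z) * (x / norm z) = q (norm z) * x" for x
    using False f_eq[of "norm z"] by simp
  then show ?thesis unfolding surf_def by (simp only:)
qed (simp add: surf_def)

lemma DERIV_q_abs: "((\<lambda>t. q \<bar>t\<bar>) has_real_derivative 0) (at 0)"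
proof -
  obtain J where om: "continuous_on {0..<L} om" "continuous_on {0..<L} J"
    "\<And>r. r \<in> {0<..<L} \<Longrightarrow> (om has_real_derivative J r / r) (at r)"
    using euler_om unfolding euler_deriv_def by blast
  show ?thesis
  proof (rule DERIV_even_radial[OF L_pos])
    show "continuous_on {0..<L} q" by (rule continuous_on_subset[OF continuous_on_q]) auto
    show "continuous_on {0..<L} (\<lambda>r. 2 * om r + J r)" by (intro continuous_on_add continuous_on_mult continuous_on_const om)
    fix r assume r: "r \<in> {0<..<L}"
    have "((\<lambda>r. r\<^sup>2) has_real_derivative 2 * r) (at r)" by (auto intro!: derivative_eq_intros)
    from DERIV_add[OF DERIV_const[of 1] DERIV_mult[OF this om(3)[OF r]]]
    show "(q has_real_derivative r * (2 * om r + J r)) (at r)"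
      unfolding q_def[abs_def]
      by (rule DERIV_cong) (use r in \<open>simp add: distrib_left power2_eq_square\<close>)
  qed
qed

lemma DERIV_g_abs: "((\<lambda>t. g \<bar>t\<bar>) has_real_derivative 0) (at 0)"
proof -
  have "filterlim (\<lambda>t::real. \<bar>t\<bar>) (at_right 0) (at 0)"
    unfolding filterlim_at
    by (auto intro!: tendsto_rabs_zero simp: eventually_at_filter)
  from filterlim_compose[OF g_pole this]
  have "((\<lambda>t. (g \<bar>t\<bar> - g 0) / \<bar>t\<bar>) \<longlongrightarrow> 0) (at 0)" .
  then have "((\<lambda>t. \<bar>(g \<bar>t\<bar> - g 0) / \<bar>t\<bar>\<bar>) \<longlongrightarrow> 0) (at 0)" by (rule tendsto_rabs_zero)
  then have "((\<lambda>t. \<bar>(g \<bar>t\<bar> - g 0) / t\<bar>) \<longlongrightarrow> 0) (at 0)" by (simp add: abs_divide)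
  then have "((\<lambda>t. (g \<bar>t\<bar> - g 0) / t) \<longlongrightarrow> 0) (at 0)" by (rule tendsto_rabs_zero_cancel)
  then show ?thesis by (simp add: DERIV_def)
qed

lemma axis_component: "axis i (1::real) $ j = (if i = j then 1 else 0)"
  by (simp add: axis_def)

lemma has_partial_radial_component:
  assumes "z \<in> ball 0 L"
  shows "has_partial i (\<lambda>z. q (norm z) * z $ j) z
    ((f1 (norm z) - q (norm z)) / (norm z)\<^sup>2 * z $ i * z $ j + (if i = j then q (norm z) else 0))"
proof (cases "z = 0")
  case True
  have "continuous_on {0..<L} q" by (rule continuous_on_subset[OF continuous_on_q]) auto
  from DERIV_odd_radial[OF L_pos this] show ?thesis
    using True by (auto simp: has_partial_def axis_component)
next
  case False
  have "has_partial i (\<lambda>z. q (norm z)) z ((f1 (norm z) - q (norm z)) / norm z * (z $ i / norm z))"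
    by (rule has_partial_compose[OF has_partial_norm[OF False] DERIV_q]) (use assms False in auto)
  from has_partial_mult[OF this has_partial_component[of i j z]]
  show ?thesis by (rule back_subst) (auto simp: power2_eq_square)
qed

lemma has_partial_height:
  assumes "z \<in> ball 0 L"
  shows "has_partial i (\<lambda>z. g (norm z)) z (g1 (norm z) / norm z * z $ i)"
proof (cases "z = 0")
  case True
  then show ?thesis using DERIV_g_abs by (simp add: has_partial_def)
next
  case False
  have "has_partial i (\<lambda>z. g (norm z)) z (g1 (norm z) * (z $ i / norm z))"
    by (rule has_partial_compose[OF has_partial_norm[OF False] g_deriv]) (use assms False in auto)
  then show ?thesis by simp
qed

lemma partial_deriv_surf:
  assumes "z \<in> ball 0 L"
  shows "partial_deriv (axis i 1) surf z = vector
    [(f1 (norm z) - q (norm z)) / (norm z)\<^sup>2 * z $ i * z $ 1 + (if i = 1 then q (norm z) else 0),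
     (f1 (norm z) - q (norm z)) / (norm z)\<^sup>2 * z $ i * z $ 2 + (if i = 2 then q (norm z) else 0),
     g1 (norm z) / norm z * z $ i]"
  unfolding partial_deriv_def surf_eq
  by (rule vector_derivative_at, rule has_vector_derivative_vector_3)
    (use has_partial_radial_component[OF assms, of i 1] has_partial_radial_component[OF assms, of i 2]
      has_partial_height[OF assms, of i] in \<open>simp_all add: has_partial_def\<close>)

text \<open>Radial lengths are unchanged, by unit speed, and tangential ones are multiplied by
  \<open>q\<close>; with \<open>n = z / norm z\<close> this is the matrix
  \<open>q\<^sup>2 I + (1 - q\<^sup>2) n n\<^sup>T\<close>. At the origin \<open>n\<close> is 0
  through division by zero and \<open>q\<close> is 1, so the formula persists.\<close>

lemma induced_metric_surf:
  assumes "z \<in> ball 0 L"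
  shows "induced_metric surf z $ i $ j =
    (if i = j then (q (norm z))\<^sup>2 else 0) + (1 - (q (norm z))\<^sup>2) * (z $ i / norm z * (z $ j / norm z))"
proof -
  let ?r = "norm z"
  define s t Q where "s = (f1 ?r - q ?r) / ?r\<^sup>2" and "t = g1 ?r / ?r" and "Q = q ?r"
  define D :: "2 \<Rightarrow> 2 \<Rightarrow> real" where "D i j = (if i = j then 1 else 0)" for i j
  have "induced_metric surf z $ i $ j =
      (s * z $ i * z $ 1 + (if i = 1 then Q else 0)) * (s * z $ j * z $ 1 + (if j = 1 then Q else 0)) +
      (s * z $ i * z $ 2 + (if i = 2 then Q else 0)) * (s * z $ j * z $ 2 + (if j = 2 then Q else 0)) +
      (t * z $ i) * (t * z $ j)"
    unfolding induced_metric_def s_def t_def Q_def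
    by (simp add: partial_deriv_surf[OF assms] inner_vec_def sum_3)
  also have "\<dots> = (if i = j then Q\<^sup>2 else 0) + z $ i * z $ j * (s\<^sup>2 * ((z $ 1)\<^sup>2 + (z $ 2)\<^sup>2) + 2 * s * Q + t\<^sup>2)"
    using exhaust_2[of i] exhaust_2[of j]
    by (elim disjE) (simp_all add: power2_eq_square algebra_simps)
  also have "z $ i * z $ j * (s\<^sup>2 * ((z $ 1)\<^sup>2 + (z $ 2)\<^sup>2) + 2 * s * Q + t\<^sup>2) =
      (1 - Q\<^sup>2) * (z $ i / ?r * (z $ j / ?r))"
  proof (cases "z = 0")
    case False
    then have r: "?r \<noteq> 0" "?r \<in> {0<..<L}" using assms by auto
    have e1: "s * ?r\<^sup>2 = f1 ?r - Q" using r by (simp add: s_def Q_def)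
    have e2: "t\<^sup>2 * ?r\<^sup>2 = (g1 ?r)\<^sup>2" using r by (simp add: t_def power_divide)
    have "(s\<^sup>2 * ?r\<^sup>2 + 2 * s * Q + t\<^sup>2) * ?r\<^sup>2 = (s * ?r\<^sup>2)\<^sup>2 + 2 * (s * ?r\<^sup>2) * Q + t\<^sup>2 * ?r\<^sup>2"
      by (simp add: power2_eq_square algebra_simps)
    also have "\<dots> = 1 - Q\<^sup>2"
      unfolding e1 e2 using unit_speed[OF r(2)] by (simp add: power2_eq_square algebra_simps)
    finally have "s\<^sup>2 * ?r\<^sup>2 + 2 * s * Q + t\<^sup>2 = (1 - Q\<^sup>2) / ?r\<^sup>2" using r by (simp add: eq_divide_eq)
    then show ?thesis unfolding norm_vec2_power2[symmetric] by (simp add: power2_eq_square)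
  qed simp
  finally show ?thesis by (simp add: Q_def)
qed

lemma unit_direction:
  fixes z :: "real^2"
  assumes "z \<noteq> 0"
  shows "(z $ 1 / norm z)\<^sup>2 + (z $ 2 / norm z)\<^sup>2 = 1"
proof -
  have "(z $ 1 / norm z)\<^sup>2 + (z $ 2 / norm z)\<^sup>2 = ((z $ 1)\<^sup>2 + (z $ 2)\<^sup>2) / (norm z)\<^sup>2"
    by (simp add: power_divide add_divide_distrib)
  also have "\<dots> = (norm z)\<^sup>2 / (norm z)\<^sup>2" by (simp only: norm_vec2_power2)
  finally show ?thesis using assms by simp
qed

lemma det_induced_metric_surf:
  assumes "z \<in> ball 0 L"
  shows "sqrt (det (induced_metric surf z)) = q (norm z)"
proof -
  let ?Q = "q (norm z)"
  define x y where "x = z $ 1 / norm z" and "y = z $ 2 / norm z"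
  have "det (induced_metric surf z) = ?Q\<^sup>2 * (?Q\<^sup>2 + (1 - ?Q\<^sup>2) * (x\<^sup>2 + y\<^sup>2))"
    unfolding det_2 induced_metric_surf[OF assms] x_def[symmetric] y_def[symmetric]
    by (simp add: power2_eq_square algebra_simps)
  also have "\<dots> = ?Q\<^sup>2"
    using unit_direction[of z] by (cases "z = 0") (auto simp: x_def y_def)
  finally show ?thesis using q_pos[of "norm z"] assms by simp
qed

lemma matrix_inv_induced_metric_surf:
  assumes "z \<in> ball 0 L"
  shows "matrix_inv (induced_metric surf z) $ i $ j =
    (if i = j then 1 / (q (norm z))\<^sup>2 else 0) + (1 - 1 / (q (norm z))\<^sup>2) * (z $ i / norm z * (z $ j / norm z))"
proof -
  let ?Q = "q (norm z)"
  have Q: "?Q \<noteq> 0" using q_nonzero[of "norm z"] assms by simp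
  define x y where "x = z $ 1 / norm z" and "y = z $ 2 / norm z"
  define B :: "real^2^2" where "B = (\<chi> i j. (if i = j then 1 / ?Q\<^sup>2 else 0) + (1 - 1 / ?Q\<^sup>2) * (z $ i / norm z * (z $ j / norm z)))"
  define P where "P = 1 / ?Q\<^sup>2"
  have QP: "?Q\<^sup>2 * P = 1" using Q by (simp add: P_def)
  \<comment> \<open>Off the origin \<open>x\<^sup>2 + y\<^sup>2\<close> is 1; at the origin it is 0,
    but there \<open>?Q = 1\<close> makes both sides vanish.\<close>
  have u: "(1 - ?Q\<^sup>2) * (1 - P) * (x\<^sup>2 + y\<^sup>2) = (1 - ?Q\<^sup>2) * (1 - P)"
    using unit_direction[of z] by (cases "z = 0") (auto simp: x_def y_def)
  let ?A = "induced_metric surf z"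
  have A: "?A $ 1 $ 1 = ?Q\<^sup>2 + (1 - ?Q\<^sup>2) * (x * x)" "?A $ 1 $ 2 = (1 - ?Q\<^sup>2) * (x * y)"
    "?A $ 2 $ 1 = (1 - ?Q\<^sup>2) * (x * y)" "?A $ 2 $ 2 = ?Q\<^sup>2 + (1 - ?Q\<^sup>2) * (y * y)"
    unfolding induced_metric_surf[OF assms] x_def y_def by simp_all
  have B: "B $ 1 $ 1 = P + (1 - P) * (x * x)" "B $ 1 $ 2 = (1 - P) * (x * y)"
    "B $ 2 $ 1 = (1 - P) * (x * y)" "B $ 2 $ 2 = P + (1 - P) * (y * y)"
    unfolding B_def x_def y_def P_def by simp_all
  have m: "(?A ** B) $ i $ j = ?A $ i $ 1 * B $ 1 $ j + ?A $ i $ 2 * B $ 2 $ j" for i j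
    by (simp add: matrix_matrix_mult_def sum_2)
  have "(?A ** B) $ 1 $ 1 = 1" unfolding m A B using QP u by algebra
  moreover have "(?A ** B) $ 1 $ 2 = 0" unfolding m A B using QP u by algebra
  moreover have "(?A ** B) $ 2 $ 1 = 0" unfolding m A B using QP u by algebra
  moreover have "(?A ** B) $ 2 $ 2 = 1" unfolding m A B using QP u by algebra
  ultimately have "?A ** B = mat 1"
    unfolding vec_eq_iff forall_2 by (simp add: mat_def)
  from matrix_inv_eqI[OF this] show ?thesis by (simp add: B_def)
qed

text \<open>The assumption \<open>d\<close> describes the flux, that is, the density times the
  inverse metric applied to the gradient: the gradient divided by \<open>q\<close>, with its radial
  part rescaled from \<open>1 / q\<close> to \<open>q\<close>.\<close>

lemma laplace_beltrami_surf:
  assumes z: "z \<in> ball 0 L"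
    and u': "\<And>i w. w \<in> ball 0 L \<Longrightarrow> partial_deriv (axis i 1) u w = u' i w"
    and d: "\<And>i. has_partial i (\<lambda>w. u' i w / q (norm w) +
      (q (norm w) - 1 / q (norm w)) * (w $ i / norm w * ((w $ 1 * u' 1 w + w $ 2 * u' 2 w) / norm w))) z (d i)"
  shows "laplace_beltrami surf u z = (d 1 + d 2) / q (norm z)"
proof -
  have "partial_deriv (axis i 1) (\<lambda>w. sqrt (det (induced_metric surf w)) *
      (\<Sum>j\<in>UNIV. matrix_inv (induced_metric surf w) $ i $ j * partial_deriv (axis j 1) u w)) z = d i" for i
  proof -
    have "partial_deriv (axis i 1) (\<lambda>w. sqrt (det (induced_metric surf w)) *
        (\<Sum>j\<in>UNIV. matrix_inv (induced_metric surf w) $ i $ j * partial_deriv (axis j 1) u w)) z =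
      partial_deriv (axis i 1) (\<lambda>w. u' i w / q (norm w) +
        (q (norm w) - 1 / q (norm w)) * (w $ i / norm w * ((w $ 1 * u' 1 w + w $ 2 * u' 2 w) / norm w))) z"
    proof (rule partial_deriv_cong[OF open_ball z])
      fix w :: "real^2" assume w: "w \<in> ball 0 L"
      have qn: "q (norm w) \<noteq> 0" using q_nonzero[of "norm w"] w by simp
      show "sqrt (det (induced_metric surf w)) *
        (\<Sum>j\<in>UNIV. matrix_inv (induced_metric surf w) $ i $ j * partial_deriv (axis j 1) u w) =
        u' i w / q (norm w) +
        (q (norm w) - 1 / q (norm w)) * (w $ i / norm w * ((w $ 1 * u' 1 w + w $ 2 * u' 2 w) / norm w))"
      proof -
        define x y U1 U2 Q where "x = w $ 1 / norm w" and "y = w $ 2 / norm w"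
          and "U1 = u' 1 w" and "U2 = u' 2 w" and "Q = q (norm w)"
        have n12: "(1::2) \<noteq> 2" "(2::2) \<noteq> 1" by simp_all
        have Q: "Q \<noteq> 0" using qn by (simp add: Q_def)
        have "(w $ 1 * U1 + w $ 2 * U2) / norm w = x * U1 + y * U2"
          by (simp add: x_def y_def add_divide_distrib)
        moreover have "Q * ((1 / Q\<^sup>2 + (1 - 1 / Q\<^sup>2) * (x * x)) * U1 + (0 + (1 - 1 / Q\<^sup>2) * (x * y)) * U2) =
            U1 / Q + (Q - 1 / Q) * (x * (x * U1 + y * U2))"
          "Q * ((0 + (1 - 1 / Q\<^sup>2) * (y * x)) * U1 + (1 / Q\<^sup>2 + (1 - 1 / Q\<^sup>2) * (y * y)) * U2) =
            U2 / Q + (Q - 1 / Q) * (y * (x * U1 + y * U2))"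
          using Q by (simp_all add: field_simps power2_eq_square)
        ultimately show ?thesis
          unfolding det_induced_metric_surf[OF w] sum_2 matrix_inv_induced_metric_surf[OF w] u'[OF w]
          using exhaust_2[of i] unfolding x_def y_def U1_def U2_def Q_def
          by (elim disjE) (simp_all only: simp_thms if_True if_False n12)
      qed
    qed
    then show ?thesis using has_partial_imp_partial_deriv[OF d] by simp
  qed
  then show ?thesis
    unfolding laplace_beltrami_def det_induced_metric_surf[OF z] by (simp add: sum_2[of d])
qed


lemma hpoly_laplace:
  "real k * (real (k - 1) * hpoly (k - 1 - 1) (c * axis_unit 1 * axis_unit 1) z) +
    real k * (real (k - 1) * hpoly (k - 1 - 1) (c * axis_unit 2 * axis_unit 2) z) = 0"
  by (simp add: hpoly_def axis_unit_def algebra_simps)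

lemma C2_partials_modeH:
  obtains J where "C2_partials (ball 0 L) (\<lambda>z. modeH k \<mu> (norm z)) (\<lambda>i z. modeK k \<mu> (norm z) * z $ i)
    (\<lambda>i j z. (if i = j then modeK k \<mu> (norm z) else 0) + z $ i * z $ j * (J (norm z) / (norm z)\<^sup>2))"
proof -
  obtain J where J: "euler_deriv L (modeK k \<mu>) J" using euler_modeK by blast
  have "continuous_on {0..<L} (modeH k \<mu>)"
    by (rule continuous_on_subset[OF continuous_on_modeH]) auto
  from radial_C2_partials[OF L_pos this J DERIV_modeH] show ?thesis by (rule that)
qed

text \<open>Needed for the eigenvalue equation at the pole. For \<open>k > 0\<close> the polynomial
  vanishes there; for \<open>k = 0\<close> the value comes from \<open>rad_flux_0\<close> and
  \<open>Phi 0 = (1 / eta 0)\<^sup>2\<close>.\<close>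

lemma modeK_pole: "2 * (Re (c * 0 ^ k) * modeK k \<mu> 0) = - \<mu> * (Re (c * 0 ^ k) * modeH k \<mu> 0)"
proof (cases "k = 0")
  case True
  have "2 * W.rad_flux 0 \<mu> 0 = (1 / eta 0)\<^sup>2"
    using W.rad_flux_0[of 0 \<mu>] Phi_rho[of 0] L_pos by simp
  then have "2 * ((eta 0)\<^sup>2 * W.rad_flux 0 \<mu> 0) = 1"
    using eta_nonzero[of 0] by (simp add: power_divide field_simps)
  then have "2 * modeK 0 \<mu> 0 = - \<mu>" by (simp add: modeK_def algebra_simps)
  moreover have "modeH 0 \<mu> 0 = 1" by (simp add: modeH_def W.rad_sol_0)
  ultimately show ?thesis using True by (simp add: algebra_simps)
qed (simp add: power_0_left)

text \<open>In polar coordinates this is the separated equation \<open>(f W')' - k\<^sup>2 W / f = - \<mu> f W\<close> for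
  \<open>W r = r\<^sup>k H r\<close>; \<open>E\<close> and \<open>T\<close> are the tangential and radial parts of the flux.\<close>

lemma laplace_beltrami_mode:
  assumes z: "z \<in> ball 0 L"
  shows "laplace_beltrami surf (\<lambda>z. hpoly k c z * modeH k \<mu> (norm z)) z =
    - \<mu> * (hpoly k c z * modeH k \<mu> (norm z))"
proof -
  let ?H = "modeH k \<mu>" and ?K = "modeK k \<mu>" and ?N = "modeN k \<mu>"
  let ?P = "hpoly k c"
  let ?P' = "\<lambda>i z. real k * hpoly (k - 1) (c * axis_unit i) z"
  let ?P'' = "\<lambda>i j z. real k * (real (k - 1) * hpoly (k - 1 - 1) (c * axis_unit i * axis_unit j) z)"
  define u' where "u' i z = ?P' i z * ?H (norm z) + ?P z * (?K (norm z) * z $ i)" for i z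
  obtain J where CH: "C2_partials (ball 0 L) (\<lambda>z. ?H (norm z)) (\<lambda>i z. ?K (norm z) * z $ i)
    (\<lambda>i j z. (if i = j then ?K (norm z) else 0) + z $ i * z $ j * (J (norm z) / (norm z)\<^sup>2))"
    by (rule C2_partials_modeH)
  have CM: "C2_partials (ball 0 L) (\<lambda>z. ?P z * ?H (norm z)) u'
      (\<lambda>i j w. (?P'' i j w * ?H (norm w) + ?P' i w * (?K (norm w) * w $ j)) + (?P' j w * (?K (norm w) * w $ i) +
        ?P w * ((if i = j then ?K (norm w) else 0) + w $ i * w $ j * (J (norm w) / (norm w)\<^sup>2))))"
    unfolding u'_def[abs_def] by (rule C2_partials_mult[OF C2_partials_hpoly CH])
  have C2: "has_partial i (\<lambda>z. ?P z * ?H (norm z)) w (u' i w)"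
    "has_partial i (u' i) w
      ((?P'' i i w * ?H (norm w) + ?P' i w * (?K (norm w) * w $ i)) + (?P' i w * (?K (norm w) * w $ i) +
        ?P w * (?K (norm w) + w $ i * w $ i * (J (norm w) / (norm w)\<^sup>2))))"
    if w: "w \<in> ball 0 L" for i w
  proof -
    show "has_partial i (\<lambda>z. ?P z * ?H (norm z)) w (u' i w)"
      using CM w unfolding C2_partials_def by blast
    have "has_partial i (u' i) w
      ((?P'' i i w * ?H (norm w) + ?P' i w * (?K (norm w) * w $ i)) + (?P' i w * (?K (norm w) * w $ i) +
        ?P w * ((if i = i then ?K (norm w) else 0) + w $ i * w $ i * (J (norm w) / (norm w)\<^sup>2))))"
      using CM w unfolding C2_partials_def by blast
    then show "has_partial i (u' i) w
      ((?P'' i i w * ?H (norm w) + ?P' i w * (?K (norm w) * w $ i)) + (?P' i w * (?K (norm w) * w $ i) +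
        ?P w * (?K (norm w) + w $ i * w $ i * (J (norm w) / (norm w)\<^sup>2))))"
      by (simp only: simp_thms if_True)
  qed
  have u': "partial_deriv (axis i 1) (\<lambda>z. ?P z * ?H (norm z)) w = u' i w" if "w \<in> ball 0 L" for i w
    by (rule has_partial_imp_partial_deriv[OF C2(1)[OF that]])
  let ?A = "\<lambda>i w. u' i w / q (norm w) +
      (q (norm w) - 1 / q (norm w)) * (w $ i / norm w * ((w $ 1 * u' 1 w + w $ 2 * u' 2 w) / norm w))"
  show ?thesis
  proof (cases "z = 0")
    case True
    let ?d = "\<lambda>i. ?P'' i i 0 * ?H 0 + ?P 0 * ?K 0"
    have "has_partial i (?A i) 0 (?d i)" for i
    proof -
      \<comment> \<open>On an axis through the pole the radial direction is the axis itself, so the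
        flux along it is \<open>q\<close> times the partial derivative.\<close>
      have line: "?A i (t *\<^sub>R axis i 1) = q \<bar>t\<bar> * u' i (t *\<^sub>R axis i 1)" if "t \<in> {- L<..<L}" for t
      proof (cases "t = 0")
        case False
        have qn: "q \<bar>t\<bar> \<noteq> 0" using that by (intro q_nonzero) auto
        have comp: "(t *\<^sub>R axis i 1 :: real^2) $ j = (if i = j then t else 0)" for j
          by (simp add: axis_component)
        have s: "((t *\<^sub>R axis i 1 :: real^2) $ 1 * u' 1 (t *\<^sub>R axis i 1) +
            (t *\<^sub>R axis i 1 :: real^2) $ 2 * u' 2 (t *\<^sub>R axis i 1)) = t * u' i (t *\<^sub>R axis i 1)"
          unfolding comp using exhaust_2[of i] by auto
        have gen: "U / Q + (Q - 1 / Q) * (t / \<bar>t\<bar> * (t * U / \<bar>t\<bar>)) = Q * U" if "Q \<noteq> 0" for U Q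
        proof -
          have "t / \<bar>t\<bar> * (t * U / \<bar>t\<bar>) = U" using False by (cases "0 < t") simp_all
          then show ?thesis using that by (simp add: field_simps)
        qed
        show ?thesis unfolding s unfolding norm_axis_scaled comp if_True simp_thms by (rule gen[OF qn])
      qed simp
      have "((\<lambda>t. u' i (t *\<^sub>R axis i 1)) has_real_derivative ?d i) (at 0)"
        using C2(2)[of 0 i] L_pos by (simp add: has_partial_def)
      from DERIV_mult[OF DERIV_q_abs this]
      have "((\<lambda>t. q \<bar>t\<bar> * u' i (t *\<^sub>R axis i 1)) has_real_derivative ?d i) (at 0)" by simp
      then have "((\<lambda>t. ?A i (t *\<^sub>R axis i 1)) has_real_derivative ?d i) (at 0)"
        by (rule has_field_derivative_transform_within_open[of _ _ _ "{- L<..<L}"])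
          (use L_pos line in \<open>auto simp del: norm_scaleR\<close>)
      then show ?thesis unfolding has_partial_def by simp
    qed
    from laplace_beltrami_surf[OF z u', of ?d] this
    have "laplace_beltrami surf (\<lambda>z. ?P z * ?H (norm z)) z = ?d 1 + ?d 2"
      using True by simp
    also have "\<dots> = (?P'' 1 1 0 + ?P'' 2 2 0) * ?H 0 + 2 * (?P 0 * ?K 0)"
      by (simp only: distrib_right mult_2 add_ac)
    also have "\<dots> = 2 * (?P 0 * ?K 0)" by (simp only: hpoly_laplace mult_zero_left add_0)
    also have "\<dots> = - \<mu> * (?P 0 * ?H 0)"
    proof -
      have "Complex 0 0 = 0" by (simp add: complex_eq_iff)
      then show ?thesis using modeK_pole[of c k \<mu>] by (simp add: hpoly_def)
    qed
    finally show ?thesis using True by simp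
  next
    case False
    let ?r = "norm z"
    have r: "?r \<in> {0<..<L}" "?r \<noteq> 0" using z False by auto
    define E where "E s = ?H s / q s" for s
    define T where "T s = (?N s - k * E s) / s\<^sup>2" for s
    define E1 where "E1 = (?r * ?K ?r * q ?r - ?H ?r * ((f1 ?r - q ?r) / ?r)) / (q ?r * q ?r)"
    define N1 where "N1 = ((real k)\<^sup>2 / (?r * q ?r) - \<mu> * ?r * q ?r) * ?H ?r - k * ?N ?r / ?r"
    define T1 where "T1 = ((N1 - k * E1) * ?r\<^sup>2 - (?N ?r - k * E ?r) * (2 * ?r)) / (?r\<^sup>2 * ?r\<^sup>2)"
    have qn: "q ?r \<noteq> 0" using r by (intro q_nonzero) auto
    have dE: "(E has_real_derivative E1) (at ?r)"
      unfolding E_def[abs_def] E1_def by (rule DERIV_divide[OF DERIV_modeH[OF r(1)] DERIV_q[OF r(1)] qn])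
    have dN: "(?N has_real_derivative N1) (at ?r)"
      unfolding N1_def by (rule DERIV_modeN[OF r(1)])
    have dsq: "((\<lambda>s. s\<^sup>2) has_real_derivative 2 * ?r) (at ?r)" by (auto intro!: derivative_eq_intros)
    have dT: "(T has_real_derivative T1) (at ?r)"
      unfolding T_def[abs_def] T1_def
      by (rule DERIV_divide[OF DERIV_diff[OF dN DERIV_cmult[OF dE]] dsq]) (use r in simp)
    define d where "d i = (E1 * (z $ i / ?r) * ?P' i z + E ?r * ?P'' i i z) +
      (1 * (?P z * T ?r) + z $ i * (?P' i z * T ?r + ?P z * (T1 * (z $ i / ?r))))" for i
    have dA: "has_partial i (?A i) z (d i)" for i
    proof -
      have nz: "open (ball 0 L - {0 :: real^2})" "z \<in> ball 0 L - {0}" using z False by (auto intro: open_Diff)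
      have hp: "has_partial i (\<lambda>w. E (norm w) * ?P' i w + w $ i * (?P w * T (norm w))) z (d i)"
        unfolding d_def
      proof (intro has_partial_add has_partial_mult)
        show "has_partial i (\<lambda>w. E (norm w)) z (E1 * (z $ i / ?r))"
          by (rule has_partial_compose[OF has_partial_norm[OF False] dE])
        show "has_partial i (\<lambda>w. T (norm w)) z (T1 * (z $ i / ?r))"
          by (rule has_partial_compose[OF has_partial_norm[OF False] dT])
        show "has_partial i (\<lambda>z. z $ i) z 1" using has_partial_component[of i i z] by simp
        show "has_partial i (?P' i) z (?P'' i i z)"
          using C2_partials_hpoly[of UNIV k c] unfolding C2_partials_def by blast
      qed (rule has_partial_hpoly)
      have he: "E (norm w) * ?P' i w + w $ i * (?P w * T (norm w)) = ?A i w" if w: "w \<in> ball 0 L - {0}" for w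
      proof -
        let ?s = "norm w"
        have s: "?s \<noteq> 0" "q ?s \<noteq> 0" using w q_nonzero[of ?s] by auto
        have "w $ 1 * u' 1 w + w $ 2 * u' 2 w =
            (w $ 1 * ?P' 1 w + w $ 2 * ?P' 2 w) * ?H ?s + ?P w * ?K ?s * ((w $ 1)\<^sup>2 + (w $ 2)\<^sup>2)"
          unfolding u'_def by (simp add: power2_eq_square algebra_simps)
        also have "\<dots> = ?P w * (k * ?H ?s + ?s\<^sup>2 * ?K ?s)"
          unfolding hpoly_euler norm_vec2_power2[symmetric] by (simp only: distrib_left mult_ac)
        finally have e: "w $ 1 * u' 1 w + w $ 2 * u' 2 w = ?P w * (k * ?H ?s + ?s\<^sup>2 * ?K ?s)" .
        have gen: "H / Q * p' + x * (p * ((Q * (k * H + s\<^sup>2 * K) - k * (H / Q)) / s\<^sup>2)) =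
            (p' * H + p * (K * x)) / Q + (Q - 1 / Q) * (x / s * (p * (k * H + s\<^sup>2 * K) / s))"
          if "s \<noteq> 0" "Q \<noteq> 0" for H Q p' x p K s k :: real
          using that by (simp add: field_simps power2_eq_square)
        show ?thesis unfolding e unfolding u'_def E_def T_def modeN_def by (rule gen[OF s])
      qed
      have "has_partial i (\<lambda>w. E (norm w) * ?P' i w + w $ i * (?P w * T (norm w))) z (d i) \<longleftrightarrow>
          has_partial i (?A i) z (d i)"
        by (rule has_partial_cong[OF nz]) (rule he)
      with hp show ?thesis by blast
    qed
    \<comment> \<open>In the divergence, Euler's relation and harmonicity remove the partial
      derivatives of the polynomial and leave a radial factor.\<close>
    have "d 1 + d 2 = E1 / ?r * (z $ 1 * ?P' 1 z + z $ 2 * ?P' 2 z) + E ?r * (?P'' 1 1 z + ?P'' 2 2 z) +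
        2 * (?P z * T ?r) + (z $ 1 * ?P' 1 z + z $ 2 * ?P' 2 z) * T ?r +
        ?P z * T1 / ?r * ((z $ 1)\<^sup>2 + (z $ 2)\<^sup>2)"
      unfolding d_def by (simp add: power2_eq_square algebra_simps add_divide_distrib)
    also have "\<dots> = ?P z * (k * E1 / ?r + (k + 2) * T ?r + ?r * T1)"
      unfolding hpoly_euler hpoly_laplace norm_vec2_power2[symmetric]
      using r by (simp add: power2_eq_square algebra_simps)
    also have "k * E1 / ?r + (k + 2) * T ?r + ?r * T1 = - \<mu> * q ?r * ?H ?r"
    proof -
      \<comment> \<open>The derivative of \<open>E\<close> cancels, and what is left is given by the
        equation for \<open>modeN\<close>.\<close>
      have "?r * T1 = (N1 - k * E1) / ?r - 2 * T ?r"
        unfolding T1_def T_def using r by (simp add: field_simps power2_eq_square)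
      then have "k * E1 / ?r + (k + 2) * T ?r + ?r * T1 = k * T ?r + N1 / ?r"
        by (simp add: diff_divide_distrib algebra_simps)
      also have "\<dots> = k * (?N ?r - k * (?H ?r / q ?r)) / ?r\<^sup>2 +
          (((real k)\<^sup>2 / (?r * q ?r) - \<mu> * ?r * q ?r) * ?H ?r - k * ?N ?r / ?r) / ?r"
        by (simp add: T_def E_def N1_def)
      also have "\<dots> = - \<mu> * q ?r * ?H ?r"
      proof -
        have gen: "x * (N - x * (H / Q)) / s\<^sup>2 + ((x\<^sup>2 / (s * Q) - \<mu> * s * Q) * H - x * N / s) / s = - \<mu> * Q * H"
          if "s \<noteq> 0" "Q \<noteq> 0" for x N H Q s :: real
          using that by (simp add: field_simps power2_eq_square)
        show ?thesis by (rule gen[OF r(2) qn])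
      qed
      finally show ?thesis .
    qed
    finally have "d 1 + d 2 = - \<mu> * (?P z * ?H ?r) * q ?r" by (simp add: mult_ac)
    then show ?thesis using laplace_beltrami_surf[OF z u' dA] qn by simp
  qed
qed

section \<open>The modes as Dirichlet eigenfunctions and their independence\<close>

definition modefun :: "nat \<Rightarrow> complex \<Rightarrow> real \<Rightarrow> real^2 \<Rightarrow> real" where
  "modefun k c \<mu> z = (if z \<in> ball 0 L then hpoly k c z * modeH k \<mu> (norm z) else 0)"

lemma modefun_eigenspace:
  assumes "W.rad_sol k \<mu> R = 0"
  shows "modefun k c \<mu> \<in> dirichlet_eigenspace (laplace_beltrami surf) (ball 0 L) \<mu>"
proof -
  let ?u = "\<lambda>z. hpoly k c z * modeH k \<mu> (norm z)"
  have eq: "modefun k c \<mu> w = ?u w" if "w \<in> ball 0 L" for w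
    using that by (simp add: modefun_def)
  obtain J where CH: "C2_partials (ball 0 L) (\<lambda>z. modeH k \<mu> (norm z)) (\<lambda>i z. modeK k \<mu> (norm z) * z $ i)
    (\<lambda>i j z. (if i = j then modeK k \<mu> (norm z) else 0) + z $ i * z $ j * (J (norm z) / (norm z)\<^sup>2))"
    by (rule C2_partials_modeH)
  have "Ck_on 2 (ball 0 L) ?u"
    by (rule C2_partials_imp_Ck_on[OF open_ball C2_partials_mult[OF C2_partials_hpoly CH]])
  then have "Ck_on 2 (ball 0 L) (modefun k c \<mu>)"
    using Ck_on_cong[of "ball 0 L" "modefun k c \<mu>" ?u] eq by blast
  moreover have "continuous_on (closure (ball 0 L)) (modefun k c \<mu>)"
  proof -
    have "continuous_on (cball 0 L) ?u"
      by (intro continuous_intros continuous_on_hpoly continuous_on_compose2[OF continuous_on_modeH]) auto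
    \<comment> \<open>On the boundary circle \<open>rho L = R\<close>, where \<open>rad_sol\<close>
      vanishes, so the extension by 0 agrees with the formula.\<close>
    moreover have "modefun k c \<mu> z = ?u z" if "z \<in> cball 0 L" for z
    proof (cases "norm z = L")
      case True
      then show ?thesis using assms by (simp add: modefun_def modeH_def)
    qed (use that eq in auto)
    ultimately have "continuous_on (cball 0 L) (modefun k c \<mu>)"
      using continuous_on_cong[of "cball 0 L" "cball 0 L" "modefun k c \<mu>" ?u] by blast
    then show ?thesis using L_pos by simp
  qed
  moreover have "- laplace_beltrami surf (modefun k c \<mu>) z = \<mu> * modefun k c \<mu> z" if z: "z \<in> ball 0 L" for z
  proof -
    have pd: "partial_deriv (axis j 1) (modefun k c \<mu>) w = partial_deriv (axis j 1) ?u w" if "w \<in> ball 0 L" for w j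
      by (rule partial_deriv_cong[OF open_ball that eq])
    have "laplace_beltrami surf (modefun k c \<mu>) z = laplace_beltrami surf ?u z"
      unfolding laplace_beltrami_def
      by (intro arg_cong2[where f = "(*)"] sum.cong refl partial_deriv_cong[OF open_ball z]) (simp add: pd)
    then show ?thesis using laplace_beltrami_mode[OF z, of k c \<mu>] eq[OF z] by simp
  qed
  ultimately show ?thesis
    unfolding dirichlet_eigenspace_def by (auto simp: modefun_def)
qed

lemma circ_coeff_modefun:
  assumes r: "r \<in> {0<..<L}" and m: "(k, c) \<in> modes" "(k', c') \<in> modes"
  shows "circ_coeff k c (modefun k' c' \<mu>) r =
    (if (k, c) = (k', c') then r ^ k * modeH k \<mu> r * (if k = 0 then 2 * pi else pi) else 0)"
proof -
  have eq: "modefun k' c' \<mu> (polar r t) * circ k c t = r ^ k' * modeH k' \<mu> r * (circ k c t * circ k' c' t)" for t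
    using r by (simp add: modefun_def hpoly_polar)
  show ?thesis
    unfolding circ_coeff_def eq
    using integral_unique[OF has_integral_mult_right[OF has_integral_circ_mult[OF m], of "r ^ k' * modeH k' \<mu> r"]]
    by auto
qed

text \<open>More modes than spanning functions would give a nontrivial vanishing combination of mode
  functions. Taking the coefficient of a mode with nonzero factor, at a radius where its profile is
  nonzero, isolates that factor by orthogonality.\<close>

lemma surface_eigenspace_modes:
  assumes A: "finite A" "A \<subseteq> modes" "\<And>k c. (k, c) \<in> A \<Longrightarrow> W.rad_sol k \<mu> R = 0"
    and B: "finite B" "fun_space.span B = dirichlet_eigenspace (laplace_beltrami surf) (ball 0 L) \<mu>"
  shows "card A \<le> card B"
proof (rule ccontr)
  assume neg: "\<not> card A \<le> card B"
  let ?u = "\<lambda>m. modefun (fst m) (snd m) \<mu>"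
  have "\<exists>s. ?u m = (\<Sum>b\<in>B. (\<lambda>x. s b * b x))" if "m \<in> A" for m
  proof -
    have "?u m \<in> fun_space.span B"
      unfolding B(2) by (rule modefun_eigenspace, rule A(3)[of "fst m" "snd m"]) (simp add: that)
    then show ?thesis unfolding fun_space.span_finite[OF B(1)] image_iff by blast
  qed
  then have "\<forall>m. \<exists>s. m \<in> A \<longrightarrow> ?u m = (\<Sum>b\<in>B. (\<lambda>x. s b * b x))" by blast
  from choice[OF this] obtain s where
    s: "\<And>m. m \<in> A \<Longrightarrow> ?u m = (\<Sum>b\<in>B. (\<lambda>x. s m b * b x))" by blast
  obtain t where t: "\<exists>m\<in>A. t m \<noteq> 0" "\<forall>b\<in>B. (\<Sum>m\<in>A. t m * s m b) = 0"
    using homogeneous_system_nontrivial[OF B(1) A(1), of "\<lambda>b m. s m b"] neg by auto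
  have zero: "(\<lambda>x. \<Sum>m\<in>A. t m * ?u m x) = (\<lambda>x. 0)"
  proof
    fix x
    have "(\<Sum>m\<in>A. t m * ?u m x) = (\<Sum>m\<in>A. \<Sum>b\<in>B. t m * s m b * b x)"
      by (intro sum.cong refl) (simp add: s sum_scaled_fun_apply sum_distrib_left mult.assoc)
    also have "\<dots> = (\<Sum>b\<in>B. (\<Sum>m\<in>A. t m * s m b) * b x)"
      by (subst sum.swap) (simp add: sum_distrib_right)
    also have "\<dots> = 0" using t(2) by simp
    finally show "(\<Sum>m\<in>A. t m * ?u m x) = 0" .
  qed
  obtain m where m: "m \<in> A" "t m \<noteq> 0" using t(1) by blast
  obtain k c where kc: "m = (k, c)" by (cases m)
  have "\<exists>r\<in>{0<..<L}. modeH k \<mu> r \<noteq> 0"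
  proof (rule ccontr)
    assume n: "\<not> ?thesis"
    have "modeH k \<mu> 0 = 0"
    proof (rule continuous_constant_on_closure[where S = "{0<..<L}" and f = "modeH k \<mu>"])
      show "continuous_on (closure {0<..<L}) (modeH k \<mu>)"
        using L_pos continuous_on_modeH[of k \<mu>] by simp
    qed (use n L_pos in auto)
    then show False using eta_nonzero[of 0] by (simp add: modeH_def W.rad_sol_0)
  qed
  then obtain r where r: "r \<in> {0<..<L}" "modeH k \<mu> r \<noteq> 0" by blast
  have cont: "continuous_on (ball 0 L) (?u m)" for m
  proof -
    have "continuous_on (ball 0 L) (\<lambda>z. hpoly (fst m) (snd m) z * modeH (fst m) \<mu> (norm z))"
      by (intro continuous_intros continuous_on_hpoly continuous_on_compose2[OF continuous_on_modeH]) auto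
    then show ?thesis by (rule continuous_on_eq) (simp add: modefun_def)
  qed
  have "0 = circ_coeff k c (\<lambda>x. \<Sum>m\<in>A. t m * ?u m x) r"
    unfolding zero by (simp add: circ_coeff_def)
  also have "\<dots> = (\<Sum>m\<in>A. t m * circ_coeff k c (?u m) r)"
    by (rule circ_coeff_sum[OF cont r(1)])
  also have "\<dots> = (\<Sum>m'\<in>A. if m' = m then t m * (r ^ k * modeH k \<mu> r * (if k = 0 then 2 * pi else pi)) else 0)"
  proof (rule sum.cong[OF refl])
    fix m' assume m': "m' \<in> A"
    show "t m' * circ_coeff k c (?u m') r =
        (if m' = m then t m * (r ^ k * modeH k \<mu> r * (if k = 0 then 2 * pi else pi)) else 0)"
      proof -
        obtain k' c' where kc': "m' = (k', c')" by (cases m')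
        have "(k, c) \<in> modes" "(k', c') \<in> modes" using m(1) m' A(2) kc kc' by auto
        from circ_coeff_modefun[OF r(1) this] show ?thesis by (auto simp: kc kc')
      qed
  qed
  also have "\<dots> = t m * (r ^ k * modeH k \<mu> r * (if k = 0 then 2 * pi else pi))"
    using m A(1) by simp
  finally show False using m r by (auto split: if_splits)
qed

end

section \<open>Counting eigenvalues\<close>

lemma revolve_eq_surf:
  assumes "meridian R L (\<lambda>r. F (L - r)) (\<lambda>r. G (L - r)) f1 g1 a"
  shows "revolve L F G = meridian.surf (\<lambda>r. F (L - r)) (\<lambda>r. G (L - r))"
  using assms by (simp add: fun_eq_iff meridian.surf_def revolve_def)

text \<open>Interior radii are tested, since at \<open>L\<close> the quotient is 1 by the
  normalization \<open>rho L = R\<close>.\<close>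

lemma (in meridian) surf_flat_disc:
  assumes "\<And>r. r \<in> {0<..<L} \<Longrightarrow> q r / eta r = 1"
  shows "surf ` cball 0 L = flat_disc R"
proof -
  have one: "q r / eta r = 1" if "r \<in> {0<..L}" for r
    using assms[of r] q_eta_L that by (cases "r = L") auto
  have flat: "L = R" "\<And>r. r \<in> {0..L} \<Longrightarrow> f r = r" "\<And>r. r \<in> {0..L} \<Longrightarrow> g r = 0"
    using flat_if_q_eta_1[OF one] by auto
  have s: "surf z = vector [z $ 1, z $ 2, 0]" if "z \<in> cball 0 L" for z
    using that flat(2)[of "norm z"] flat(3)[of "norm z"] by (cases "z = 0") (auto simp: surf_def)
  have ball: "z \<in> cball 0 L \<longleftrightarrow> (z $ 1)\<^sup>2 + (z $ 2)\<^sup>2 \<le> R\<^sup>2" for z :: "real^2"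
    using L_pos flat(1) abs_le_square_iff[of "norm z" R] by (simp add: norm_vec2_power2)
  show ?thesis
  proof (intro set_eqI iffI)
    fix p assume "p \<in> surf ` cball 0 L"
    then obtain z where z: "z \<in> cball 0 L" "p = surf z" by blast
    then show "p \<in> flat_disc R" using ball[of z] s[OF z(1)] by (simp add: flat_disc_def)
  next
    fix p :: "real^3" assume p: "p \<in> flat_disc R"
    define z :: "real^2" where "z = vector [p $ 1, p $ 2]"
    have z: "z \<in> cball 0 L" using p unfolding ball by (simp add: z_def flat_disc_def)
    have "z $ 1 = p $ 1" "z $ 2 = p $ 2" by (simp_all add: z_def)
    with s[OF z] have "surf z = p" using p by (simp add: flat_disc_def vec_eq_iff forall_3)
    with z show "p \<in> surf ` cball 0 L" by blast
  qed
qed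

text \<open>The indices up to \<open>j\<close> lie in the fibres over their values; later indices
  with the same value make this an inequality.\<close>

lemma dirichlet_eigenvalues_card_ge:
  assumes D: "dirichlet_eigenvalues A \<Omega> lam" and "1 \<le> j"
  shows "j \<le> (\<Sum>\<kappa>\<in>lam ` {1..j}. card {i. 1 \<le> i \<and> lam i = \<kappa>})"
proof -
  have fin: "finite {i. 1 \<le> i \<and> lam i = \<kappa>}" for \<kappa>
    using D by (simp add: dirichlet_eigenvalues_def)
  have "j = card {1..j}" by simp
  also have "\<dots> \<le> card (\<Union>\<kappa>\<in>lam ` {1..j}. {i. 1 \<le> i \<and> lam i = \<kappa>})"
    by (rule card_mono) (use fin in auto)
  also have "\<dots> \<le> (\<Sum>\<kappa>\<in>lam ` {1..j}. card {i. 1 \<le> i \<and> lam i = \<kappa>})"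
    by (rule card_UN_le) simp
  finally show ?thesis .
qed

text \<open>At least \<open>j\<close> indices carry values from \<open>N\<close>, and only
  \<open>j - 1\<close> positive indices lie below \<open>j\<close>, so one of them is at least
  \<open>j\<close>; monotonicity does the rest.\<close>

lemma dirichlet_eigenvalues_less:
  assumes D: "dirichlet_eigenvalues A \<Omega> lam" and N: "finite N" "\<And>\<nu>. \<nu> \<in> N \<Longrightarrow> \<nu> < \<mu>"
    and j: "1 \<le> j" "j \<le> (\<Sum>\<nu>\<in>N. card {i. 1 \<le> i \<and> lam i = \<nu>})"
  shows "lam j < \<mu>"
proof -
  have fin: "finite {i. 1 \<le> i \<and> lam i = \<kappa>}" for \<kappa>
    using D by (simp add: dirichlet_eigenvalues_def)
  let ?I = "\<Union>\<nu>\<in>N. {i. 1 \<le> i \<and> lam i = \<nu>}"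
  have "card ?I = (\<Sum>\<nu>\<in>N. card {i. 1 \<le> i \<and> lam i = \<nu>})"
    by (rule card_UN_disjoint) (use N fin in auto)
  then have "j \<le> card ?I" using j by simp
  have "\<not> ?I \<subseteq> {1..<j}"
  proof
    assume "?I \<subseteq> {1..<j}"
    then have "card ?I \<le> card {1..<j}" by (intro card_mono) auto
    with \<open>j \<le> card ?I\<close> j(1) show False by simp
  qed
  then obtain i where "i \<in> ?I" "j \<le> i" using j by fastforce
  moreover have "mono_on {1..} lam" using D by (simp add: dirichlet_eigenvalues_def)
  ultimately have "lam j \<le> lam i" "lam i < \<mu>"
    using j N(2) monotone_onD[of "{1..}" "(\<le>)" "(\<le>)" lam j i] by auto
  then show ?thesis by simp
qed

lemma finite_fibre:
  assumes "finite Q"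
  shows "finite {y. (x, y) \<in> Q}"
proof (rule finite_subset)
  show "{y. (x, y) \<in> Q} \<subseteq> snd ` Q" by force
qed (use assms in simp)

lemma card_eq_sum_card_fibre:
  assumes "finite Q"
  shows "card Q = (\<Sum>x\<in>fst ` Q. card {y. (x, y) \<in> Q})"
proof -
  have "Q = Sigma (fst ` Q) (\<lambda>x. {y. (x, y) \<in> Q})" by force
  then have "card Q = card (Sigma (fst ` Q) (\<lambda>x. {y. (x, y) \<in> Q}))" by (rule arg_cong)
  then show ?thesis using assms finite_fibre[OF assms] by simp
qed

theorem mainTheorem1:
  fixes R L :: real and F G :: "real \<Rightarrow> real" and lamS lamD :: "nat \<Rightarrow> real"
  assumes "surface_of_revolution R L F G"
    and "dirichlet_eigenvalues (laplace_beltrami (revolve L F G)) (ball 0 L) lamS"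
    and "dirichlet_eigenvalues laplacian (ball (0 :: real^2) R) lamD"
    and "revolve L F G ` cball 0 L \<noteq> flat_disc R"
  shows "\<forall>j\<ge>1. lamS j < lamD j"
proof (intro allI impI)
  fix j :: nat assume j: "1 \<le> j"
  obtain f1 g1 a where mer: "meridian R L (\<lambda>r. F (L - r)) (\<lambda>r. G (L - r)) f1 g1 a"
    using surface_of_revolution_meridian[OF assms(1)] by blast
  interpret meridian R L "\<lambda>r. F (L - r)" "\<lambda>r. G (L - r)" f1 g1 a by (rule mer)
  note rev = revolve_eq_surf[OF mer]
  have "\<exists>r\<in>{0<..<L}. q r / eta r \<noteq> 1"
    using surf_flat_disc assms(4) unfolding rev by blast
  then obtain r0 where "r0 \<in> {0<..<L}" and r0: "q r0 / eta r0 \<noteq> 1" by blast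
  then have "r0 \<in> {0<..L}" by simp
  from Phi_gt_1_near_0[OF this r0] obtain d where d: "0 < d" "\<And>s. s \<in> {0<..<d} \<Longrightarrow> 1 < Phi s" by blast
  let ?hD = "radial_weight.rad_sol (\<lambda>_. 1)"
  from mode_eigenvalue_injection[OF W.radial_weight_axioms Phi_ge_1 d]
  have "\<forall>k. \<exists>\<phi>. inj_on \<phi> {\<kappa>. ?hD k \<kappa> R = 0} \<and>
      (\<forall>\<kappa>. ?hD k \<kappa> R = 0 \<longrightarrow> \<phi> \<kappa> < \<kappa> \<and> W.rad_sol k (\<phi> \<kappa>) R = 0)" by blast
  from choice[OF this] obtain \<phi> where \<phi>: "\<And>k. inj_on (\<phi> k) {\<kappa>. ?hD k \<kappa> R = 0}"
    "\<And>k \<kappa>. ?hD k \<kappa> R = 0 \<Longrightarrow> \<phi> k \<kappa> < \<kappa>" "\<And>k \<kappa>. ?hD k \<kappa> R = 0 \<Longrightarrow> W.rad_sol k (\<phi> k \<kappa>) R = 0"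
    by blast
  \<comment> \<open>Multiplicities of the disc are traded for modes, which carry the angular
    frequency that \<phi> depends on.\<close>
  have "\<forall>\<kappa>. \<exists>M. finite M \<and> card M = card {i. 1 \<le> i \<and> lamD i = \<kappa>} \<and> M \<subseteq> modes \<and>
      (\<forall>(k, c)\<in>M. ?hD k \<kappa> R = 0)"
  proof
    fix \<kappa>
    obtain B where B: "finite B" "\<not> fun_space.dependent B"
      "fun_space.span B = dirichlet_eigenspace laplacian (ball (0 :: real^2) R) \<kappa>"
      "card B = card {i. 1 \<le> i \<and> lamD i = \<kappa>}"
      using assms(3) unfolding dirichlet_eigenvalues_def by blast
    show "\<exists>M. finite M \<and> card M = card {i. 1 \<le> i \<and> lamD i = \<kappa>} \<and> M \<subseteq> modes \<and>
        (\<forall>(k, c)\<in>M. ?hD k \<kappa> R = 0)"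
      unfolding B(4)[symmetric] by (rule disc_eigenspace_modes[OF R_pos B(1,2,3)])
  qed
  from choice[OF this] obtain M where MM: "\<forall>\<kappa>. finite (M \<kappa>) \<and> card (M \<kappa>) = card {i. 1 \<le> i \<and> lamD i = \<kappa>} \<and>
      M \<kappa> \<subseteq> modes \<and> (\<forall>(k, c)\<in>M \<kappa>. ?hD k \<kappa> R = 0)" by blast
  have M: "finite (M \<kappa>)" "card (M \<kappa>) = card {i. 1 \<le> i \<and> lamD i = \<kappa>}" "M \<kappa> \<subseteq> modes"
    "\<And>k c. (k, c) \<in> M \<kappa> \<Longrightarrow> ?hD k \<kappa> R = 0" for \<kappa>
    using spec[OF MM, of \<kappa>] by auto
  let ?\<Lambda> = "lamD ` {1..j}"
  let ?P = "Sigma ?\<Lambda> M"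
  text \<open>\<open>T\<close> sends a mode of the disc to the mode of the surface with the same angular part and the same
    final Pruefer angle.\<close>
  define T where "T p = (\<phi> (fst (snd p)) (fst p), snd p)" for p :: "real \<times> nat \<times> complex"
  have "inj_on T ?P"
  proof (rule inj_onI)
    fix p p' assume p: "p \<in> ?P" "p' \<in> ?P" "T p = T p'"
    obtain \<kappa> k c \<kappa>' where eq: "p = (\<kappa>, k, c)" "p' = (\<kappa>', k, c)" "\<phi> k \<kappa> = \<phi> k \<kappa>'"
      using p(3) by (cases p; cases p') (auto simp: T_def)
    then have "?hD k \<kappa> R = 0" "?hD k \<kappa>' R = 0" using p M(4) by auto
    then have "\<kappa> = \<kappa>'" using \<phi>(1)[of k] eq(3) by (simp add: inj_on_def)
    then show "p = p'" using eq by simp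
  qed
  \<comment> \<open>Pairs of a surface parameter and a mode. Different \<kappa> may lead to the same
    parameter, so pairs are counted and not values.\<close>
  let ?Q = "T ` ?P"
  let ?N = "fst ` ?Q"
  have finQ: "finite ?Q" by (intro finite_imageI finite_SigmaI M(1)) auto
  have jQ: "j \<le> card ?Q"
  proof -
    have "j \<le> (\<Sum>\<kappa>\<in>?\<Lambda>. card (M \<kappa>))"
      using dirichlet_eigenvalues_card_ge[OF assms(3) j] by (simp only: M(2))
    also have "\<dots> = card ?P" using M(1) by simp
    also have "\<dots> = card ?Q" using card_image[OF \<open>inj_on T ?P\<close>] by simp
    finally show ?thesis .
  qed
  \<comment> \<open>Every parameter in \<open>?Q\<close> is strictly below some
    \<open>lamD i\<close> with \<open>i \<le> j\<close>, hence below \<open>lamD j\<close>.\<close>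
  have Q: "(k, c) \<in> modes" "W.rad_sol k \<nu> R = 0" "\<nu> < lamD j" if "(\<nu>, k, c) \<in> ?Q" for \<nu> k c
  proof -
    from that obtain p where p: "(\<nu>, k, c) = T p" "p \<in> ?P" by (rule imageE)
    define \<kappa> where "\<kappa> = fst p"
    have k: "\<kappa> \<in> ?\<Lambda>" "(k, c) \<in> M \<kappa>" "\<nu> = \<phi> k \<kappa>"
      using p unfolding T_def \<kappa>_def by (cases p; simp)+
    have "\<kappa> \<le> lamD j"
    proof -
      from k(1) obtain i where "i \<in> {1..j}" "\<kappa> = lamD i" by blast
      moreover have "mono_on {1..} lamD" using assms(3) by (simp add: dirichlet_eigenvalues_def)
      ultimately show ?thesis using monotone_onD[of "{1..}" "(\<le>)" "(\<le>)" lamD i j] j by auto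
    qed
    with k \<phi>(2,3)[OF M(4)[OF k(2)]] M(3) show "(k, c) \<in> modes" "W.rad_sol k \<nu> R = 0" "\<nu> < lamD j"
      by auto
  qed
  \<comment> \<open>Modes over the same \<nu> give independent eigenfunctions of the surface, so the
    multiplicity of \<nu> in \<open>lamS\<close> bounds their number.\<close>
  have slice: "card {m. (\<nu>, m) \<in> ?Q} \<le> card {i. 1 \<le> i \<and> lamS i = \<nu>}" for \<nu>
  proof -
    obtain B where B: "finite B"
      "fun_space.span B = dirichlet_eigenspace (laplace_beltrami (revolve L F G)) (ball 0 L) \<nu>"
      "card B = card {i. 1 \<le> i \<and> lamS i = \<nu>}"
      using assms(2) unfolding dirichlet_eigenvalues_def by blast
    have "finite {m. (\<nu>, m) \<in> ?Q}" by (rule finite_fibre[OF finQ])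
    then have "card {m. (\<nu>, m) \<in> ?Q} \<le> card B"
    proof (rule surface_eigenspace_modes[OF _ _ _ B(1) B(2)[unfolded rev]])
      show "{m. (\<nu>, m) \<in> ?Q} \<subseteq> modes"
      proof
        fix m assume "m \<in> {m. (\<nu>, m) \<in> ?Q}"
        then have "(\<nu>, fst m, snd m) \<in> ?Q" by (simp only: prod.collapse mem_Collect_eq)
        from Q(1)[OF this] show "m \<in> modes" by simp
      qed
      show "W.rad_sol k \<nu> R = 0" if "(k, c) \<in> {m. (\<nu>, m) \<in> ?Q}" for k c
        using that unfolding mem_Collect_eq by (rule Q(2))
    qed
    then show ?thesis by (simp only: B(3))
  qed
  have "card ?Q = (\<Sum>\<nu>\<in>?N. card {m. (\<nu>, m) \<in> ?Q})"
    by (rule card_eq_sum_card_fibre[OF finQ])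
  also have "\<dots> \<le> (\<Sum>\<nu>\<in>?N. card {i. 1 \<le> i \<and> lamS i = \<nu>})"
    by (rule sum_mono) (rule slice)
  finally have le: "j \<le> (\<Sum>\<nu>\<in>?N. card {i. 1 \<le> i \<and> lamS i = \<nu>})" using jQ by simp
  show "lamS j < lamD j"
  proof (rule dirichlet_eigenvalues_less[OF assms(2) _ _ j le])
    show "finite ?N" using finQ by blast
    show "\<nu> < lamD j" if "\<nu> \<in> ?N" for \<nu>
    proof -
      from that obtain k c where "(\<nu>, k, c) \<in> ?Q" by (metis (no_types, lifting) imageE prod.collapse)
      then show ?thesis by (rule Q(3))
    qed
  qed
qed

end
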